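(* Let $\mathcal{H}$ be a complex Hilbert space and let $T:\mathcal{H}\to\mathcal{H}$ be a bounded linear operator whose numerical range $W(T)=\{\langle Tx,x\rangle:x\in\mathcal{H},\ \|x\|=1\}$ has non-empty interior. Let $W:=\overline{W(T)}$. Then for every complex polynomial $p$, $$\|p(T)\|\le\Bigl(1+\sqrt{1+a(W)}\Bigr)\sup_{z\in W(T)}|p(z)|.$$
   Context: The set $W=\overline{W(T)}$ is a compact convex set with non-empty interior. The analytic configuration constant $a(\Omega)$ of a compact convex set $\Omega\subset\mathbb{C}$ with non-empty interior is defined as follows. The boundary $\partial\Omega$ is a rectifiable simple closed curve, oriented counter-clockwise; $s$ denotes arclength measure on $\partial\Omega$. At every $\zeta\in\partial\Omega$ the one-sided tangent angles $\alpha_-(\zeta)\le\alpha_+(\zeta)$ (incoming and outgoing, with branches chosen so that $0\le\alpha_+(\zeta)-\alpha_-(\zeta)<\pi$) exist; $\zeta$ is called a corner if $\alpha_-(\zeta)<\alpha_+(\zeta)$, and there are at most countably many corners. Put $\theta_\zeta:=\pi-\alpha_+(\zeta)+\alpha_-(\zeta)\in(0,\pi]$ (the interior angle at $\zeta$; it equals $\pi$ if $\zeta$ is not a corner). At a non-corner $\sigma$ let $T(\sigma)$ be the unit tangent (in the positive direction; not to be confused with the operator) and $N(\sigma)=-iT(\sigma)$ the outward unit normal. For $\zeta\in\partial\Omega$ let $\mu_\zeta$ be the Borel probability measure on $\partial\Omega$ given by $d\mu_\zeta=(1-\theta_\zeta/\pi)\,d\delta_\zeta+\rho_\zeta\,ds$,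 where $\delta_\zeta$ is the unit point mass at $\zeta$ and $\rho_\zeta(\sigma)=\frac1\pi\operatorname{Re}\Big(\frac{N(\sigma)}{\sigma-\zeta}\Big)$ for non-corners $\sigma\ne\zeta$. Let $C(\partial\Omega)$ be the space of complex-valued continuous functions on $\partial\Omega$. The Neumann–Poincaré operator $K_\Omega:C(\partial\Omega)\to C(\partial\Omega)$ is $K_\Omega f(\zeta):=\int_{\partial\Omega}f\,d\mu_\zeta$, $\zeta\in\partial\Omega$; it fixes the constant function $\mathbf{1}$, so it acts on $C(\partial\Omega)/\mathbb{C}\mathbf{1}$, which has the quotient norm $\|g+\mathbb{C}\mathbf{1}\|_{\partial\Omega}=\min_{\lambda\in\mathbb{C}}\max_{\zeta\in\partial\Omega}|g(\zeta)-\lambda|$. Let $\mathcal{A}(\Omega)$ be the space of functions continuous on $\Omega$ and analytic in the interior of $\Omega$, regarded as a subspace of $C(\partial\Omega)$ by restriction to $\partial\Omega$. The analytic configuration constant is the operator norm $a(\Omega):=\|K_\Omega:\mathcal{A}(\Omega)/\mathbb{C}\mathbf{1}\to C(\partial\Omega)/\mathbb{C}\mathbf{1}\|$. *)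

theory Defs
  imports "HOL-Complex_Analysis.Complex_Analysis"
begin

section \<open>Complex Hilbert spaces and bounded operators\<close>

class complex_vector = real_vector +
  fixes scaleC :: "complex \<Rightarrow> 'a \<Rightarrow> 'a"  (infixr \<open>*\<^sub>C\<close> 75)
  assumes scaleC_add_right: "a *\<^sub>C (x + y) = a *\<^sub>C x + a *\<^sub>C y"
    and scaleC_add_left: "(a + b) *\<^sub>C x = a *\<^sub>C x + b *\<^sub>C x"
    and scaleC_scaleC: "a *\<^sub>C (b *\<^sub>C x) = (a * b) *\<^sub>C x"
    and scaleC_one: "1 *\<^sub>C x = x"
    and scaleR_scaleC: "r *\<^sub>R x = complex_of_real r *\<^sub>C x"

text \<open>The inner product is linear in its first argument.\<close>

class complex_inner = complex_vector + real_normed_vector +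
  fixes cinner :: "'a \<Rightarrow> 'a \<Rightarrow> complex"
  assumes cinner_commute: "cinner x y = cnj (cinner y x)"
    and cinner_add_left: "cinner (x + y) z = cinner x z + cinner y z"
    and cinner_scaleC_left: "cinner (a *\<^sub>C x) y = a * cinner x y"
    and cinner_ge_zero: "0 \<le> Re (cinner x x)"
    and cinner_eq_zero_iff: "cinner x x = 0 \<longleftrightarrow> x = 0"
    and norm_eq_sqrt_cinner: "norm x = sqrt (Re (cinner x x))"

class chilbert_space = complex_inner + complete_space
begin
subclass banach ..
end

definition bounded_clinear :: "('a::complex_inner \<Rightarrow> 'b::complex_inner) \<Rightarrow> bool" where
  "bounded_clinear T \<longleftrightarrow> bounded_linear T \<and> (\<forall>c x. T (c *\<^sub>C x) = c *\<^sub>C T x)"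

definition numerical_range :: "('a::complex_inner \<Rightarrow> 'a) \<Rightarrow> complex set" where
  "numerical_range T = {cinner (T x) x | x. norm x = 1}"

definition poly_operator :: "complex poly \<Rightarrow> ('a::complex_inner \<Rightarrow> 'a) \<Rightarrow> 'a \<Rightarrow> 'a" where
  "poly_operator p T = (\<lambda>x. \<Sum>k\<le>degree p. coeff p k *\<^sub>C (T ^^ k) x)"


section \<open>The boundary of a planar convex body\<close>

definition curve_length :: "(real \<Rightarrow> complex) \<Rightarrow> real \<Rightarrow> real \<Rightarrow> ennreal" where
  "curve_length g a b =
     (SUP ts \<in> {ts. sorted ts \<and> set ts \<subseteq> {a..b}}.
        \<Sum>i<length ts - 1. ennreal (dist (g (ts ! i)) (g (ts ! Suc i))))"

text \<open>
  A counter-clockwise parametrization of \<open>\<partial>\<Omega>\<close> by arclength, extended periodically to all of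
  \<open>\<real>\<close>; \<open>L\<close> is the perimeter.
\<close>

definition arclength_parametrization :: "complex set \<Rightarrow> real \<Rightarrow> (real \<Rightarrow> complex) \<Rightarrow> bool" where
  "arclength_parametrization \<Omega> L g \<longleftrightarrow>
     0 < L \<and> (\<forall>t. g (t + L) = g t) \<and> range g = frontier \<Omega> \<and>
     simple_path (\<lambda>t. g (L * t)) \<and>
     (\<forall>z\<in>interior \<Omega>. winding_number (\<lambda>t. g (L * t)) z = 1) \<and>
     (\<forall>a b. a \<le> b \<longrightarrow> curve_length g a b = ennreal (b - a))"

text \<open>
  For a compact convex set with non-empty interior such a parametrization exists and is unique up
  to a shift \<open>t \<mapsto> t + c\<close>; none of the notions below that refer to it depends on the choice.
\<close>

definition perimeter :: "complex set \<Rightarrow> real" where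
  "perimeter \<Omega> = fst (SOME (L, g). arclength_parametrization \<Omega> L g)"

definition boundary_curve :: "complex set \<Rightarrow> real \<Rightarrow> complex" where
  "boundary_curve \<Omega> = snd (SOME (L, g). arclength_parametrization \<Omega> L g)"

definition arclength_measure :: "complex set \<Rightarrow> complex measure" where
  "arclength_measure \<Omega> =
     distr (restrict_space lborel {0..<perimeter \<Omega>}) (restrict_space borel (frontier \<Omega>))
       (boundary_curve \<Omega>)"

text \<open>
  \<open>tangent_angles \<Omega> \<zeta> \<alpha> \<beta>\<close>: \<open>\<alpha>\<close> is an incoming and \<open>\<beta>\<close> an outgoing tangent angle at \<open>\<zeta>\<close>.
  They are determined up to a common multiple of \<open>2 \<pi>\<close>.
\<close>

definition tangent_angles :: "complex set \<Rightarrow> complex \<Rightarrow> real \<Rightarrow> real \<Rightarrow> bool" where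
  "tangent_angles \<Omega> \<zeta> \<alpha> \<beta> \<longleftrightarrow>
     0 \<le> \<beta> - \<alpha> \<and> \<beta> - \<alpha> < pi \<and>
     (\<exists>t. boundary_curve \<Omega> t = \<zeta> \<and>
        ((\<lambda>u. sgn (\<zeta> - boundary_curve \<Omega> u)) \<longlongrightarrow> cis \<alpha>) (at_left t) \<and>
        ((\<lambda>u. sgn (boundary_curve \<Omega> u - \<zeta>)) \<longlongrightarrow> cis \<beta>) (at_right t))"

definition corner :: "complex set \<Rightarrow> complex \<Rightarrow> bool" where
  "corner \<Omega> \<zeta> \<longleftrightarrow> (\<exists>\<alpha> \<beta>. tangent_angles \<Omega> \<zeta> \<alpha> \<beta> \<and> \<alpha> < \<beta>)"

definition interior_angle :: "complex set \<Rightarrow> complex \<Rightarrow> real" where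
  "interior_angle \<Omega> \<zeta> = (THE \<theta>. \<exists>\<alpha> \<beta>. tangent_angles \<Omega> \<zeta> \<alpha> \<beta> \<and> \<theta> = pi - \<beta> + \<alpha>)"

text \<open>Meaningful only at non-corners, where the two tangent angles agree.\<close>

definition unit_tangent :: "complex set \<Rightarrow> complex \<Rightarrow> complex" where
  "unit_tangent \<Omega> \<sigma> = (THE v. \<exists>\<alpha>. tangent_angles \<Omega> \<sigma> \<alpha> \<alpha> \<and> v = cis \<alpha>)"

definition outward_normal :: "complex set \<Rightarrow> complex \<Rightarrow> complex" where
  "outward_normal \<Omega> \<sigma> = - \<i> * unit_tangent \<Omega> \<sigma>"


section \<open>The Neumann--Poincare operator and the analytic configuration constant\<close>

text \<open>
  The value \<open>0\<close> at \<open>\<sigma> = \<zeta>\<close> and at the (countably many) corners is immaterial: these points form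
  a null set for arclength.
\<close>

definition np_kernel :: "complex set \<Rightarrow> complex \<Rightarrow> complex \<Rightarrow> real" where
  "np_kernel \<Omega> \<zeta> \<sigma> =
     (if \<sigma> = \<zeta> \<or> corner \<Omega> \<sigma> then 0 else Re (outward_normal \<Omega> \<sigma> / (\<sigma> - \<zeta>)) / pi)"

text \<open>
  The Borel measure \<open>(1 - \<theta>/\<pi>) \<delta> + \<rho> ds\<close> on \<open>\<partial>\<Omega>\<close>. Both coefficients are non-negative
  for convex \<open>\<Omega>\<close>, so the coercions to \<^typ>\<open>ennreal\<close> lose nothing.
\<close>

definition np_measure :: "complex set \<Rightarrow> complex \<Rightarrow> complex measure" where
  "np_measure \<Omega> \<zeta> =
     measure_of (frontier \<Omega>) (sets (restrict_space borel (frontier \<Omega>)))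
       (\<lambda>A. ennreal (1 - interior_angle \<Omega> \<zeta> / pi) * indicator A \<zeta>
          + emeasure (density (arclength_measure \<Omega>) (\<lambda>\<sigma>. ennreal (np_kernel \<Omega> \<zeta> \<sigma>))) A)"

lemma emeasure_np_measure:
  assumes "A \<in> sets (restrict_space borel (frontier \<Omega>))"
  shows "emeasure (np_measure \<Omega> \<zeta>) A =
    ennreal (1 - interior_angle \<Omega> \<zeta> / pi) * indicator A \<zeta>
      + emeasure (density (arclength_measure \<Omega>) (\<lambda>\<sigma>. ennreal (np_kernel \<Omega> \<zeta> \<sigma>))) A"
proof -
  define B where "B = restrict_space (borel :: complex measure) (frontier \<Omega>)"
  define D where "D = density (arclength_measure \<Omega>) (\<lambda>\<sigma>. ennreal (np_kernel \<Omega> \<zeta> \<sigma>))"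
  define c where "c = ennreal (1 - interior_angle \<Omega> \<zeta> / pi)"
  define m where "m = (\<lambda>A. c * indicator A \<zeta> + emeasure D A)"
  have sp: "space B = frontier \<Omega>" and sD: "sets D = sets B"
    by (simp_all add: B_def D_def space_restrict_space arclength_measure_def)
  have eq: "np_measure \<Omega> \<zeta> = measure_of (space B) (sets B) m"
    unfolding np_measure_def m_def c_def D_def by (simp add: sp) (simp add: B_def)
  have "countably_additive (sets B) m"
  proof (rule countably_additiveI)
    fix F :: "nat \<Rightarrow> complex set"
    assume F: "range F \<subseteq> sets B" "disjoint_family F" "(\<Union>i. F i) \<in> sets B"
    have 1: "(\<Sum>i. emeasure D (F i)) = emeasure D (\<Union>i. F i)"
      using F by (intro suminf_emeasure) (auto simp: sD)
    have 2: "(\<Sum>i. indicator (F i) \<zeta> :: ennreal) = indicator (\<Union>i. F i) \<zeta>"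
      using F(2) by (rule suminf_indicator)
    show "(\<Sum>i. m (F i)) = m (\<Union>i. F i)"
      unfolding m_def by (subst suminf_add[symmetric]) (auto simp: 1 2)
  qed
  then have "emeasure (measure_of (space B) (sets B) m) A = m A"
    using assms
    by (intro emeasure_measure_of_sigma[OF _ _ _ ])
       (auto simp: positive_def m_def B_def[symmetric] sets.sigma_algebra_axioms)
  then show ?thesis unfolding eq m_def c_def D_def .
qed

definition np_operator :: "complex set \<Rightarrow> (complex \<Rightarrow> complex) \<Rightarrow> complex \<Rightarrow> complex" where
  "np_operator \<Omega> f \<zeta> = (\<integral>\<sigma>. f \<sigma> \<partial>np_measure \<Omega> \<zeta>)"

text \<open>
  The norm of the class of \<open>g\<close> in \<open>C(\<partial>\<Omega>)/\<complex>\<one>\<close>; for \<open>g\<close> continuous on \<open>\<partial>\<Omega>\<close>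
  the infimum and the supremum are attained.
\<close>

definition boundary_quotient_norm :: "complex set \<Rightarrow> (complex \<Rightarrow> complex) \<Rightarrow> real" where
  "boundary_quotient_norm \<Omega> g = (INF c. SUP \<zeta>\<in>frontier \<Omega>. cmod (g \<zeta> - c))"

definition analytic_functions :: "complex set \<Rightarrow> (complex \<Rightarrow> complex) set" where
  "analytic_functions \<Omega> = {f. continuous_on \<Omega> f \<and> f analytic_on interior \<Omega>}"

text \<open>
  The operator norm is taken as for \<^const>\<open>onorm\<close>, with the zero class contributing \<open>0 / 0 = 0\<close>.
\<close>

definition analytic_configuration_constant :: "complex set \<Rightarrow> real" where
  "analytic_configuration_constant \<Omega> =
     (SUP f\<in>analytic_functions \<Omega>.
        boundary_quotient_norm \<Omega> (np_operator \<Omega> f) / boundary_quotient_norm \<Omega> f)"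

end

theory Submission
  imports Defs
begin

text \<open>
  Let \<open>S\<close> have its numerical range well inside \<open>\<Omega>\<close> and let \<open>|f| \<le> 1\<close> on \<open>\<Omega>\<close>. With \<open>G\<close> the Cauchy
  transform of \<open>cnj f\<close>, the operator \<open>f(S) + G(S)\<^sup>*\<close> is the integral of \<open>f\<close> against a positive operator
  kernel of total mass \<open>2\<close> (the numerical range lies on the inner side of every tangent), so its norm is
  at most \<open>2\<close>; on the boundary \<open>cnj G\<close> is the Neumann--Poincare transform \<open>K f\<close>, so that \<open>|G - c| \<le> a\<close>
  for a suitable constant \<open>c\<close>. If \<open>f\<close> is nearly extremal for \<open>\<kappa> = sup \<parallel>f(S)\<parallel>\<close> and the unit vector \<open>x\<close>
  nearly maximises \<open>\<parallel>f(S) x\<parallel>\<close>, then \<open>\<langle>f(S) x, x\<rangle>\<close> is nearly \<open>0\<close>. Hence \<open>G\<close> may be replaced by \<open>G - c\<close>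
  in the Crouzeix--Palencia argument, which yields \<open>\<kappa>\<^sup>2 \<le> 2 \<kappa> + a\<close>, that is \<open>\<kappa> \<le> 1 + sqrt (1 + a)\<close>. An
  operator whose numerical range reaches the boundary is the limit of its dilations \<open>r S + (1 - r) z0\<close>
  about an interior point.\<close>

section \<open>Complex inner product spaces\<close>

text \<open>The quadratic inequality comes from testing the norm bound on the pair \<open>x\<close>,
  \<open>A x\<close>, where \<open>A = f(S)\<close> and \<open>q\<close> is a polynomial close to
  the translated companion. The term with \<open>c\<close> contains the conjugate of <A x, x>.
  Near-extremality also makes \<open>x\<close> almost an eigenvector of the product of
  \<open>A\<close> with its adjoint, for the eigenvalue \<open>K\<^sup>2\<close>; so <q(S) A x, x>
  is almost \<open>1 / K\<^sup>2\<close> times <(f q f)(S) x, A x>, hence at most about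
  \<open>a\<close>, because \<open>f q f\<close> is bounded by about \<open>a\<close> on
  \<open>\<Omega>\<close>. What remains is \<open>2 * K\<close>. Two obstacles shape the rest.
  Functions of the operator are polynomials only, and extremal functions or vectors need not exist:
  every step carries an error, and the Cauchy transform acts through a sesquilinear form until a
  polynomial replaces it. That replacement works strictly inside \<open>\<Omega>\<close>, whereas
  \<open>a\<close> concerns boundary values; the double layer potential, continuous up to the
  boundary, connects them. And the boundary curve is a \<open>SOME\<close> choice, Lipschitz with
  possibly infinitely many corners, so its existence, tangents and line integrals have to be
  established.\<close>

lemma scaleC_zero_left [simp]: "0 *\<^sub>C (x::'a::complex_vector) = 0"
  using scaleR_scaleC[of 0 x] by simp

lemma scaleC_zero_right [simp]: "a *\<^sub>C (0::'a::complex_vector) = 0"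
  using scaleC_add_right[of a 0 "0::'a"] by simp

lemma scaleC_minus_left: "(- a) *\<^sub>C (x::'a::complex_vector) = - (a *\<^sub>C x)"
  using scaleC_add_left[of a "- a" x] by (simp add: eq_neg_iff_add_eq_0 add.commute)

lemma scaleC_minus_right: "a *\<^sub>C (- x::'a::complex_vector) = - (a *\<^sub>C x)"
  using scaleC_add_right[of a x "- x"] by (simp add: eq_neg_iff_add_eq_0 add.commute)

lemma scaleC_diff_right: "a *\<^sub>C (x - y::'a::complex_vector) = a *\<^sub>C x - a *\<^sub>C y"
  using scaleC_add_right[of a x "- y"] by (simp add: scaleC_minus_right)

lemma scaleC_diff_left: "(a - b) *\<^sub>C (x::'a::complex_vector) = a *\<^sub>C x - b *\<^sub>C x"
  using scaleC_add_left[of a "- b" x] by (simp add: scaleC_minus_left)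

lemma scaleC_sum_right: "a *\<^sub>C (\<Sum>i\<in>I. f i :: 'a::complex_vector) = (\<Sum>i\<in>I. a *\<^sub>C f i)"
  by (induction I rule: infinite_finite_induct) (auto simp: scaleC_add_right)

lemma cinner_add_right: "cinner x (y + z) = cinner x y + cinner x (z::'a::complex_inner)"
  by (metis cinner_add_left cinner_commute complex_cnj_add)

lemma cinner_scaleC_right: "cinner x (a *\<^sub>C y) = cnj a * cinner x (y::'a::complex_inner)"
  by (metis cinner_commute cinner_scaleC_left complex_cnj_mult)

lemma cinner_zero_left [simp]: "cinner 0 (x::'a::complex_inner) = 0"
  using cinner_add_left[of 0 0 x] by simp

lemma cinner_zero_right [simp]: "cinner (x::'a::complex_inner) 0 = 0"
  using cinner_add_right[of x 0 0] by simp

lemma cinner_minus_left: "cinner (- x) (y::'a::complex_inner) = - cinner x y"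
  using cinner_add_left[of x "- x" y] by (simp add: eq_neg_iff_add_eq_0 add.commute)

lemma cinner_minus_right: "cinner x (- y::'a::complex_inner) = - cinner x y"
  using cinner_add_right[of x y "- y"] by (simp add: eq_neg_iff_add_eq_0 add.commute)

lemma cinner_diff_left: "cinner (x - y) (z::'a::complex_inner) = cinner x z - cinner y z"
  using cinner_add_left[of x "- y" z] by (simp add: cinner_minus_left)

lemma cinner_diff_right: "cinner x (y - z::'a::complex_inner) = cinner x y - cinner x z"
  using cinner_add_right[of x y "- z"] by (simp add: cinner_minus_right)

lemma cinner_sum_left: "cinner (\<Sum>i\<in>I. f i) (y::'a::complex_inner) = (\<Sum>i\<in>I. cinner (f i) y)"
  by (induction I rule: infinite_finite_induct) (auto simp: cinner_add_left)

lemma cinner_self: "cinner x (x::'a::complex_inner) = of_real ((norm x)\<^sup>2)"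
proof -
  have "Im (cinner x x) = 0"
    using cinner_commute[of x x] by (metis cnj.simps(2) neg_equal_zero)
  then show ?thesis
    by (simp add: complex_eq_iff norm_eq_sqrt_cinner cinner_ge_zero)
qed

lemma Re_cinner_commute: "Re (cinner x (y::'a::complex_inner)) = Re (cinner y x)"
  by (metis cinner_commute cnj.simps(1))

lemma norm_scaleC [simp]: "norm (a *\<^sub>C (x::'a::complex_inner)) = cmod a * norm x"
proof -
  have "complex_of_real ((norm (a *\<^sub>C x))\<^sup>2) = of_real ((cmod a * norm x)\<^sup>2)"
    using cinner_scaleC_left[of a x "a *\<^sub>C x"] cinner_scaleC_right[of x a x]
      complex_norm_square[of a]
    by (simp add: cinner_self power_mult_distrib mult.assoc)
  then have "(norm (a *\<^sub>C x))\<^sup>2 = (cmod a * norm x)\<^sup>2"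
    using of_real_eq_iff by blast
  then show ?thesis by (simp add: power2_eq_iff_nonneg)
qed

lemma norm_add_sq: "(norm (x + y::'a::complex_inner))\<^sup>2 = (norm x)\<^sup>2 + 2 * Re (cinner x y) + (norm y)\<^sup>2"
proof -
  have "complex_of_real ((norm (x + y))\<^sup>2) = cinner x x + cinner x y + cinner y x + cinner y y"
    unfolding cinner_self[symmetric] by (simp add: cinner_add_left cinner_add_right)
  then have "(norm (x + y))\<^sup>2 = Re (cinner x x + cinner x y + cinner y x + cinner y y)"
    by (metis Re_complex_of_real)
  then show ?thesis by (simp add: cinner_self Re_cinner_commute[of y x])
qed

text \<open>Three forms are meant: the inner product, the defect of an operator from its norm, and
  the kernel of the boundary integral. The last two may degenerate, so no definiteness is
  assumed.\<close>

locale psd_form =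
  fixes Q :: "'a::complex_vector \<Rightarrow> 'a \<Rightarrow> complex"
  assumes add_left: "Q (x + y) z = Q x z + Q y z"
    and scale_left: "Q (a *\<^sub>C x) y = a * Q x y"
    and herm: "Q y x = cnj (Q x y)"
    and nonneg: "0 \<le> Re (Q x x)"
begin

lemma quadratic_nonneg:
  "0 \<le> Re (Q x x) - 2 * t * cmod (Q x y) + t\<^sup>2 * Re (Q y y)"
proof -
  \<comment> \<open>The phase of \<open>w\<close> makes the cross term equal to
    \<open>- t * cmod (Q x y)\<close>. If \<open>Q x y = 0\<close> then \<open>w = 0\<close>, so the
    last term is only bounded, not computed.\<close>
  define w where "w = - (of_real t * sgn (Q x y))"
  have ar: "Q x (y + z) = Q x y + Q x z" for x y z
    by (metis add_left herm complex_cnj_add)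
  have sr: "Q x (a *\<^sub>C y) = cnj a * Q x y" for a x y
    by (metis scale_left herm complex_cnj_mult)
  have e: "Q (x + w *\<^sub>C y) (x + w *\<^sub>C y)
      = Q x x + cnj w * Q x y + cnj (cnj w * Q x y) + w * cnj w * Q y y"
    by (simp add: add_left scale_left ar sr herm[of x y] algebra_simps)
  have 1: "cnj w * Q x y = - of_real (t * cmod (Q x y))"
  proof (cases "Q x y = 0")
    case False
    have "cnj (sgn (Q x y)) * Q x y = of_real (cmod (Q x y))"
      using False complex_norm_square[of "Q x y"]
      by (simp add: sgn_eq mult.commute[of "cnj (Q x y)"] power2_eq_square field_simps)
    then show ?thesis by (simp add: w_def)
  qed simp
  have 2: "Re (w * cnj w * Q y y) \<le> t\<^sup>2 * Re (Q y y)"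
  proof -
    have "w * cnj w = of_real ((cmod w)\<^sup>2)" using complex_norm_square[of w] by simp
    then have "Re (w * cnj w * Q y y) = (cmod w)\<^sup>2 * Re (Q y y)"
      by (metis Re_complex_of_real Im_complex_of_real times_complex.sel(1) mult_zero_left diff_zero)
    moreover have "(cmod w)\<^sup>2 \<le> t\<^sup>2"
      by (auto simp: w_def norm_mult norm_sgn)
    ultimately show ?thesis using mult_right_mono[OF _ nonneg[of y]] by metis
  qed
  have "0 \<le> Re (Q (x + w *\<^sub>C y) (x + w *\<^sub>C y))" by (rule nonneg)
  also have "\<dots> \<le> Re (Q x x) - 2 * t * cmod (Q x y) + t\<^sup>2 * Re (Q y y)"
    unfolding e 1 using 2 by simp
  finally show ?thesis .
qed

lemma arith_mean: "cmod (Q x y) \<le> (Re (Q x x) + Re (Q y y)) / 2"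
  using quadratic_nonneg[of x 1 y] by simp

lemma Cauchy_Schwarz: "(cmod (Q x y))\<^sup>2 \<le> Re (Q x x) * Re (Q y y)"
proof (cases "Re (Q y y) = 0")
  case True
  have "cmod (Q x y) = 0"
  proof (rule ccontr)
    assume "cmod (Q x y) \<noteq> 0"
    \<comment> \<open>With \<open>Re (Q y y) = 0\<close> the quadratic is affine in
      \<open>t\<close>; this \<open>t\<close> would make it \<open>- Re (Q x x) - 2\<close>, which
      is negative.\<close>
    then have "2 * ((Re (Q x x) + 1) / cmod (Q x y)) * cmod (Q x y) = 2 * (Re (Q x x) + 1)" by simp
    then have "0 \<le> Re (Q x x) - 2 * (Re (Q x x) + 1)"
      using quadratic_nonneg[of x "(Re (Q x x) + 1) / cmod (Q x y)" y] True by simp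
    moreover define A where "A = Re (Q x x)"
    moreover have "0 \<le> A" unfolding A_def by (rule nonneg)
    ultimately show False by simp
  qed
  then show ?thesis using True by simp
next
  case False
  then have "0 < Re (Q y y)" using nonneg[of y] by linarith
  then show ?thesis
    using quadratic_nonneg[of x "cmod (Q x y) / Re (Q y y)" y]
    by (simp add: field_simps power2_eq_square)
qed

end

lemma psd_form_cinner: "psd_form (cinner :: 'a::complex_inner \<Rightarrow> 'a \<Rightarrow> complex)"
  by unfold_locales
    (auto simp: cinner_add_left cinner_scaleC_left cinner_ge_zero intro: cinner_commute)

lemma cinner_norm_le: "cmod (cinner x (y::'a::complex_inner)) \<le> norm x * norm y"
proof -
  have "(cmod (cinner x y))\<^sup>2 \<le> (norm x * norm y)\<^sup>2"
    using psd_form.Cauchy_Schwarz[OF psd_form_cinner, of x y]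
    by (simp add: cinner_self power_mult_distrib)
  then show ?thesis by (rule power2_le_imp_le) simp
qed

text \<open>Operators given by boundary integrals are accessible only through scalar integrals
  against \<open>y\<close>; this turns such bounds into norm bounds.\<close>

lemma norm_le_by_cinner:
  fixes x :: "'a::complex_inner"
  assumes "\<And>y. cmod (cinner x y) \<le> B * norm y" "0 \<le> B"
  shows "norm x \<le> B"
proof (cases "x = 0")
  case False
  have "(norm x)\<^sup>2 \<le> B * norm x"
    using assms(1)[of x] by (simp add: cinner_self norm_power)
  then show ?thesis using False by (simp add: power2_eq_square)
qed (use assms(2) in simp)

lemma bounded_bilinear_scaleC:
  "bounded_bilinear (scaleC :: complex \<Rightarrow> 'a::complex_inner \<Rightarrow> 'a)"
  by (rule bounded_bilinear.intro)
    (auto simp: scaleC_add_left scaleC_add_right scaleR_scaleC scaleC_scaleC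
      scaleR_conv_of_real mult.commute intro!: exI[of _ 1])

lemmas tendsto_scaleC = bounded_bilinear.tendsto[OF bounded_bilinear_scaleC]

lemma bounded_clinearD:
  assumes "bounded_clinear T"
  shows "bounded_linear T" "T (x + y) = T x + T y" "T (x - y) = T x - T y" "T (c *\<^sub>C x) = c *\<^sub>C T x"
    "T 0 = 0"
  using assms unfolding bounded_clinear_def
  by (auto simp: bounded_linear.linear linear_add linear_diff linear_0)

lemma bounded_clinearI:
  assumes "\<And>x y. T (x + y) = T x + T y" "\<And>c x. T (c *\<^sub>C x) = c *\<^sub>C T x"
    "\<And>x. norm (T x) \<le> B * norm x"
  shows "bounded_clinear T"
  unfolding bounded_clinear_def
  by (auto intro!: bounded_linear_intro[of T B] simp: assms scaleR_scaleC mult.commute)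

lemma bounded_clinear_affine:
  fixes T :: "'a::complex_inner \<Rightarrow> 'a"
  assumes "bounded_clinear T"
  shows "bounded_clinear (\<lambda>x. a *\<^sub>C x + b *\<^sub>C T x)"
proof -
  note T = bounded_clinearD[OF assms]
  obtain B where B: "\<And>x. norm (T x) \<le> norm x * B"
    using bounded_linear.bounded[OF T(1)] by blast
  show ?thesis
  proof (rule bounded_clinearI[where B = "cmod a + cmod b * B"])
    show "norm (a *\<^sub>C x + b *\<^sub>C T x) \<le> (cmod a + cmod b * B) * norm x" for x
      using norm_triangle_ineq[of "a *\<^sub>C x" "b *\<^sub>C T x"] mult_left_mono[OF B[of x], of "cmod b"]
      by (simp add: algebra_simps)
  qed (auto simp: T scaleC_add_right scaleC_scaleC algebra_simps)
qed

section \<open>The numerical range\<close>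

lemma cinner_in_numerical_range:
  fixes T :: "'a::complex_inner \<Rightarrow> 'a"
  assumes "bounded_clinear T" "x \<noteq> 0"
  shows "cinner (T x) x / of_real ((norm x)\<^sup>2) \<in> numerical_range T"
proof -
  let ?u = "of_real (1 / norm x) *\<^sub>C x"
  have "norm ?u = 1" using assms(2) by (simp add: norm_divide)
  moreover have "cinner (T ?u) ?u = cinner (T x) x / of_real ((norm x)\<^sup>2)"
    by (simp add: bounded_clinearD[OF assms(1)] cinner_scaleC_left cinner_scaleC_right power2_eq_square)
  ultimately show ?thesis unfolding numerical_range_def by (metis (mono_tags, lifting) mem_Collect_eq)
qed

lemma bounded_numerical_range:
  fixes T :: "'a::complex_inner \<Rightarrow> 'a"
  assumes "bounded_clinear T"
  shows "bounded (numerical_range T)"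
proof -
  obtain B where B: "\<And>x. norm (T x) \<le> norm x * B"
    using bounded_linear.bounded bounded_clinearD(1)[OF assms] by blast
  have "cmod z \<le> B" if z: "z \<in> numerical_range T" for z
  proof -
    obtain x where "z = cinner (T x) x" "norm x = 1"
      using z unfolding numerical_range_def by blast
    then show ?thesis using cinner_norm_le[of "T x" x] B[of x] by simp
  qed
  then show ?thesis by (auto simp: bounded_iff)
qed

lemma numerical_range_affine:
  fixes T :: "'a::complex_inner \<Rightarrow> 'a"
  assumes "bounded_clinear T"
  shows "numerical_range (\<lambda>x. a *\<^sub>C x + b *\<^sub>C T x) = (\<lambda>z. a + b * z) ` numerical_range T"
proof -
  have e: "cinner (a *\<^sub>C x + b *\<^sub>C T x) x = a + b * cinner (T x) x" if "norm x = 1" for x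
    using that by (simp add: cinner_add_left cinner_scaleC_left cinner_self)
  show ?thesis unfolding numerical_range_def
  proof (intro set_eqI iffI)
    fix w assume "w \<in> {cinner (a *\<^sub>C x + b *\<^sub>C T x) x |x. norm x = 1}"
    then obtain x where "w = cinner (a *\<^sub>C x + b *\<^sub>C T x) x" "norm x = 1" by blast
    then show "w \<in> (\<lambda>z. a + b * z) ` {cinner (T x) x |x. norm x = 1}" using e by blast
  next
    fix w assume "w \<in> (\<lambda>z. a + b * z) ` {cinner (T x) x |x. norm x = 1}"
    then obtain x where "w = a + b * cinner (T x) x" "norm x = 1" by blast
    then show "w \<in> {cinner (a *\<^sub>C x + b *\<^sub>C T x) x |x. norm x = 1}" using e[of x] by (intro CollectI exI[of _ x]) simp
  qed
qed

text \<open>Toeplitz--Hausdorff: after an affine normalisation the two points are \<open>0\<close> and \<open>1\<close>, and a phase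
  shift of one of the vectors makes the form real on the real line through them.\<close>

lemma numerical_range_unit_segment:
  fixes T :: "'a::complex_inner \<Rightarrow> 'a"
  assumes T: "bounded_clinear T" and 0: "0 \<in> numerical_range T" and 1: "1 \<in> numerical_range T"
    and t: "0 \<le> t" "t \<le> (1::real)"
  shows "of_real t \<in> numerical_range T"
proof -
  note Tl = bounded_clinearD[OF T]
  obtain x' where x': "norm x' = 1" "cinner (T x') x' = 0" using 0 unfolding numerical_range_def by auto
  obtain y where y: "norm y = 1" "cinner (T y) y = 1" using 1 unfolding numerical_range_def by auto
  \<comment> \<open>Chosen so that the imaginary part of the two cross terms, after
    \<open>x'\<close> is multiplied by \<open>e\<close>, equals \<open>Im (e * d)\<close>.\<close>
  define d where "d = cinner (T x') y - cnj (cinner (T y) x')"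
  define e where "e = (if d = 0 then 1 else cnj (sgn d))"
  have e1: "cmod e = 1" by (simp add: e_def norm_sgn)
  have ed: "Im (e * d) = 0"
  proof (cases "d = 0")
    case False
    have "cnj (sgn d) * d = of_real (cmod d)"
      using False complex_norm_square[of d]
      by (simp add: sgn_eq mult.commute[of "cnj d"] power2_eq_square field_simps)
    then show ?thesis using False by (simp add: e_def)
  qed simp
  define x where "x = e *\<^sub>C x'"
  have x: "norm x = 1" "cinner (T x) x = 0"
    using x' e1 by (simp_all add: x_def Tl cinner_scaleC_left cinner_scaleC_right)
  have im: "Im (cinner (T x) y + cinner (T y) x) = 0"
  proof -
    have "Im (cinner (T x) y + cinner (T y) x) = Im (e * cinner (T x') y) + Im (cnj e * cinner (T y) x')"
      by (simp add: x_def Tl cinner_scaleC_left cinner_scaleC_right)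
    also have "\<dots> = Im (e * d)" by (simp add: d_def algebra_simps)
    finally show ?thesis using ed by simp
  qed
  define w where "w s = of_real (1 - s) *\<^sub>C x + of_real s *\<^sub>C y" for s :: real
  define h where "h s = cinner (T (w s)) (w s)" for s
  have h: "h s = of_real (s * (1 - s)) * (cinner (T x) y + cinner (T y) x) + of_real (s\<^sup>2)" for s
    using x y by (simp add: h_def w_def Tl cinner_scaleC_left cinner_scaleC_right cinner_add_left
        cinner_add_right power2_eq_square algebra_simps)
  have imh: "Im (h s) = 0" for s
    unfolding h plus_complex.sel(2) times_complex.sel(2) im[unfolded plus_complex.sel(2)] by simp
  \<comment> \<open>If \<open>w s\<close> vanished, \<open>y\<close> would be a multiple of
    \<open>x\<close>, and the form would be 0 at \<open>y\<close> instead of 1.\<close>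
  have w0: "w s \<noteq> 0" if "s \<in> {0..1}" for s
  proof
    assume w: "w s = 0"
    have s1: "s \<noteq> 0"
    proof
      assume "s = 0"
      then have "x = 0" using w by (simp add: w_def scaleC_one)
      then show False using x by simp
    qed
    have "of_real s *\<^sub>C y = (- of_real (1 - s)) *\<^sub>C x"
      using w by (simp only: w_def scaleC_minus_left add_eq_0_iff)
    then have "y = (inverse (of_real s) * (- of_real (1 - s))) *\<^sub>C x"
      using s1 by (metis left_inverse of_real_eq_0_iff scaleC_one scaleC_scaleC)
    then have "cinner (T y) y = 0" using x(2)
      by (simp add: Tl cinner_scaleC_left cinner_scaleC_right)
    then show False using y by simp
  qed
  have cw: "continuous_on {0..1} (\<lambda>s. norm (w s))"
  proof -
    have "continuous_on {0..1} w" unfolding w_def scaleR_scaleC[symmetric]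
      by (intro continuous_intros)
    then show ?thesis by (rule continuous_on_norm)
  qed
  define F where "F s = Re (h s) / (norm (w s))\<^sup>2" for s
  have "continuous_on {0..1} F"
    unfolding F_def h by (intro continuous_intros cw) (use w0 in auto)
  moreover have "F 0 = 0" by (simp add: F_def h)
  moreover have "F 1 = 1" using y by (simp add: F_def h w_def scaleC_one)
  ultimately have "\<exists>s\<ge>0. s \<le> 1 \<and> F s = t"
    using IVT'[of F 0 t 1] t by simp
  then obtain s where s: "s \<in> {0..1}" "Re (h s) / (norm (w s))\<^sup>2 = t" by (auto simp: F_def)
  have "h s / of_real ((norm (w s))\<^sup>2) = of_real t"
    using imh[of s] s(2) by (simp add: complex_eq_iff)
  then show ?thesis
    using cinner_in_numerical_range[OF T w0[OF s(1)]] by (simp add: h_def)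
qed

theorem convex_numerical_range:
  fixes T :: "'a::complex_inner \<Rightarrow> 'a"
  assumes T: "bounded_clinear T"
  shows "convex (numerical_range T)"
proof (rule convexI)
  fix a b :: complex and u v :: real
  assume a: "a \<in> numerical_range T" and b: "b \<in> numerical_range T" and uv: "0 \<le> u" "0 \<le> v" "u + v = 1"
  show "u *\<^sub>R a + v *\<^sub>R b \<in> numerical_range T"
  proof (cases "a = b")
    case True
    then show ?thesis using a uv by (metis scaleR_add_left scaleR_one)
  next
    case False
    define S where "S = (\<lambda>x. (- a / (b - a)) *\<^sub>C x + (1 / (b - a)) *\<^sub>C T x)"
    have S: "bounded_clinear S" unfolding S_def by (rule bounded_clinear_affine[OF T])
    have nr: "numerical_range S = (\<lambda>z. - a / (b - a) + 1 / (b - a) * z) ` numerical_range T"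
      unfolding S_def by (rule numerical_range_affine[OF T])
    have "0 \<in> numerical_range S" unfolding nr using a by (auto intro!: image_eqI[of _ _ a])
    moreover have "1 \<in> numerical_range S" unfolding nr using b False
      by (auto intro!: image_eqI[of _ _ b] simp: diff_divide_distrib[symmetric])
    ultimately have "of_real v \<in> numerical_range S"
      using numerical_range_unit_segment[OF S] uv by simp
    then obtain z where z: "z \<in> numerical_range T" "of_real v = - a / (b - a) + 1 / (b - a) * z"
      unfolding nr by auto
    have "of_real v = (z - a) / (b - a)" using z(2) by (simp add: diff_divide_distrib)
    then have "z = a + of_real v * (b - a)" using False by simp
    also have "\<dots> = (1 - v) *\<^sub>R a + v *\<^sub>R b" by (simp add: scaleR_conv_of_real algebra_simps)
    finally show ?thesis using z(1) uv(3) by (metis add_diff_cancel_right')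
  qed
qed

section \<open>Polynomials in an operator\<close>

lemma poly_operator_sum:
  assumes "degree p \<le> n"
  shows "poly_operator p T x = (\<Sum>k\<le>n. coeff p k *\<^sub>C (T ^^ k) x)"
  unfolding poly_operator_def
  by (rule sum.mono_neutral_left) (use assms in \<open>auto simp: coeff_eq_0\<close>)

lemma poly_operator_0 [simp]: "poly_operator 0 T x = 0"
  by (simp add: poly_operator_def)

context
  fixes T :: "'a::complex_inner \<Rightarrow> 'a"
  assumes T: "bounded_clinear T"
begin

lemma poly_operator_pCons: "poly_operator (pCons a p) T x = a *\<^sub>C x + T (poly_operator p T x)"
proof -
  have lin: "linear T" using bounded_clinearD(1)[OF T] by (rule bounded_linear.linear)
  have "poly_operator (pCons a p) T x = (\<Sum>k\<le>Suc (degree p). coeff (pCons a p) k *\<^sub>C (T ^^ k) x)"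
    by (rule poly_operator_sum) (simp add: degree_pCons_le)
  also have "\<dots> = a *\<^sub>C x + (\<Sum>k\<le>degree p. coeff p k *\<^sub>C T ((T ^^ k) x))"
    by (subst sum.atMost_Suc_shift) simp
  also have "(\<Sum>k\<le>degree p. coeff p k *\<^sub>C T ((T ^^ k) x)) = T (poly_operator p T x)"
    by (simp add: poly_operator_def linear_sum[OF lin] bounded_clinearD[OF T])
  finally show ?thesis .
qed

lemma poly_operator_add: "poly_operator (p + q) T x = poly_operator p T x + poly_operator q T x"
proof -
  define n where "n = max (degree p) (degree q)"
  have "degree (p + q) \<le> n" unfolding n_def by (rule degree_add_le_max)
  then show ?thesis
    using poly_operator_sum[of p n T x] poly_operator_sum[of q n T x] poly_operator_sum[of "p + q" n T x]
    by (simp add: n_def scaleC_add_left sum.distrib)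
qed

lemma poly_operator_smult: "poly_operator (smult c p) T x = c *\<^sub>C poly_operator p T x"
  using poly_operator_sum[of "smult c p" "degree p" T x] degree_smult_le[of c p]
  by (simp add: poly_operator_def scaleC_sum_right scaleC_scaleC)

lemma poly_operator_const: "poly_operator [:c:] T x = c *\<^sub>C x"
  by (simp add: poly_operator_pCons bounded_clinearD[OF T])

lemma bounded_clinear_poly_operator: "bounded_clinear (poly_operator p T)"
proof (induction p)
  case 0
  show ?case by (rule bounded_clinearI[where B = 0]) auto
next
  case (pCons a p)
  obtain B where B: "\<And>x. norm (T x) \<le> norm x * B" "B > 0"
    using bounded_linear.pos_bounded bounded_clinearD(1)[OF T] by blast
  obtain C where C: "\<And>x. norm (poly_operator p T x) \<le> norm x * C"
    using bounded_linear.bounded bounded_clinearD(1)[OF pCons(2)] by blast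
  note eq = poly_operator_pCons
  show ?case
  proof (rule bounded_clinearI[where B = "cmod a + C * B"])
    show "norm (poly_operator (pCons a p) T x) \<le> (cmod a + C * B) * norm x" for x
    proof -
      have "norm (poly_operator (pCons a p) T x) \<le> cmod a * norm x + norm (T (poly_operator p T x))"
        unfolding eq using norm_triangle_ineq[of "a *\<^sub>C x" "T (poly_operator p T x)"] by simp
      moreover have "norm (T (poly_operator p T x)) \<le> norm x * C * B"
        using B(1)[of "poly_operator p T x"] C[of x] B(2) by (meson less_imp_le mult_right_mono order_trans)
      ultimately show ?thesis by (simp add: algebra_simps)
    qed
  qed (auto simp: eq bounded_clinearD[OF T] bounded_clinearD[OF pCons(2)] scaleC_add_right
      scaleC_scaleC mult.commute)
qed

lemmas poly_operator_linear = bounded_clinearD[OF bounded_clinear_poly_operator]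

lemma poly_operator_minus: "poly_operator (- p) T x = - poly_operator p T x"
  using poly_operator_smult[of "-1" p x] by (simp add: scaleC_minus_left scaleC_one)

lemma poly_operator_diff: "poly_operator (p - q) T x = poly_operator p T x - poly_operator q T x"
  using poly_operator_add[of p "- q" x] by (simp add: poly_operator_minus)

lemma poly_operator_commute: "poly_operator p T (T x) = T (poly_operator p T x)"
  by (induction p) (auto simp: poly_operator_pCons bounded_clinearD[OF T])

lemma poly_operator_mult: "poly_operator (p * q) T x = poly_operator p T (poly_operator q T x)"
  by (induction p)
    (auto simp: poly_operator_pCons poly_operator_add poly_operator_smult bounded_clinearD[OF T])

end

text \<open>Moves a dilation from the operator to the polynomial: an approximation found for a
  dilate becomes a polynomial in the original operator.\<close>

lemma poly_operator_pcompose_affine: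
  fixes T :: "'a::complex_inner \<Rightarrow> 'a"
  assumes T: "bounded_clinear T"
  shows "poly_operator (pcompose p [:a, b:]) T x = poly_operator p (\<lambda>x. a *\<^sub>C x + b *\<^sub>C T x) x"
proof (induction p arbitrary: x)
  case (pCons c p)
  have e: "poly_operator [:a, b:] T x = a *\<^sub>C x + b *\<^sub>C T x" for x
    by (simp add: poly_operator_pCons[OF T] bounded_clinearD[OF T])
  show ?case
    by (simp only: pcompose_pCons poly_operator_add[OF T] poly_operator_mult[OF T] e pCons
        poly_operator_const[OF T] poly_operator_pCons[OF bounded_clinear_affine[OF T]])
qed simp

section \<open>Near-extremal functions\<close>

text \<open>The expression is the Moebius map \<open>(w - \<alpha>) / (1 - cnj \<alpha> * w)\<close>
  up to first order in \<open>\<alpha>\<close>. Truncation keeps polynomials polynomial, and the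
  bound 1 is exceeded only to second order.\<close>

lemma moebius_second_order:
  assumes "cmod w \<le> 1" "cmod \<alpha> \<le> 1/2"
  shows "(cmod (w - \<alpha> + cnj \<alpha> * w\<^sup>2))\<^sup>2 \<le> 1 + 4 * (cmod \<alpha>)\<^sup>2"
proof -
  define v where "v = - \<alpha> + cnj \<alpha> * w\<^sup>2"
  define r where "r = cmod w"
  have r: "0 \<le> r" "r \<le> 1" using assms by (auto simp: r_def)
  have r2: "r\<^sup>2 \<le> 1" using r by (simp add: power_le_one)
  have "cmod v \<le> cmod \<alpha> + cmod \<alpha> * r\<^sup>2"
    unfolding v_def using norm_triangle_ineq[of "-\<alpha>" "cnj \<alpha> * w\<^sup>2"]
    by (simp add: norm_mult norm_power r_def)
  also have "\<dots> \<le> 2 * cmod \<alpha>" using mult_left_mono[OF r2, of "cmod \<alpha>"] by simp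
  finally have "(cmod v)\<^sup>2 \<le> (2 * cmod \<alpha>)\<^sup>2" by (rule power_mono) simp
  then have v2: "(cmod v)\<^sup>2 \<le> 4 * (cmod \<alpha>)\<^sup>2" by (simp add: power_mult_distrib)
  have w2: "cnj w * w\<^sup>2 = of_real (r\<^sup>2) * w"
    using complex_norm_square[of w] by (simp add: r_def power2_eq_square mult.commute mult.left_commute)
  have "Re (cnj w * v) = - Re (cnj w * \<alpha>) + Re (cnj \<alpha> * (cnj w * w\<^sup>2))"
    by (simp add: v_def algebra_simps)
  also have "\<dots> = - Re (cnj w * \<alpha>) + r\<^sup>2 * Re (cnj \<alpha> * w)"
    unfolding w2 by (simp add: algebra_simps)
  also have "Re (cnj \<alpha> * w) = Re (cnj w * \<alpha>)" by (simp add: algebra_simps)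
  finally have e: "Re (cnj w * v) = (1 - r\<^sup>2) * (- Re (cnj w * \<alpha>))" by (simp add: algebra_simps)
  \<comment> \<open>Since \<open>cmod \<alpha> \<le> 1/2\<close>, twice the first-order term is at
    most \<open>1 - r\<^sup>2\<close>, exactly the room that \<open>r\<^sup>2\<close> leaves below
    1.\<close>
  have "- Re (cnj w * \<alpha>) \<le> cmod (cnj w * \<alpha>)" using abs_Re_le_cmod[of "cnj w * \<alpha>"] by linarith
  also have "\<dots> \<le> 1 * (1/2)" unfolding norm_mult using assms by (intro mult_mono) auto
  finally have "Re (cnj w * v) \<le> (1 - r\<^sup>2) * (1/2)"
    unfolding e using r2 by (intro mult_left_mono) auto
  moreover have "(cmod (w + v))\<^sup>2 = r\<^sup>2 + 2 * Re (cnj w * v) + (cmod v)\<^sup>2"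
    unfolding r_def cmod_power2 by (simp add: power2_eq_square algebra_simps)
  ultimately show ?thesis using v2 by (simp add: v_def algebra_simps)
qed

text \<open>Comparing a near-extremal \<open>f\<close> with its Moebius perturbations \<open>f - \<alpha> + cnj \<alpha> * f\<^sup>2\<close> shows that a
  near-maximising vector \<open>x\<close> is almost orthogonal to \<open>f(S) x\<close>. This is what allows replacing the
  companion of \<open>f\<close> by its translate by a constant \<open>c\<close>.\<close>

lemma poly_operator_bound:
  fixes S :: "'a::complex_inner \<Rightarrow> 'a" and a :: real
  assumes S: "bounded_clinear S" and a0: "0 \<le> a"
    and fin: "\<And>p x. (\<And>z. z \<in> \<Omega> \<Longrightarrow> cmod (poly p z) \<le> 1) \<Longrightarrow> norm (poly_operator p S x) \<le> B * norm x"
    and companion: "\<And>f \<epsilon>. (\<And>z. z \<in> \<Omega> \<Longrightarrow> cmod (poly f z) \<le> 1) \<Longrightarrow> 0 < \<epsilon> \<Longrightarrow>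
      \<exists>q c. (\<forall>z\<in>\<Omega>. cmod (poly q z) \<le> a + \<epsilon>) \<and> cmod c \<le> 1 + a + \<epsilon> \<and>
        (\<forall>x y. cmod (cinner (poly_operator f S x) y + cnj (cinner (poly_operator q S y) x) + c * cinner x y)
           \<le> (2 + \<epsilon>) * norm x * norm y)"
    and p: "\<And>z. z \<in> \<Omega> \<Longrightarrow> cmod (poly p z) \<le> 1"
  shows "norm (poly_operator p S x0) \<le> (1 + sqrt (1 + a)) * norm x0"
proof (cases "x0 = 0")
  case True
  then show ?thesis by (simp add: poly_operator_linear[OF S])
next
  case x0: False
  define X where "X = {norm (poly_operator f S x) | f x. (\<forall>z\<in>\<Omega>. cmod (poly f z) \<le> 1) \<and> norm x = 1}"
  \<comment> \<open>The best constant in the inequality. The bound \<open>B\<close> serves only to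
    make this supremum finite; its size never enters the result.\<close>
  define K where "K = Sup X"
  have bdd: "bdd_above X"
  proof (rule bdd_aboveI[of _ B])
    fix k assume "k \<in> X"
    then obtain f x where "k = norm (poly_operator f S x)" "\<forall>z\<in>\<Omega>. cmod (poly f z) \<le> 1" "norm x = 1"
      unfolding X_def by blast
    then show "k \<le> B" using fin[of f x] by simp
  qed
  let ?u = "of_real (1 / norm x0) *\<^sub>C x0"
  have u1: "norm ?u = 1" using x0 by (simp add: norm_divide)
  have K_ge: "norm (poly_operator f S x) \<le> K * norm x" if f: "\<And>z. z \<in> \<Omega> \<Longrightarrow> cmod (poly f z) \<le> 1" for f x
  proof (cases "x = 0")
    case True
    then show ?thesis by (simp add: poly_operator_linear[OF S])
  next
    case False
    let ?v = "of_real (1 / norm x) *\<^sub>C x"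
    have "norm ?v = 1" using False by (simp add: norm_divide)
    then have "norm (poly_operator f S ?v) \<in> X" using f unfolding X_def by blast
    then have "norm (poly_operator f S ?v) \<le> K" unfolding K_def using bdd by (rule cSup_upper)
    then show ?thesis using False
      by (simp add: poly_operator_linear[OF S] norm_divide field_simps)
  qed
  have K1: "1 \<le> K" using K_ge[of "[:1:]" ?u] u1 by (simp add: poly_operator_const[OF S] scaleC_one)
  have K_scale: "norm (poly_operator f S x) \<le> K * M * norm x"
    if f: "\<And>z. z \<in> \<Omega> \<Longrightarrow> cmod (poly f z) \<le> M" and M: "0 < M" for f x M
  proof -
    have "norm (poly_operator (smult (of_real (1 / M)) f) S x) \<le> K * norm x"
      by (rule K_ge) (use f M in \<open>auto simp: norm_mult norm_divide field_simps\<close>)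
    then show ?thesis using M by (simp add: poly_operator_smult[OF S] norm_divide field_simps)
  qed
  \<comment> \<open>For \<open>K = 1\<close> the claim is trivial; the orthogonality estimate below
    divides by \<open>K\<^sup>2 - 1\<close>.\<close>
  have main: "K\<^sup>2 \<le> 2 * K + a" if K: "1 < K"
  proof -
    \<comment> \<open>\<open>C * \<epsilon>\<close> is the bound on \<open>cmod u\<close> that the
      Moebius comparison yields. \<open>M\<close> collects, with some slack, all coefficients of
      \<open>\<epsilon>\<close> in the final estimate.\<close>
    define C where "C = (1 + 6 * K\<^sup>2) / (2 * (K\<^sup>2 - 1))"
    have Kp: "0 < K\<^sup>2 - 1" using K by (simp add: power2_eq_square less_1_mult)
    define M where "M = 2 + 2 * K + (a + 1) * K + (2 + a) * C"
    have est: "K\<^sup>2 \<le> 2 * K + a + M * \<epsilon>" if e: "0 < \<epsilon>" "\<epsilon> < 1/2" for \<epsilon>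
    proof -
      \<comment> \<open>The deficit is \<open>\<epsilon>\<^sup>2\<close> in the square of the norm,
        so that Cauchy-Schwarz for the defect form gives errors of order
        \<open>\<epsilon>\<close>.\<close>
      have "sqrt (K\<^sup>2 - \<epsilon>\<^sup>2) < K"
        by (rule real_less_lsqrt) (use e K in auto)
      moreover have "norm (poly_operator [:1:] S ?u) \<in> X" using u1 unfolding X_def
        by (intro CollectI exI[of _ "[:1:]"] exI[of _ ?u]) auto
      then have "X \<noteq> {}" by blast
      ultimately obtain k where k: "k \<in> X" "sqrt (K\<^sup>2 - \<epsilon>\<^sup>2) < k"
        unfolding K_def using less_cSup_iff[OF _ bdd] by blast
      from k(1) obtain f x where f: "\<And>z. z \<in> \<Omega> \<Longrightarrow> cmod (poly f z) \<le> 1" and x: "norm x = 1"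
        and kk: "k = norm (poly_operator f S x)" unfolding X_def by blast
      define A where "A = poly_operator f S"
      note Al = poly_operator_linear[OF S, of f, folded A_def]
      have A_le: "norm (A v) \<le> K * norm v" for v unfolding A_def by (rule K_ge) (rule f)
      have "K\<^sup>2 - \<epsilon>\<^sup>2 \<ge> 0" using e K power_mono[of \<epsilon> K 2] by simp
      then have "(sqrt (K\<^sup>2 - \<epsilon>\<^sup>2))\<^sup>2 \<le> k\<^sup>2" using k(2) by (intro power_mono) auto
      then have Ax: "K\<^sup>2 - \<epsilon>\<^sup>2 \<le> (norm (A x))\<^sup>2" using \<open>K\<^sup>2 - \<epsilon>\<^sup>2 \<ge> 0\<close> by (simp add: kk A_def)
      \<comment> \<open>The defect form of \<open>A\<close> from its norm bound \<open>K\<close>.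
        Smallness of \<open>Q v x\<close> for all \<open>v\<close> says weakly that \<open>x\<close>
        is almost an eigenvector for \<open>K\<^sup>2\<close>; it allows replacing <A v, A x> by
        \<open>K\<^sup>2\<close> times <v, x>.\<close>
      define Q where "Q v w = of_real (K\<^sup>2) * cinner v w - cinner (A v) (A w)" for v w
      have psd: "psd_form Q"
      proof
        show "Q w v = cnj (Q v w)" for v w
          using cinner_commute[of w v] cinner_commute[of "A w" "A v"] by (simp add: Q_def)
        show "0 \<le> Re (Q v v)" for v
          using power_mono[OF A_le[of v], of 2] by (simp add: Q_def cinner_self power_mult_distrib)
      qed (auto simp: Q_def Al cinner_add_left cinner_scaleC_left algebra_simps)
      have Qx: "cmod (Q v x) \<le> K * norm v * \<epsilon>" for v
      proof -
        have "Re (Q v v) \<le> K\<^sup>2 * (norm v)\<^sup>2" by (simp add: Q_def cinner_self)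
        moreover have "Re (Q x x) \<le> \<epsilon>\<^sup>2" using Ax x by (simp add: Q_def cinner_self)
        ultimately have "(cmod (Q v x))\<^sup>2 \<le> (K\<^sup>2 * (norm v)\<^sup>2) * \<epsilon>\<^sup>2"
          using psd_form.Cauchy_Schwarz[OF psd, of v x] psd_form.nonneg[OF psd]
          by (meson mult_mono order_trans zero_le_power2 mult_nonneg_nonneg)
        then have "(cmod (Q v x))\<^sup>2 \<le> (K * norm v * \<epsilon>)\<^sup>2" by (simp add: power_mult_distrib)
        then show ?thesis by (rule power2_le_imp_le) (use K e in auto)
      qed
      define u where "u = cinner (A x) x"
      have u: "cmod u \<le> C * \<epsilon>"
      proof -
        \<comment> \<open>Size \<open>\<epsilon>\<close> balances the linear gain against the
          quadratic loss, and the phase of \<open>u\<close> makes the linear term as large as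
          possible.\<close>
        define \<alpha> where "\<alpha> = of_real \<epsilon> * sgn u"
        have al: "cmod \<alpha> \<le> \<epsilon>" using e by (auto simp: \<alpha>_def norm_mult norm_sgn)
        have au: "Re (cnj \<alpha> * u) = \<epsilon> * cmod u"
        proof (cases "u = 0")
          case False
          have "cnj (sgn u) * u = of_real (cmod u)"
            using False complex_norm_square[of u]
            by (simp add: sgn_eq mult.commute[of "cnj u"] power2_eq_square field_simps)
          then have "cnj \<alpha> * u = of_real (\<epsilon> * cmod u)" by (simp add: \<alpha>_def mult.assoc)
          then show ?thesis by simp
        qed simp
        define h where "h = f - [:\<alpha>:] + smult (cnj \<alpha>) (f * f)"
        have hx: "poly_operator h S x = A x + (cnj \<alpha> *\<^sub>C A (A x) - \<alpha> *\<^sub>C x)"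
          by (simp add: h_def poly_operator_add[OF S] poly_operator_diff[OF S] poly_operator_const[OF S]
              poly_operator_smult[OF S] poly_operator_mult[OF S] A_def)
        have hz: "cmod (poly h z) \<le> sqrt (1 + 4 * \<epsilon>\<^sup>2)" if "z \<in> \<Omega>" for z
        proof (rule real_le_rsqrt)
          have "(cmod (poly h z))\<^sup>2 \<le> 1 + 4 * (cmod \<alpha>)\<^sup>2"
            using moebius_second_order[OF f[OF that], of \<alpha>] al e by (simp add: h_def power2_eq_square)
          also have "\<dots> \<le> 1 + 4 * \<epsilon>\<^sup>2" using power_mono[OF al, of 2] by simp
          finally show "(cmod (poly h z))\<^sup>2 \<le> 1 + 4 * \<epsilon>\<^sup>2" .
        qed
        have "norm (poly_operator h S x) \<le> K * sqrt (1 + 4 * \<epsilon>\<^sup>2) * norm x"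
          by (rule K_scale[OF hz]) (auto intro: add_pos_nonneg)
        then have "(norm (poly_operator h S x))\<^sup>2 \<le> (K * sqrt (1 + 4 * \<epsilon>\<^sup>2))\<^sup>2"
          using x by (intro power_mono) auto
        also have "\<dots> = K\<^sup>2 * (1 + 4 * \<epsilon>\<^sup>2)" by (simp add: power_mult_distrib)
        finally have "(norm (A x))\<^sup>2 + 2 * Re (cinner (A x) (cnj \<alpha> *\<^sub>C A (A x) - \<alpha> *\<^sub>C x)) \<le> K\<^sup>2 * (1 + 4 * \<epsilon>\<^sup>2)"
          unfolding hx norm_add_sq using zero_le_power2[of "norm (cnj \<alpha> *\<^sub>C A (A x) - \<alpha> *\<^sub>C x)"] by linarith
        moreover have "Re (cinner (A x) (cnj \<alpha> *\<^sub>C A (A x) - \<alpha> *\<^sub>C x))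
            = Re (cnj \<alpha> * cinner (A (A x)) (A x)) - Re (cnj \<alpha> * u)"
        proof -
          have "Re (cinner (A x) (cnj \<alpha> *\<^sub>C A (A x))) = Re (cnj \<alpha> * cinner (A (A x)) (A x))"
            by (subst Re_cinner_commute) (simp add: cinner_scaleC_left)
          then show ?thesis by (simp add: cinner_diff_right cinner_scaleC_right u_def)
        qed
        \<comment> \<open>The defect form turns <A (A x), A x> into \<open>K\<^sup>2 * u\<close>.
          The linear gain is therefore twice \<open>(K\<^sup>2 - 1) * \<epsilon> * cmod u\<close>,
          and everything else is of order \<open>\<epsilon>\<^sup>2\<close>.\<close>
        moreover have AAx: "cinner (A (A x)) (A x) = of_real (K\<^sup>2) * u - Q (A x) x"
          by (simp add: Q_def u_def)
        have "Re (cnj \<alpha> * cinner (A (A x)) (A x)) = K\<^sup>2 * Re (cnj \<alpha> * u) - Re (cnj \<alpha> * Q (A x) x)"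
        proof -
          have "Re (cnj \<alpha> * (of_real k * u - w)) = k * Re (cnj \<alpha> * u) - Re (cnj \<alpha> * w)" for k w
            by (simp add: algebra_simps)
          then show ?thesis using AAx by metis
        qed
        moreover have "Re (cnj \<alpha> * Q (A x) x) \<le> \<epsilon> * (K\<^sup>2 * \<epsilon>)"
        proof -
          have "cmod (Q (A x) x) \<le> K * K * \<epsilon>"
          proof -
            have "K * norm (A x) * \<epsilon> \<le> K * K * \<epsilon>"
              using A_le[of x] x K e by (intro mult_right_mono mult_left_mono) auto
            then show ?thesis using Qx[of "A x"] by linarith
          qed
          then have "cmod (cnj \<alpha> * Q (A x) x) \<le> \<epsilon> * (K\<^sup>2 * \<epsilon>)"
            unfolding norm_mult using al e by (intro mult_mono) (auto simp: power2_eq_square)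
          then show ?thesis using complex_Re_le_cmod order_trans by blast
        qed
        ultimately have "2 * ((K\<^sup>2 - 1) * (\<epsilon> * cmod u)) \<le> \<epsilon>\<^sup>2 * (1 + 6 * K\<^sup>2)"
          using Ax unfolding au by (simp add: algebra_simps power2_eq_square)
        then have "\<epsilon> * (cmod u * (2 * (K\<^sup>2 - 1))) \<le> \<epsilon> * (\<epsilon> * (1 + 6 * K\<^sup>2))"
          by (simp add: power2_eq_square algebra_simps)
        then have "cmod u * (2 * (K\<^sup>2 - 1)) \<le> \<epsilon> * (1 + 6 * K\<^sup>2)" using e(1) by simp
        then show ?thesis using Kp by (simp add: C_def field_simps)
      qed
      obtain q c where q: "\<And>z. z \<in> \<Omega> \<Longrightarrow> cmod (poly q z) \<le> a + \<epsilon>" and c: "cmod c \<le> 1 + a + \<epsilon>"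
        and qc: "\<And>x y. cmod (cinner (A x) y + cnj (cinner (poly_operator q S y) x) + c * cinner x y)
           \<le> (2 + \<epsilon>) * norm x * norm y"
        using companion[OF f e(1)] unfolding A_def by blast
      define y where "y = poly_operator q S (A x)"
      have Axn: "norm (A x) \<le> K" using A_le[of x] x by simp
      have y_le: "norm y \<le> K * (a + \<epsilon>) * K"
      proof -
        have "norm y \<le> K * (a + \<epsilon>) * norm (A x)"
          unfolding y_def by (rule K_scale[OF q]) (use a0 e in auto)
        also have "\<dots> \<le> K * (a + \<epsilon>) * K" using Axn K a0 e by (intro mult_left_mono) auto
        finally show ?thesis .
      qed
      have fqf: "cmod (cinner (A y) (A x)) \<le> K * (a + \<epsilon>) * K"
      proof -
        have "A y = poly_operator (f * q * f) S x"
          by (simp add: y_def A_def poly_operator_mult[OF S])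
        moreover have "cmod (poly (f * q * f) z) \<le> a + \<epsilon>" if "z \<in> \<Omega>" for z
        proof -
          have "cmod (poly (f * q * f) z) \<le> 1 * (a + \<epsilon>) * 1"
            unfolding poly_mult norm_mult using f[OF that] q[OF that] a0 e by (intro mult_mono) auto
          then show ?thesis by simp
        qed
        ultimately have "norm (A y) \<le> K * (a + \<epsilon>)"
          using K_scale[of "f * q * f" "a + \<epsilon>" x] a0 e x by simp
        then have "norm (A y) * norm (A x) \<le> K * (a + \<epsilon>) * K"
          using Axn K a0 e by (intro mult_mono) auto
        then show ?thesis using cinner_norm_le order_trans by blast
      qed
      have yx: "cmod (cinner y x) \<le> (a + \<epsilon>) + (a + \<epsilon>) * K * \<epsilon>"
      proof -
        have "of_real (K\<^sup>2) * cinner y x = cinner (A y) (A x) + Q y x" by (simp add: Q_def)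
        then have "K\<^sup>2 * cmod (cinner y x) \<le> cmod (cinner (A y) (A x)) + cmod (Q y x)"
          by (metis norm_mult norm_of_real abs_of_nonneg zero_le_power2 norm_triangle_ineq)
        also have "\<dots> \<le> K * (a + \<epsilon>) * K + K * (K * (a + \<epsilon>) * K) * \<epsilon>"
        proof (rule add_mono[OF fqf])
          have "K * norm y * \<epsilon> \<le> K * (K * (a + \<epsilon>) * K) * \<epsilon>"
            using y_le K e by (intro mult_right_mono mult_left_mono) auto
          then show "cmod (Q y x) \<le> K * (K * (a + \<epsilon>) * K) * \<epsilon>" using Qx[of y] by linarith
        qed
        also have "\<dots> = K\<^sup>2 * ((a + \<epsilon>) + (a + \<epsilon>) * K * \<epsilon>)" by (simp add: power2_eq_square algebra_simps)
        finally show ?thesis using K by simp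
      qed
      have cu: "cmod (c * cinner x (A x)) \<le> (2 + a) * (C * \<epsilon>)"
      proof -
        have "cmod (cinner x (A x)) = cmod u" unfolding u_def by (metis cinner_commute complex_mod_cnj)
        then show ?thesis unfolding norm_mult using c u e a0 by (intro mult_mono) auto
      qed
      have "(norm (A x))\<^sup>2 = cmod (cinner (A x) (A x))" by (simp add: cinner_self norm_power)
      also have "\<dots> \<le> cmod (cinner (A x) (A x) + cnj (cinner y x) + c * cinner x (A x))
          + cmod (cinner y x) + cmod (c * cinner x (A x))"
        using norm_triangle_ineq4[of "cinner (A x) (A x) + cnj (cinner y x) + c * cinner x (A x)" "cnj (cinner y x) + c * cinner x (A x)"]
          norm_triangle_ineq[of "cnj (cinner y x)" "c * cinner x (A x)"] by simp
      also have "\<dots> \<le> (2 + \<epsilon>) * K + ((a + \<epsilon>) + (a + \<epsilon>) * K * \<epsilon>) + (2 + a) * (C * \<epsilon>)"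
      proof (intro add_mono yx cu)
        have "cmod (cinner (A x) (A x) + cnj (cinner y x) + c * cinner x (A x)) \<le> (2 + \<epsilon>) * norm x * norm (A x)"
          unfolding y_def by (rule qc)
        also have "\<dots> \<le> (2 + \<epsilon>) * K" using x Axn e by (simp add: mult_left_mono)
        finally show "cmod (cinner (A x) (A x) + cnj (cinner y x) + c * cinner x (A x)) \<le> (2 + \<epsilon>) * K" .
      qed
      finally have "K\<^sup>2 \<le> \<epsilon>\<^sup>2 + (2 + \<epsilon>) * K + ((a + \<epsilon>) + (a + \<epsilon>) * K * \<epsilon>) + (2 + a) * (C * \<epsilon>)"
        using Ax by linarith
      moreover have "\<epsilon>\<^sup>2 \<le> \<epsilon>" using e by (simp add: power2_eq_square mult_le_cancel_left2)
      moreover have "(a + \<epsilon>) * K * \<epsilon> \<le> (a + 1) * K * \<epsilon>" using e K by (intro mult_right_mono) auto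
      moreover have "\<epsilon> * K \<ge> 0" using e K by simp
      ultimately show ?thesis by (simp add: M_def algebra_simps)
    qed
    have "((\<lambda>\<epsilon>. 2 * K + a + M * \<epsilon>) \<longlongrightarrow> 2 * K + a + M * 0) (at_right 0)"
      by (intro tendsto_intros)
    moreover have "eventually (\<lambda>\<epsilon>. K\<^sup>2 \<le> 2 * K + a + M * \<epsilon>) (at_right 0)"
      unfolding eventually_at_right_field using est by (intro exI[of _ "1/2"]) auto
    ultimately show ?thesis using tendsto_lowerbound by fastforce
  qed
  have "K \<le> 1 + sqrt (1 + a)"
  proof (cases "K = 1")
    case False
    then have "(K - 1)\<^sup>2 \<le> 1 + a" using main K1 by (simp add: power2_eq_square algebra_simps)
    then show ?thesis using real_le_rsqrt by force
  qed (use a0 in simp)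
  then show ?thesis using K_ge[OF p, of x0] by (meson mult_right_mono norm_ge_zero order_trans)
qed

section \<open>The fundamental theorem of calculus for Lipschitz functions\<close>

text \<open>The difference quotients of a locally Lipschitz function are uniformly bounded, so the
  dominated convergence theorem applies; a countable exceptional set does no harm.\<close>

lemma FTC_locally_lipschitz:
  fixes f :: "real \<Rightarrow> complex"
  assumes ab: "a \<le> b" and N: "countable N" and d: "0 < d"
    and lip: "\<And>t u. t \<in> {a..b} \<Longrightarrow> u \<in> {a..b} \<Longrightarrow> \<bar>t - u\<bar> < d \<Longrightarrow> dist (f t) (f u) \<le> C * \<bar>t - u\<bar>"
    and deriv: "\<And>t. t \<in> {a<..<b} - N \<Longrightarrow> (f has_vector_derivative f' t) (at t)"
  shows "(f' has_integral f b - f a) {a..b}"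
proof -
  \<comment> \<open>Constant continuation beyond the interval makes the difference quotients
    meaningful up to \<open>b\<close>.\<close>
  define F where "F t = f (max a (min b t))" for t
  define D where "D = max C 0"
  have lipF: "dist (F t) (F u) \<le> D * \<bar>t - u\<bar>" if "\<bar>t - u\<bar> < d" for t u
  proof -
    have le: "\<bar>max a (min b t) - max a (min b u)\<bar> \<le> \<bar>t - u\<bar>" by (auto simp: max_def min_def)
    then have "dist (F t) (F u) \<le> C * \<bar>max a (min b t) - max a (min b u)\<bar>"
      unfolding F_def using ab that by (intro lip) auto
    also have "\<dots> \<le> D * \<bar>t - u\<bar>" using le by (intro mult_mono) (auto simp: D_def)
    finally show ?thesis .
  qed
  have contF: "continuous_on S F" for S
  proof -
    have "isCont F t" for t
      unfolding continuous_at_eps_delta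
    proof (intro allI impI)
      fix e :: real assume e: "0 < e"
      show "\<exists>k>0. \<forall>x'. dist x' t < k \<longrightarrow> dist (F x') (F t) < e"
      proof (intro exI[of _ "min d (e / (D + 1))"] conjI allI impI)
        show "0 < min d (e / (D + 1))" using d e by (simp add: D_def)
        fix x' assume x': "dist x' t < min d (e / (D + 1))"
        then have "dist (F x') (F t) \<le> D * \<bar>x' - t\<bar>" by (intro lipF) (simp add: dist_real_def)
        also have "\<dots> \<le> (D + 1) * \<bar>x' - t\<bar>" by (simp add: mult_right_mono)
        also have "\<dots> < e" using x' by (simp add: dist_real_def D_def field_simps)
        finally show "dist (F x') (F t) < e" .
      qed
    qed
    then show ?thesis by (simp add: continuous_at_imp_continuous_on)
  qed
  obtain n0 :: nat where n0: "1 / d < n0" using reals_Archimedean2 by blast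
  have n0p: "0 < real n0" using n0 d by (meson divide_pos_pos less_trans zero_less_one)
  \<comment> \<open>The offset \<open>n0\<close> keeps all steps below \<open>d\<close>, where the
    Lipschitz bound applies.\<close>
  define h where "h n = 1 / real (n + n0)" for n
  have h: "0 < h n" "h n < d" for n
  proof -
    show "0 < h n" using n0p by (simp add: h_def)
    have "1 / d < real (n + n0)" using n0 by simp
    then show "h n < d" using d n0p by (simp add: h_def field_simps)
  qed
  have h_lim: "h \<longlonglongrightarrow> 0"
    unfolding h_def using LIMSEQ_ignore_initial_segment[OF lim_inverse_n', of n0] by simp
  define E where "E = N \<union> {a, b}"
  have negE: "negligible E" unfolding E_def using N by (simp add: countable_imp_null_set_lborel negligible_iff_null_sets null_sets_completionI)
  define Q where "Q n t = (F (t + h n) - F t) /\<^sub>R h n" for n t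
  have contQ: "continuous_on S (Q n)" for S n
    unfolding Q_def by (intro continuous_intros continuous_on_compose2[OF contF[of UNIV]]) auto
  define QE where "QE n t = (if t \<in> E then 0 else Q n t)" for n t
  define G where "G t = (if t \<in> E then 0 else f' t)" for t
  have intQ: "Q n integrable_on {a..b}" for n by (rule integrable_continuous_interval[OF contQ])
  have QE_int: "QE n integrable_on {a..b}" for n
    by (rule integrable_spike[OF intQ negE]) (auto simp: QE_def)
  have QE_eq: "integral {a..b} (QE n) = integral {a..b} (Q n)" for n
    by (rule integral_spike[OF negE]) (auto simp: QE_def)
  have le: "norm (QE n t) \<le> D" for n t
  proof -
    have "norm (Q n t) \<le> D"
    proof -
      have "norm (Q n t) = norm (F (t + h n) - F t) / h n"
        unfolding Q_def norm_scaleR using h[of n] by (simp add: divide_inverse mult.commute)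
      then show ?thesis using lipF[of "t + h n" t] h[of n] by (simp add: dist_norm divide_le_eq)
    qed
    then show ?thesis by (auto simp: QE_def D_def)
  qed
  have conv: "(\<lambda>n. QE n t) \<longlonglongrightarrow> G t" if t: "t \<in> {a..b}" for t
  proof (cases "t \<in> E")
    case False
    then have t': "t \<in> {a<..<b} - N" using t by (auto simp: E_def)
    have "(F has_vector_derivative f' t) (at t)"
    proof (rule has_vector_derivative_transform_within_open[OF deriv[OF t'], of "{a<..<b}"])
      show "f s = F s" if "s \<in> {a<..<b}" for s using that by (simp add: F_def)
    qed (use t' in auto)
    then have "((\<lambda>k. norm (F (t + k) - F t - k *\<^sub>R f' t) / norm k) \<longlongrightarrow> 0) (at 0)"
      by (simp add: has_vector_derivative_def has_derivative_at)
    moreover have "norm (F (t + k) - F t - k *\<^sub>R f' t) / norm k = norm ((F (t + k) - F t) /\<^sub>R k - f' t)"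
      if "k \<noteq> 0" for k
    proof -
      have "(F (t + k) - F t) /\<^sub>R k - f' t = (F (t + k) - F t - k *\<^sub>R f' t) /\<^sub>R k"
        using that by (simp add: scaleR_diff_right)
      then show ?thesis by (simp only: norm_scaleR) (simp add: divide_inverse mult.commute)
    qed
    ultimately have "((\<lambda>k. norm ((F (t + k) - F t) /\<^sub>R k - f' t)) \<longlongrightarrow> 0) (at 0)"
      by (rule_tac Lim_transform_eventually) (auto simp: eventually_at_filter)
    then have "((\<lambda>k. (F (t + k) - F t) /\<^sub>R k) \<longlongrightarrow> f' t) (at 0)"
      using tendsto_norm_zero_iff LIM_zero_iff by blast
    then have "(\<lambda>n. (F (t + h n) - F t) /\<^sub>R h n) \<longlonglongrightarrow> f' t"
      by (rule filterlim_compose)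
        (use h_lim h(1) in \<open>auto simp: filterlim_at eventually_sequentially less_imp_neq[symmetric]\<close>)
    then show ?thesis using False by (simp add: QE_def G_def Q_def)
  qed (simp add: QE_def G_def)
  have dc: "G integrable_on {a..b}" "(\<lambda>n. integral {a..b} (QE n)) \<longlonglongrightarrow> integral {a..b} G"
    using dominated_convergence[of QE "{a..b}" "\<lambda>_. D" G] QE_int le conv by auto
  have intF: "F integrable_on {s..u}" for s u by (rule integrable_continuous_interval[OF contF])
  \<comment> \<open>The integral of a difference quotient telescopes to the mean of \<open>F\<close>
    over the step after \<open>b\<close> minus its mean over the step after \<open>a\<close>; the
    first is exactly \<open>f b\<close> because \<open>F\<close> is constant there.\<close>
  have val: "integral {a..b} (Q n) = f b - integral {a..a + h n} F /\<^sub>R h n" for n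
  proof -
    have shift: "integral {a..b} (\<lambda>t. F (t + h n)) = integral {a + h n..b + h n} F"
      using integral_shift_real_ivl[of "a + h n" "h n" "b + h n" F] by simp
    have i1: "(\<lambda>t. F (t + h n)) integrable_on {a..b}"
      by (intro integrable_continuous_interval continuous_on_compose2[OF contF[of UNIV]] continuous_intros) auto
    have "integral {a..b} (Q n) = (integral {a + h n..b + h n} F - integral {a..b} F) /\<^sub>R h n"
      unfolding Q_def using i1 intF by (simp add: integral_diff shift)
    moreover have "integral {a..a + h n} F + integral {a + h n..b + h n} F = integral {a..b + h n} F"
      using h(1)[of n] ab intF by (intro Henstock_Kurzweil_Integration.integral_combine) auto
    then have "integral {a + h n..b + h n} F = integral {a..b + h n} F - integral {a..a + h n} F"
      by (simp add: eq_diff_eq add.commute)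
    moreover have "integral {a..b} F + integral {b..b + h n} F = integral {a..b + h n} F"
      using h(1)[of n] ab intF by (intro Henstock_Kurzweil_Integration.integral_combine) auto
    then have "integral {a..b} F = integral {a..b + h n} F - integral {b..b + h n} F"
      by (simp add: eq_diff_eq)
    moreover have "integral {b..b + h n} F = integral {b..b + h n} (\<lambda>t. f b)"
      by (rule integral_cong) (use ab in \<open>auto simp: F_def\<close>)
    then have "integral {b..b + h n} F = h n *\<^sub>R f b" using h(1)[of n] by simp
    ultimately have "integral {a..b} (Q n) = (h n *\<^sub>R f b - integral {a..a + h n} F) /\<^sub>R h n"
      by (simp only: diff_diff_eq2) simp
    then show ?thesis using h(1)[of n] by (simp add: scaleR_diff_right)
  qed
  have "(\<lambda>n. integral {a..a + h n} F /\<^sub>R h n) \<longlonglongrightarrow> f a"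
  proof (rule LIM_zero_cancel, rule Lim_null_comparison[where g = "\<lambda>n. D * h n"])
    have "norm (integral {a..a + h n} F /\<^sub>R h n - f a) \<le> D * h n" for n
    proof -
      have "integral {a..a + h n} F - h n *\<^sub>R f a = integral {a..a + h n} (\<lambda>t. F t - f a)"
        using h(1)[of n] intF by (subst integral_diff) auto
      also have "norm \<dots> \<le> (D * h n) * (a + h n - a)"
      proof (rule integral_bound)
        show "continuous_on {a..a + h n} (\<lambda>t. F t - f a)" by (intro continuous_intros contF)
        fix t assume t: "t \<in> {a..a + h n}"
        have "dist (F t) (F a) \<le> D * \<bar>t - a\<bar>" by (rule lipF) (use t h(2)[of n] in auto)
        also have "\<dots> \<le> D * h n" using t by (intro mult_left_mono) (auto simp: D_def)
        finally show "norm (F t - f a) \<le> D * h n" using ab by (simp add: F_def dist_norm)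
      qed (use h(1)[of n] in auto)
      finally have "norm (integral {a..a + h n} F - h n *\<^sub>R f a) \<le> D * h n * h n" by simp
      moreover have eq: "integral {a..a + h n} F /\<^sub>R h n - f a = (integral {a..a + h n} F - h n *\<^sub>R f a) /\<^sub>R h n"
        using h(1)[of n] by (simp add: scaleR_diff_right)
      have "norm (integral {a..a + h n} F /\<^sub>R h n - f a) = norm (integral {a..a + h n} F - h n *\<^sub>R f a) / h n"
        unfolding eq norm_scaleR using h(1)[of n] by (simp add: divide_inverse mult.commute)
      ultimately show ?thesis using h(1)[of n] by (simp add: divide_le_eq)
    qed
    then show "\<forall>\<^sub>F n in sequentially. norm (integral {a..a + h n} F /\<^sub>R h n - f a) \<le> D * h n" by simp
    show "(\<lambda>n. D * h n) \<longlonglongrightarrow> 0" using tendsto_mult_right_zero[OF h_lim] by simp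
  qed
  then have "(\<lambda>n. integral {a..b} (QE n)) \<longlonglongrightarrow> f b - f a"
    unfolding QE_eq val by (intro tendsto_intros)
  then have "integral {a..b} G = f b - f a" using dc(2) LIMSEQ_unique by blast
  then have "(G has_integral f b - f a) {a..b}" using dc(1) by (metis integrable_integral)
  then show ?thesis by (rule has_integral_spike[OF negE, rotated]) (auto simp: G_def)
qed

text \<open>\<open>K\<close> need not be convex, but close points of it share a closed disc inside
  the compact neighbourhood \<open>K'\<close>; there the derivative is bounded and the mean value
  inequality applies.\<close>

lemma holomorphic_locally_lipschitz:
  assumes h: "h holomorphic_on U" and U: "open U" and K: "compact K" "K \<subseteq> U"
  obtains d C where "0 < d" "0 \<le> C"
    "\<And>z w. z \<in> K \<Longrightarrow> w \<in> K \<Longrightarrow> dist z w < d \<Longrightarrow> dist (h z) (h w) \<le> C * dist z w"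
proof -
  obtain e where e: "0 < e" "(\<Union>x\<in>K. cball x e) \<subseteq> U"
    using compact_subset_open_imp_cball_epsilon_subset[OF K(1) U K(2)] by auto
  define K' where "K' = (\<lambda>p. fst p + snd p) ` (K \<times> cball 0 e)"
  have "compact K'" unfolding K'_def
    by (intro compact_continuous_image compact_Times K continuous_intros) auto
  have sub: "cball x e \<subseteq> K'" if "x \<in> K" for x
  proof
    fix y assume "y \<in> cball x e"
    then have "(x, y - x) \<in> K \<times> cball 0 e" using that by (auto simp: dist_norm norm_minus_commute)
    then show "y \<in> K'" unfolding K'_def by (metis (no_types, lifting) add_diff_cancel_left' diff_add_cancel add.commute fst_conv snd_conv imageI)
  qed
  have "K' \<subseteq> U"
  proof
    fix y assume "y \<in> K'"
    then obtain x k where "x \<in> K" "norm k \<le> e" "y = x + k" by (auto simp: K'_def)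
    then have "y \<in> cball x e" by (simp add: dist_norm)
    then show "y \<in> U" using e(2) \<open>x \<in> K\<close> by blast
  qed
  have "continuous_on K' (deriv h)"
    using holomorphic_deriv[OF h U] holomorphic_on_imp_continuous_on continuous_on_subset \<open>K' \<subseteq> U\<close> by blast
  then have "bounded (deriv h ` K')" using \<open>compact K'\<close> compact_continuous_image compact_imp_bounded by blast
  then obtain B where B: "\<And>z. z \<in> K' \<Longrightarrow> cmod (deriv h z) \<le> B" "0 < B"
    unfolding bounded_pos by auto
  show thesis
  proof (rule that[OF e(1), of B])
    fix z w assume zw: "z \<in> K" "w \<in> K" "dist z w < e"
    have "norm (h z - h w) \<le> B * norm (z - w)"
    proof (rule field_differentiable_bound[of "cball z e"])
      show "(h has_field_derivative deriv h x) (at x within cball z e)" if "x \<in> cball z e" for x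
        using that sub[OF zw(1)] \<open>K' \<subseteq> U\<close> holomorphic_derivI[OF h U] has_field_derivative_at_within by blast
    qed (use B sub[OF zw(1)] zw e in auto)
    then show "dist (h z) (h w) \<le> B * dist z w" by (simp add: dist_norm)
  qed (use B in auto)
qed

text \<open>Integration of an exact form along a Lipschitz curve that may have infinitely many
  corners and so need not be piecewise smooth: the composite is locally Lipschitz, and the chain
  rule holds off \<open>N\<close>.\<close>

lemma FTC_compose:
  fixes g :: "real \<Rightarrow> complex"
  assumes ab: "a \<le> b" and N: "countable N" and lip: "\<And>t u. dist (g t) (g u) \<le> \<bar>t - u\<bar>"
    and dg: "\<And>t. t \<notin> N \<Longrightarrow> (g has_vector_derivative g' t) (at t)"
    and U: "open U" "g ` {a..b} \<subseteq> U" and h: "\<And>z. z \<in> U \<Longrightarrow> (h has_field_derivative h' z) (at z)"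
  shows "((\<lambda>t. h' (g t) * g' t) has_integral h (g b) - h (g a)) {a..b}"
proof -
  have hol: "h holomorphic_on U"
    unfolding holomorphic_on_def using h by (meson field_differentiable_at_within field_differentiable_def)
  have "continuous_on {a..b} g"
    by (rule lipschitz_on_continuous_on[of 1]) (auto intro!: lipschitz_onI simp: lip dist_real_def)
  then have "compact (g ` {a..b})" by (intro compact_continuous_image) auto
  then obtain d C where dC: "0 < d" "0 \<le> C"
    "\<And>z w. z \<in> g ` {a..b} \<Longrightarrow> w \<in> g ` {a..b} \<Longrightarrow> dist z w < d \<Longrightarrow> dist (h z) (h w) \<le> C * dist z w"
    using holomorphic_locally_lipschitz[OF hol U(1) _ U(2)] by metis
  show ?thesis
  proof (rule FTC_locally_lipschitz[where f = "\<lambda>t. h (g t)" and d = d and C = C and N = N])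
    fix t u assume "t \<in> {a..b}" "u \<in> {a..b}" "\<bar>t - u\<bar> < d"
    then have "dist (h (g t)) (h (g u)) \<le> C * dist (g t) (g u)" using lip[of t u] by (intro dC(3)) auto
    also have "\<dots> \<le> C * \<bar>t - u\<bar>" by (rule mult_left_mono[OF lip dC(2)])
    finally show "dist (h (g t)) (h (g u)) \<le> C * \<bar>t - u\<bar>" .
  next
    fix t assume t: "t \<in> {a<..<b} - N"
    then have "g t \<in> U" "t \<notin> N" using U(2) by auto
    then show "((\<lambda>t. h (g t)) has_vector_derivative h' (g t) * g' t) (at t)"
      using field_vector_diff_chain_at[OF dg h] by (simp add: o_def mult.commute)
  qed (use ab N dC in auto)
qed

text \<open>Two continuous logarithms differ by a continuous function with values in the multiples
  of \<open>2 * pi * \<i>\<close>, hence by a constant. So any logarithm that can be written down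
  explicitly computes the winding number.\<close>

lemma winding_number_continuous_log:
  assumes p: "path p" and q: "path q" and pq: "\<And>t. t \<in> {0..1} \<Longrightarrow> p t = \<zeta> + exp (q t)"
  shows "pathfinish q - pathstart q = 2 * of_real pi * \<i> * winding_number p \<zeta>"
proof -
  have "\<zeta> \<notin> path_image p" using pq by (auto simp: path_image_def)
  then obtain r where r: "path r" "pathfinish r - pathstart r = 2 * of_real pi * \<i> * winding_number p \<zeta>"
    "\<And>t. t \<in> {0..1} \<Longrightarrow> p t = \<zeta> + exp (r t)"
    using winding_number_as_continuous_log[OF p] by blast
  have ints: "\<exists>k::int. q t - r t = of_int k * (2 * of_real pi * \<i>)" if "t \<in> {0..1}" for t
  proof -
    have "exp (q t) = exp (r t)" using pq[OF that] r(3)[OF that] by simp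
    then obtain n::int where "q t = r t + (of_int (2 * n) * pi) * \<i>" unfolding exp_eq by blast
    then show ?thesis by (intro exI[of _ n]) (simp add: algebra_simps)
  qed
  have "(\<lambda>t. q t - r t) constant_on {0..1}"
  proof (rule continuous_discrete_range_constant)
    show "continuous_on {0..1} (\<lambda>t. q t - r t)" using q r(1) by (intro continuous_intros) (auto simp: path_def)
    fix t :: real assume t: "t \<in> {0..1}"
    have "2 * pi \<le> norm ((q y - r y) - (q t - r t))" if y: "y \<in> {0..1}" "q y - r y \<noteq> q t - r t" for y
    proof -
      obtain k l where kl: "q t - r t = of_int k * (2 * of_real pi * \<i>)" "q y - r y = of_int l * (2 * of_real pi * \<i>)"
        using ints t y by metis
      have "(q y - r y) - (q t - r t) = of_int (l - k) * (2 * of_real pi * \<i>)"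
        unfolding kl by (simp add: algebra_simps)
      then have "norm ((q y - r y) - (q t - r t)) = \<bar>of_int (l - k)\<bar> * (2 * pi)" 
        by (simp only: norm_mult norm_of_int) (simp add: norm_mult)
      moreover have "1 \<le> \<bar>real_of_int (l - k)\<bar>" using y(2) kl by (cases "l = k") (auto simp del: of_int_diff)
      ultimately show ?thesis by (metis mult_le_cancel_right1 pi_ge_zero mult_nonneg_nonneg zero_le_numeral not_le)
    qed
    then show "\<exists>e>0. \<forall>y. y \<in> {0..1} \<and> q y - r y \<noteq> q t - r t \<longrightarrow> e \<le> norm (q y - r y - (q t - r t))"
      by (intro exI[of _ "2 * pi"]) auto
  qed auto
  then have "q 1 - r 1 = q 0 - r 0" unfolding constant_on_def by force
  then show ?thesis using r(2) by (simp add: pathfinish_def pathstart_def algebra_simps)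
qed

section \<open>Length of a curve\<close>

text \<open>The sum in \<open>curve_length\<close> in recursive form, suited to induction over
  concatenations.\<close>

fun polygon_length :: "complex list \<Rightarrow> real" where
  "polygon_length (x # y # xs) = dist x y + polygon_length (y # xs)"
| "polygon_length _ = 0"

lemma polygon_length_nonneg: "0 \<le> polygon_length xs"
  by (induction xs rule: polygon_length.induct) auto

lemma polygon_length_sum: "polygon_length xs = (\<Sum>i<length xs - 1. dist (xs ! i) (xs ! Suc i))"
proof (induction xs rule: polygon_length.induct)
  case (1 x y xs)
  then show ?case by (simp add: sum.lessThan_Suc_shift del: sum.lessThan_Suc)
qed auto

lemma polygon_length_append_ge: "polygon_length xs + polygon_length ys \<le> polygon_length (xs @ ys)"
proof (induction xs rule: polygon_length.induct)
  case ("2_2" v)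
  then show ?case by (cases ys) auto
qed auto

lemma polygon_length_append_le: "polygon_length (xs @ ys) \<le> polygon_length (xs @ [b]) + polygon_length (b # ys)"
proof (induction xs rule: polygon_length.induct)
  case ("2_1")
  then show ?case by (cases ys) (auto simp: zero_le_dist add_nonneg_nonneg)
next
  case ("2_2" v)
  then show ?case by (cases ys) (auto simp: dist_triangle)
qed auto

lemma curve_length_polygon:
  "curve_length g a b = (SUP ts \<in> {ts. sorted ts \<and> set ts \<subseteq> {a..b}}. ennreal (polygon_length (map g ts)))"
  unfolding curve_length_def polygon_length_sum
  by (intro SUP_cong) (auto simp: sum_ennreal)

lemma polygon_length_le_curve_length:
  assumes "sorted ts" "set ts \<subseteq> {a..b}"
  shows "ennreal (polygon_length (map g ts)) \<le> curve_length g a b"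
  unfolding curve_length_polygon by (rule SUP_upper) (use assms in auto)

lemma dist_le_curve_length: "a \<le> b \<Longrightarrow> ennreal (dist (g a) (g b)) \<le> curve_length g a b"
  using polygon_length_le_curve_length[of "[a, b]" a b g] by simp

lemma curve_length_least:
  assumes "\<And>ts. sorted ts \<Longrightarrow> set ts \<subseteq> {a..b} \<Longrightarrow> polygon_length (map g ts) \<le> B"
  shows "curve_length g a b \<le> ennreal B"
  unfolding curve_length_polygon by (rule SUP_least) (use assms in \<open>auto intro: ennreal_leI\<close>)

text \<open>A partition of the long interval is cut at \<open>b\<close>, and inserting
  \<open>b\<close> as a vertex does not shorten the polygon; conversely, partitions of the two
  pieces are concatenated.\<close>

lemma curve_length_additive:
  assumes "a \<le> b" "b \<le> c"
  shows "curve_length g a c = curve_length g a b + curve_length g b c"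
proof (rule antisym)
  show "curve_length g a c \<le> curve_length g a b + curve_length g b c"
    unfolding curve_length_polygon[of g a c]
  proof (rule SUP_least, safe)
    fix ts assume ts: "sorted ts" "set ts \<subseteq> {a..c}"
    define xs ys where "xs = takeWhile (\<lambda>t. t \<le> b) ts" and "ys = dropWhile (\<lambda>t. t \<le> b) ts"
    have app: "ts = xs @ ys" by (simp add: xs_def ys_def)
    have xsb: "\<And>t. t \<in> set xs \<Longrightarrow> t \<le> b" unfolding xs_def by (blast dest: set_takeWhileD)
    have ysb: "b \<le> t" if "t \<in> set ys" for t
    proof (cases ys)
      case (Cons y zs)
      then have "\<not> y \<le> b" unfolding ys_def by (metis hd_dropWhile list.sel(1) list.distinct(1))
      moreover have "y \<le> t" using that ts(1) Cons unfolding app by (auto simp: sorted_append)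
      ultimately show ?thesis by linarith
    qed (use that in auto)
    have "ennreal (polygon_length (map g ts))
      \<le> ennreal (polygon_length (map g (xs @ [b])) + polygon_length (map g (b # ys)))"
      unfolding app using polygon_length_append_le[of "map g xs" "map g ys" "g b"] by (intro ennreal_leI) simp
    also have "\<dots> = ennreal (polygon_length (map g (xs @ [b]))) + ennreal (polygon_length (map g (b # ys)))"
      by (intro ennreal_plus polygon_length_nonneg)
    also have "\<dots> \<le> curve_length g a b + curve_length g b c"
      using ts assms xsb ysb unfolding app
      by (intro add_mono polygon_length_le_curve_length) (auto simp: sorted_append)
    finally show "ennreal (polygon_length (map g ts)) \<le> curve_length g a b + curve_length g b c" .
  qed
  have *: "ennreal (polygon_length (map g xs)) + ennreal (polygon_length (map g ys)) \<le> curve_length g a c"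
    if "sorted xs" "set xs \<subseteq> {a..b}" "sorted ys" "set ys \<subseteq> {b..c}" for xs ys
  proof -
    have "ennreal (polygon_length (map g xs)) + ennreal (polygon_length (map g ys))
      = ennreal (polygon_length (map g xs) + polygon_length (map g ys))"
      by (intro ennreal_plus[symmetric] polygon_length_nonneg)
    also have "\<dots> \<le> ennreal (polygon_length (map g (xs @ ys)))"
      using polygon_length_append_ge by (intro ennreal_leI) simp
    also have "\<dots> \<le> curve_length g a c"
      using that assms by (intro polygon_length_le_curve_length) (fastforce simp: sorted_append)+
    finally show ?thesis .
  qed
  have ne: "{ts. sorted ts \<and> set ts \<subseteq> {s..u}} \<noteq> {}" for s u :: real
    by (auto intro: exI[of _ "[]"])
  show "curve_length g a b + curve_length g b c \<le> curve_length g a c"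
  proof -
    have "curve_length g a b + curve_length g b c =
        (SUP xs \<in> {ts. sorted ts \<and> set ts \<subseteq> {a..b}}. ennreal (polygon_length (map g xs)) + curve_length g b c)"
      unfolding curve_length_polygon[of g a b] by (rule ennreal_SUP_add_left[OF ne, symmetric])
    also have "\<dots> \<le> curve_length g a c"
    proof (rule SUP_least)
      fix xs assume xs: "xs \<in> {ts. sorted ts \<and> set ts \<subseteq> {a..b}}"
      have "ennreal (polygon_length (map g xs)) + curve_length g b c =
          (SUP ys \<in> {ts. sorted ts \<and> set ts \<subseteq> {b..c}}. ennreal (polygon_length (map g xs)) + ennreal (polygon_length (map g ys)))"
        unfolding curve_length_polygon[of g b c] by (rule ennreal_SUP_add_right[OF ne])
      also have "\<dots> \<le> curve_length g a c" by (rule SUP_least) (use xs * in auto)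
      finally show "ennreal (polygon_length (map g xs)) + curve_length g b c \<le> curve_length g a c" .
    qed
    finally show ?thesis .
  qed
qed

lemma curve_length_lipschitz:
  assumes lip: "\<And>t u. dist (g t) (g u) \<le> C * \<bar>t - u\<bar>" and ab: "a \<le> b"
  shows "curve_length g a b \<le> ennreal (C * (b - a))"
proof (rule curve_length_least)
  fix ts assume ts: "sorted ts" "set ts \<subseteq> {a..b}"
  have C0: "0 \<le> C" using order_trans[OF zero_le_dist lip[of 1 0]] by simp
  show "polygon_length (map g ts) \<le> C * (b - a)"
  proof (cases ts)
    case (Cons x xs)
    have "sorted (x # xs) \<Longrightarrow> set (x # xs) \<subseteq> {..b} \<Longrightarrow> polygon_length (map g (x # xs)) \<le> C * (b - x)"
    proof (induction xs arbitrary: x)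
      case (Cons y ys)
      have "polygon_length (map g (y # ys)) \<le> C * (b - y)" using Cons.prems by (intro Cons.IH) auto
      moreover have "dist (g x) (g y) \<le> C * (y - x)" using lip[of x y] Cons.prems by simp
      ultimately show ?case by (simp add: algebra_simps)
    qed (use C0 in simp)
    moreover have "sorted (x # xs)" "set (x # xs) \<subseteq> {..b}" using ts Cons by fastforce+
    ultimately have "polygon_length (map g ts) \<le> C * (b - x)" using Cons by blast
    also have "\<dots> \<le> C * (b - a)" using C0 ts Cons by (intro mult_left_mono) auto
    finally show ?thesis .
  qed (use C0 ab in simp)
qed

text \<open>An increasing bijection carries the partitions of one interval onto those of the
  other.\<close>

lemma curve_length_reparam:
  assumes mono: "strict_mono \<theta>" and surj: "surj (\<theta> :: real \<Rightarrow> real)"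
  shows "curve_length (\<lambda>t. g (\<theta> t)) a b = curve_length g (\<theta> a) (\<theta> b)"
proof -
  have le: "\<theta> x \<le> \<theta> y \<longleftrightarrow> x \<le> y" for x y using mono by (rule strict_mono_less_eq)
  have sorted_map: "sorted (map \<theta> ts) \<longleftrightarrow> sorted ts" for ts by (simp add: sorted_wrt_map le)
  have "{ts. sorted ts \<and> set ts \<subseteq> {\<theta> a..\<theta> b}} = map \<theta> ` {ts. sorted ts \<and> set ts \<subseteq> {a..b}}"
  proof safe
    fix ts assume ts: "sorted ts" "set ts \<subseteq> {\<theta> a..\<theta> b}"
    define us where "us = map (inv \<theta>) ts"
    have eq: "ts = map \<theta> us" unfolding us_def using surj by (simp add: o_def surj_f_inv_f)
    then have "sorted us" "set us \<subseteq> {a..b}" using ts sorted_map by (auto simp: le)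
    then show "ts \<in> map \<theta> ` {ts. sorted ts \<and> set ts \<subseteq> {a..b}}" using eq by blast
  qed (auto simp: sorted_map le)
  then show ?thesis unfolding curve_length_polygon by (simp add: image_image o_def)
qed

section \<open>Planar convex bodies\<close>

locale convex_body =
  fixes \<Omega> :: "complex set" and z0 :: complex
  assumes compact: "compact \<Omega>" and convex: "convex \<Omega>" and z0: "z0 \<in> interior \<Omega>"
begin

lemma closed: "closed \<Omega>" using compact by (rule compact_imp_closed)

lemma frontier_subset: "frontier \<Omega> \<subseteq> \<Omega>" using closed by (rule frontier_subset_closed)

lemma frontier_eq: "frontier \<Omega> = \<Omega> - interior \<Omega>" using closed by (simp add: frontier_def)

lemma compact_frontier: "compact (frontier \<Omega>)" using compact by (rule compact_frontier)

text \<open>Outer unit normals of supporting lines; \<open>Re (cnj n * w)\<close> is the real inner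
  product of \<open>n\<close> and \<open>w\<close> in the plane.\<close>

definition unit_normal :: "complex \<Rightarrow> complex \<Rightarrow> bool" where
  "unit_normal \<zeta> n \<longleftrightarrow> cmod n = 1 \<and> (\<forall>z\<in>\<Omega>. Re (cnj n * (z - \<zeta>)) \<le> 0)"

lemma unit_normalD:
  assumes "unit_normal \<zeta> n"
  shows "cmod n = 1" "z \<in> \<Omega> \<Longrightarrow> Re (cnj n * (z - \<zeta>)) \<le> 0"
  using assms unfolding unit_normal_def by blast+

lemma unit_normal_exists:
  assumes "\<zeta> \<in> frontier \<Omega>"
  obtains n where "unit_normal \<zeta> n"
proof -
  have ri: "rel_interior \<Omega> = interior \<Omega>" using z0 rel_interior_nonempty_interior by auto
  obtain a where a: "a \<noteq> 0" "\<And>y. y \<in> \<Omega> \<Longrightarrow> a \<bullet> \<zeta> \<le> a \<bullet> y"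
    using supporting_hyperplane_rel_boundary[OF convex, of \<zeta>] assms ri
    by (metis Diff_iff frontier_eq)
  have "unit_normal \<zeta> (- sgn a)"
    unfolding unit_normal_def
  proof safe
    show "cmod (- sgn a) = 1" using a by (simp add: norm_sgn)
    fix z assume "z \<in> \<Omega>"
    then have "0 \<le> a \<bullet> (z - \<zeta>)" using a(2) by (simp add: inner_diff_right)
    then have "0 \<le> Re (cnj a * (z - \<zeta>))" by (simp add: inner_complex_def)
    then have "0 \<le> Re (cnj a * (z - \<zeta>)) / cmod a" by simp
    also have "\<dots> = Re (cnj a * (z - \<zeta>) / of_real (cmod a))" by simp
    finally show "Re (cnj (- sgn a) * (z - \<zeta>)) \<le> 0" by (simp add: sgn_eq)
  qed
  then show thesis by (rule that)
qed

text \<open>The inscribed disc contains \<open>z0 + of_real r * n\<close>, to which the supporting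
  inequality is applied. The uniform \<open>r\<close> controls the polar radius, decides the
  direction of the tangent, and measures what a dilation towards \<open>z0\<close> gains.\<close>

lemma inradius:
  obtains r where "0 < r" "cball z0 r \<subseteq> \<Omega>"
    "\<And>\<zeta> n. unit_normal \<zeta> n \<Longrightarrow> r \<le> Re (cnj n * (\<zeta> - z0))"
proof -
  obtain r where r: "0 < r" "cball z0 r \<subseteq> \<Omega>" using z0 mem_interior_cball by blast
  have "r \<le> Re (cnj n * (\<zeta> - z0))" if n: "unit_normal \<zeta> n" for \<zeta> n
  proof -
    have n1: "cmod n = 1" using n by (simp add: unit_normal_def)
    have "z0 + of_real r * n \<in> \<Omega>" using r n1 by (auto simp: dist_norm norm_mult intro!: subsetD[OF r(2)])
    then have "Re (cnj n * (z0 + of_real r * n - \<zeta>)) \<le> 0" by (rule unit_normalD(2)[OF n])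
    moreover have "cnj n * (z0 + of_real r * n - \<zeta>) = of_real r - cnj n * (\<zeta> - z0)"
    proof -
      have "n * cnj n = 1" using complex_norm_square[of n] n1 by simp
      then have "cnj n * (of_real r * n) = of_real r" by (metis mult.commute mult.assoc mult.right_neutral)
      then show ?thesis by (simp add: algebra_simps)
    qed
    ultimately show ?thesis by simp
  qed
  then show thesis using r that by blast
qed

text \<open>A nearer boundary point would lie in the open segment from an interior point to a point
  of the closure, hence in the interior.\<close>

lemma frontier_ray_unique:
  assumes "z0 + of_real d * v \<in> frontier \<Omega>" "z0 + of_real e * v \<in> frontier \<Omega>" "0 < d" "0 < e"
  shows "d = e"
proof -
  have False if de: "z0 + of_real d * v \<in> frontier \<Omega>" "z0 + of_real e * v \<in> frontier \<Omega>" "0 < d" "d < e" for d e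
  proof -
    have v: "v \<noteq> 0" using de(1) z0 by (auto simp: frontier_eq)
    have "z0 + of_real d * v \<in> open_segment z0 (z0 + of_real e * v)"
      unfolding in_segment using de v
      by (intro conjI exI[of _ "d / e"]) (auto simp: scaleR_conv_of_real algebra_simps)
    moreover have "z0 + of_real e * v \<in> closure \<Omega>" using de(2) by (simp add: frontier_def)
    ultimately show False
      using in_interior_closure_convex_segment[OF convex z0] de(1) by (auto simp: frontier_eq)
  qed
  then show ?thesis using assms by (meson linorder_neqE_linordered_idom)
qed

lemma frontier_same_ray:
  assumes "z \<in> frontier \<Omega>" "w \<in> frontier \<Omega>" "sgn (z - z0) = sgn (w - z0)"
  shows "z = w"
proof -
  have z: "z = z0 + of_real (cmod (z - z0)) * sgn (z - z0)" for z by (simp add: sgn_eq)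
  have "z \<noteq> z0" "w \<noteq> z0" using assms z0 by (auto simp: frontier_eq)
  then have "cmod (z - z0) = cmod (w - z0)"
    using assms z[of z] z[of w] by (intro frontier_ray_unique[of _ "sgn (z - z0)"]) auto
  then show ?thesis using assms(3) z[of z] z[of w] by metis
qed

text \<open>Existence: the polar parametrization about \<open>z0\<close> is Lipschitz; reparametrize it by the inverse of its
  length function.\<close>

lemma polar_parametrization:
  obtains \<rho> :: "real \<Rightarrow> real" and C where
    "\<And>t. 0 < \<rho> t" "\<And>t. \<rho> (t + 2 * pi) = \<rho> t" "range (\<lambda>t. z0 + of_real (\<rho> t) * cis t) = frontier \<Omega>"
    "\<And>t u. dist (z0 + of_real (\<rho> t) * cis t) (z0 + of_real (\<rho> u) * cis u) \<le> C * \<bar>t - u\<bar>"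
proof -
  define \<rho> where "\<rho> t = (SOME d. 0 < d \<and> z0 + of_real d * cis t \<in> frontier \<Omega>)" for t
  have rho: "0 < \<rho> t \<and> z0 + of_real (\<rho> t) * cis t \<in> frontier \<Omega>" for t
    unfolding \<rho>_def
  proof (rule someI_ex)
    show "\<exists>d>0. z0 + of_real d * cis t \<in> frontier \<Omega>"
      using ray_to_frontier[OF compact_imp_bounded[OF compact] z0, of "cis t"]
      by (metis cis_neq_zero scaleR_conv_of_real)
  qed
  obtain r where r: "0 < r" "\<And>\<zeta> n. unit_normal \<zeta> n \<Longrightarrow> r \<le> Re (cnj n * (\<zeta> - z0))" using inradius by metis
  obtain M where M: "\<And>z. z \<in> \<Omega> \<Longrightarrow> cmod (z - z0) \<le> M" "0 < M"
  proof -
    have "bounded ((\<lambda>z. z - z0) ` \<Omega>)" using compact_imp_bounded[OF compact] by (rule bounded_translation_minus)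
    then show thesis using that unfolding bounded_pos by auto
  qed
  have rhoM: "\<rho> t \<le> M" for t
    using M(1)[of "z0 + of_real (\<rho> t) * cis t"] rho[of t] frontier_subset by (auto simp: norm_mult)
  \<comment> \<open>A supporting line at angle \<open>t\<close> limits the growth of the radius
    towards angle \<open>u\<close>. The line cannot be nearly parallel to the ray: its normal makes
    with the ray an angle of cosine \<open>c\<close>, at least \<open>r / M\<close> by the
    inradius.\<close>
  have one: "\<rho> u - \<rho> t \<le> M\<^sup>2 / r * cmod (cis t - cis u)" for t u
  proof -
    define a b where "a = z0 + of_real (\<rho> t) * cis t" and "b = z0 + of_real (\<rho> u) * cis u"
    have fr: "a \<in> frontier \<Omega>" "b \<in> \<Omega>" using rho frontier_subset by (auto simp: a_def b_def)
    obtain n where n: "unit_normal a n" using unit_normal_exists[OF fr(1)] .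
    have n1: "cmod n = 1" using n by (simp add: unit_normal_def)
    define c where "c = Re (cnj n * cis t)"
    have "Re (cnj n * (b - a)) \<le> 0" by (rule unit_normalD(2)[OF n fr(2)])
    moreover have "cnj n * (b - a) = of_real (\<rho> u - \<rho> t) * (cnj n * cis t) - of_real (\<rho> u) * (cnj n * (cis t - cis u))"
      by (simp add: a_def b_def algebra_simps)
    ultimately have le: "(\<rho> u - \<rho> t) * c \<le> \<rho> u * Re (cnj n * (cis t - cis u))"
    proof -
      have "Re (of_real k * v - of_real l * w) = k * Re v - l * Re w" for k l v w by simp
      then show ?thesis using \<open>Re (cnj n * (b - a)) \<le> 0\<close>
        \<open>cnj n * (b - a) = of_real (\<rho> u - \<rho> t) * (cnj n * cis t) - of_real (\<rho> u) * (cnj n * (cis t - cis u))\<close>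
        by (simp only: c_def)
    qed
    have "r \<le> \<rho> t * c" using r(2)[OF n] by (simp add: a_def c_def algebra_simps)
    then have c: "r / M \<le> c"
    proof -
      have "0 < c" using \<open>r \<le> \<rho> t * c\<close> r(1) rho[of t] by (metis less_le_trans zero_less_mult_pos)
      then have "\<rho> t * c \<le> M * c" using rhoM[of t] by (intro mult_right_mono) auto
      then show ?thesis using \<open>r \<le> \<rho> t * c\<close> M(2) by (simp add: field_simps)
    qed
    show ?thesis
    proof (cases "\<rho> u \<le> \<rho> t")
      case True
      then show ?thesis using r(1) by (smt (verit) divide_nonneg_pos mult_nonneg_nonneg norm_ge_zero zero_le_power2)
    next
      case False
      then have "(\<rho> u - \<rho> t) * (r / M) \<le> (\<rho> u - \<rho> t) * c" using c by (intro mult_left_mono) auto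
      also have "\<dots> \<le> \<rho> u * Re (cnj n * (cis t - cis u))" by (rule le)
      also have "\<dots> \<le> M * cmod (cis t - cis u)"
      proof -
        have "Re (cnj n * (cis t - cis u)) \<le> cmod (cis t - cis u)"
          using complex_Re_le_cmod[of "cnj n * (cis t - cis u)"] n1 by (simp add: norm_mult)
        then have "\<rho> u * Re (cnj n * (cis t - cis u)) \<le> \<rho> u * cmod (cis t - cis u)"
          using rho[of u] by (intro mult_left_mono) auto
        also have "\<dots> \<le> M * cmod (cis t - cis u)" using rhoM by (intro mult_right_mono) auto
        finally show ?thesis .
      qed
      finally show ?thesis using r(1) M(2) by (simp add: field_simps power2_eq_square)
    qed
  qed
  have cis_lip: "cmod (cis t - cis u) \<le> \<bar>t - u\<bar>" for t u
  proof -
    have "cis t - cis u = cis u * (exp (\<i> * of_real (t - u)) - 1)"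
      unfolding cis_conv_exp[symmetric] right_diff_distrib by (simp add: cis_mult)
    then have "cmod (cis t - cis u) = 2 * \<bar>sin ((t - u) / 2)\<bar>"
      by (simp only: norm_mult dist_exp_i_1 norm_cis)
    also have "\<dots> \<le> 2 * \<bar>(t - u) / 2\<bar>" by (intro mult_left_mono abs_sin_x_le_abs_x) auto
    finally show ?thesis by simp
  qed
  show thesis
  proof (rule that[of \<rho> "M\<^sup>2 / r + M"])
    show "\<rho> (t + 2 * pi) = \<rho> t" for t
      unfolding \<rho>_def by (simp add: cis_mult[symmetric])
    show "range (\<lambda>t. z0 + of_real (\<rho> t) * cis t) = frontier \<Omega>"
    proof (intro equalityI subsetI)
      fix z assume z: "z \<in> frontier \<Omega>"
      then have "z \<noteq> z0" using z0 by (auto simp: frontier_eq)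
      obtain t where t: "sgn (z - z0) = cis t" using \<open>z \<noteq> z0\<close>
        by (metis cis_Arg right_minus_eq)
      have "sgn (z0 + of_real (\<rho> t) * cis t - z0) = cis t" using rho[of t] by (simp add: sgn_mult sgn_of_real sgn_cis)
      then have "z = z0 + of_real (\<rho> t) * cis t" using t by (intro frontier_same_ray[OF z conjunct2[OF rho[of t]]]) metis
      then show "z \<in> range (\<lambda>t. z0 + of_real (\<rho> t) * cis t)" by blast
    next
      fix z assume "z \<in> range (\<lambda>t. z0 + of_real (\<rho> t) * cis t)"
      then show "z \<in> frontier \<Omega>" using rho by blast
    qed
    show "dist (z0 + of_real (\<rho> t) * cis t) (z0 + of_real (\<rho> u) * cis u) \<le> (M\<^sup>2 / r + M) * \<bar>t - u\<bar>" for t u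
    proof -
      have "\<bar>\<rho> t - \<rho> u\<bar> \<le> M\<^sup>2 / r * cmod (cis t - cis u)"
        using one[of t u] one[of u t] by (simp add: abs_le_iff norm_minus_commute)
      also have "\<dots> \<le> M\<^sup>2 / r * \<bar>t - u\<bar>" using r(1) cis_lip by (intro mult_left_mono) auto
      finally have 1: "\<bar>\<rho> t - \<rho> u\<bar> \<le> M\<^sup>2 / r * \<bar>t - u\<bar>" .
      have "of_real (\<rho> t) * cis t - of_real (\<rho> u) * cis u
          = of_real (\<rho> t - \<rho> u) * cis t + of_real (\<rho> u) * (cis t - cis u)" by (simp add: algebra_simps)
      then have "dist (z0 + of_real (\<rho> t) * cis t) (z0 + of_real (\<rho> u) * cis u)
          \<le> cmod (of_real (\<rho> t - \<rho> u) * cis t) + cmod (of_real (\<rho> u) * (cis t - cis u))"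
        unfolding dist_norm add_diff_cancel_left by (metis norm_triangle_ineq)
      also have "\<dots> = \<bar>\<rho> t - \<rho> u\<bar> + \<rho> u * cmod (cis t - cis u)"
        unfolding norm_mult norm_of_real using rho[of u] by simp
      also have "\<dots> \<le> M\<^sup>2 / r * \<bar>t - u\<bar> + M * \<bar>t - u\<bar>"
        using 1 cis_lip[of t u] rhoM[of u] M(2) by (intro add_mono mult_mono) auto
      finally show ?thesis by (simp add: algebra_simps)
    qed
    show "0 < \<rho> t" for t using rho by blast
  qed
qed

lemma winding_number_interior:
  assumes p: "path p" "pathfinish p = pathstart p" "path_image p \<subseteq> frontier \<Omega>"
    and z: "z \<in> interior \<Omega>"
  shows "winding_number p z = winding_number p z0"
  by (rule winding_number_eq[OF p(1,2) z z0])
    (use p(3) convex in \<open>auto simp: frontier_eq convex_connected\<close>)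

text \<open>\<open>perimeter\<close> and \<open>boundary_curve\<close> are values of
  \<open>SOME\<close>; all knowledge about them rests on this existence.\<close>

lemma arclength_parametrization_exists: "\<exists>L g. arclength_parametrization \<Omega> L g"
proof -
  obtain \<rho> :: "real \<Rightarrow> real" and C where rho: "\<And>t. 0 < \<rho> t" "\<And>t. \<rho> (t + 2 * pi) = \<rho> t"
    and ran: "range (\<lambda>t. z0 + of_real (\<rho> t) * cis t) = frontier \<Omega>"
    and lip: "\<And>t u. dist (z0 + of_real (\<rho> t) * cis t) (z0 + of_real (\<rho> u) * cis u) \<le> C * \<bar>t - u\<bar>"
    by (rule polar_parametrization) blast
  define \<gamma> where "\<gamma> t = z0 + of_real (\<rho> t) * cis t" for t
  have lip': "dist (\<gamma> t) (\<gamma> u) \<le> C * \<bar>t - u\<bar>" for t u unfolding \<gamma>_def by (rule lip)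
  have per: "\<gamma> (t + 2 * pi) = \<gamma> t" for t by (simp add: \<gamma>_def rho cis_mult[symmetric])
  have inj: "\<exists>k::int. s = t + 2 * pi * of_int k" if "\<gamma> s = \<gamma> t" for s t
  proof -
    have "sgn (\<gamma> s - z0) = cis s" for s using rho(1)[of s] by (simp add: \<gamma>_def sgn_mult sgn_of_real sgn_cis)
    then have "cis s = cis t" using that by metis
    then have "sin s = sin t \<and> cos s = cos t" by (simp add: complex_eq_iff)
    then obtain k::int where "s = t + 2 * pi * k" using sin_cos_eq_iff by blast
    then show ?thesis by blast
  qed
  define l where "l a b = enn2real (curve_length \<gamma> a b)" for a b
  have l: "curve_length \<gamma> a b = ennreal (l a b)" if "a \<le> b" for a b
    using curve_length_lipschitz[OF lip' that] unfolding l_def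
    by (metis ennreal_enn2real ennreal_less_top order_le_less_trans)
  have l0: "0 \<le> l a b" for a b by (simp add: l_def)
  have l_add: "l a c = l a b + l b c" if "a \<le> b" "b \<le> c" for a b c
  proof -
    have "ennreal (l a c) = ennreal (l a b + l b c)"
      using curve_length_additive[OF that, of \<gamma>] that by (simp add: l l0)
    then show ?thesis using l0 by (simp add: add_nonneg_nonneg del: ennreal_plus)
  qed
  have l_le: "l a b \<le> C * (b - a)" if "a \<le> b" for a b
  proof -
    have "0 \<le> C" using order_trans[OF zero_le_dist lip'[of 1 0]] by simp
    then show ?thesis using curve_length_lipschitz[OF lip' that] that by (simp add: l)
  qed
  have l_dist: "dist (\<gamma> a) (\<gamma> b) \<le> l a b" if "a \<le> b" for a b
    using dist_le_curve_length[OF that, of \<gamma>] l0 by (simp add: l that)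
  have l_pos: "0 < l a b" if "a < b" for a b
  proof -
    \<comment> \<open>At most half a turn beyond \<open>a\<close>, so that \<open>\<gamma> c\<close>
      differs from \<open>\<gamma> a\<close> even when the whole arc closes up.\<close>
    define c where "c = min b (a + pi)"
    have c: "a < c" "c \<le> b" "c \<le> a + pi" using that by (auto simp: c_def)
    have "\<gamma> c \<noteq> \<gamma> a"
    proof
      assume "\<gamma> c = \<gamma> a"
      then obtain k::int where k: "c = a + 2 * pi * of_int k" using inj by blast
      then have "0 < of_int k * (2 * pi)" "of_int k * (2 * pi) < 1 * (2 * pi)" using c by (auto simp: mult.commute)
      then have "0 < real_of_int k" "real_of_int k < 1" by (auto simp: zero_less_mult_iff)
      then show False by simp
    qed
    then have "0 < dist (\<gamma> a) (\<gamma> c)" by auto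
    also have "\<dots> \<le> l a c" using c by (intro l_dist) auto
    also have "\<dots> \<le> l a b" using l_add[of a c b] c l0[of c b] by simp
    finally show ?thesis .
  qed
  have l_shift: "l (a + 2 * pi) (b + 2 * pi) = l a b" for a b
  proof -
    have "surj (\<lambda>t::real. t + 2 * pi)" by (rule surjI[of _ "\<lambda>t. t - 2 * pi"]) simp
    then have "curve_length (\<lambda>t. \<gamma> (t + 2 * pi)) a b = curve_length \<gamma> (a + 2 * pi) (b + 2 * pi)"
      by (intro curve_length_reparam) (auto simp: strict_mono_def)
    then show ?thesis by (simp add: per l_def)
  qed
  \<comment> \<open>Signed length measured from the parameter 0. It is strictly increasing,
    continuous and onto, and its inverse \<open>\<theta>\<close> is the change of parameter.\<close>
  define S where "S t = (if 0 \<le> t then l 0 t else - l t 0)" for t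
  define L where "L = l 0 (2 * pi)"
  have L: "0 < L" unfolding L_def by (rule l_pos) simp
  have S_diff: "S b - S a = l a b" if "a \<le> b" for a b
    using that l_add[of a 0 b] l_add[of 0 a b] l_add[of a b 0] by (auto simp: S_def)
  have S_mono: "strict_mono S"
    by (rule strict_monoI) (use S_diff l_pos in \<open>metis diff_gt_0_iff_gt less_imp_le\<close>)
  have S_per1: "S (t + 2 * pi) = S t + L" for t
  proof -
    have "l 0 0 = 0" using l_add[of 0 0 0] by simp
    then have S0: "S 0 = 0" "S (2 * pi) = L" by (auto simp: S_def L_def)
    have d: "S (b + 2 * pi) - S (a + 2 * pi) = S b - S a" if "a \<le> b" for a b
      using S_diff[of a b] S_diff[of "a + 2 * pi" "b + 2 * pi"] l_shift that by simp
    show ?thesis using d[of 0 t] d[of t 0] S0 by (cases "0 \<le> t") auto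
  qed
  have S_per: "S (t + 2 * pi * of_int k) = S t + of_int k * L" for t and k::int
  proof (induction k rule: int_induct[of _ 0])
    case (step1 i)
    have "S (t + 2 * pi * of_int (i + 1)) = S ((t + 2 * pi * of_int i) + 2 * pi)" by (simp add: algebra_simps)
    also have "\<dots> = S (t + 2 * pi * of_int i) + L" by (rule S_per1)
    finally show ?case using step1(2) by (simp add: distrib_right)
  next
    case (step2 i)
    have "S (t + 2 * pi * of_int i) = S ((t + 2 * pi * of_int (i - 1)) + 2 * pi)" by (simp add: algebra_simps)
    also have "\<dots> = S (t + 2 * pi * of_int (i - 1)) + L" by (rule S_per1)
    finally show ?case using step2(2) by (simp add: left_diff_distrib)
  qed simp
  have S_cont: "continuous_on UNIV S"
  proof (rule lipschitz_on_continuous_on[of "max C 0"], rule lipschitz_onI)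
    have *: "dist (S x) (S y) \<le> max C 0 * dist x y" if "x \<le> y" for x y
    proof -
      have "dist (S x) (S y) = l x y" using S_diff[OF that] l0[of x y] by (simp add: dist_real_def)
      also have "\<dots> \<le> C * (y - x)" using that by (rule l_le)
      also have "\<dots> \<le> max C 0 * dist x y" using that by (auto simp: dist_real_def intro!: mult_right_mono)
      finally show ?thesis .
    qed
    show "dist (S x) (S y) \<le> max C 0 * dist x y" for x y
      using *[of x y] *[of y x] by (cases "x \<le> y") (auto simp: dist_commute)
  qed auto
  have S_surj: "surj S"
  proof -
    have "\<exists>x. S x = y" for y
    proof -
      \<comment> \<open>So many full turns in both directions that \<open>S\<close> passes below and
        above \<open>y\<close>.\<close>
      define k where "k = \<lceil>\<bar>y - S 0\<bar> / L\<rceil>"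
      have "\<bar>y - S 0\<bar> / L \<le> of_int k" unfolding k_def by (rule le_of_int_ceiling)
      then have k: "\<bar>y - S 0\<bar> \<le> of_int k * L" using L by (simp add: pos_divide_le_eq)
      have "0 \<le> k" unfolding k_def using L by (intro zero_le_ceiling[THEN iffD2]) (auto intro: less_le_trans[of _ 0])
      have "\<exists>x\<ge>2 * pi * of_int (- k). x \<le> 2 * pi * of_int k \<and> S x = y"
        using k S_per[of 0 k] S_per[of 0 "- k"] \<open>0 \<le> k\<close>
        by (intro IVT' continuous_on_subset[OF S_cont]) auto
      then show ?thesis by blast
    qed
    then show ?thesis by (metis surjI)
  qed
  define \<theta> where "\<theta> = inv S"
  have S\<theta>: "S (\<theta> s) = s" for s unfolding \<theta>_def using S_surj by (rule surj_f_inv_f)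
  have \<theta>S: "\<theta> (S t) = t" for t unfolding \<theta>_def by (rule inv_f_f[OF strict_mono_imp_inj_on[OF S_mono]])
  have \<theta>_mono: "strict_mono \<theta>"
    by (rule strict_monoI) (metis S\<theta> S_mono strict_mono_less)
  have \<theta>_surj: "surj \<theta>" by (rule surjI[of _ S]) (rule \<theta>S)
  have \<theta>_cont: "continuous_on UNIV \<theta>"
    by (rule continuous_onI_mono) (use \<theta>_surj \<theta>_mono in \<open>auto simp: strict_mono_less_eq\<close>)
  have \<theta>_per: "\<theta> (s + of_int k * L) = \<theta> s + 2 * pi * of_int k" for s and k::int
    by (metis S\<theta> S_per \<theta>S)
  define g where "g s = \<gamma> (\<theta> s)" for s
  have g_len: "curve_length g a b = ennreal (b - a)" if "a \<le> b" for a b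
  proof -
    have "\<theta> a \<le> \<theta> b" using \<theta>_mono that by (simp add: strict_mono_less_eq)
    then show ?thesis unfolding g_def curve_length_reparam[OF \<theta>_mono \<theta>_surj]
      using S_diff[of "\<theta> a" "\<theta> b"] by (simp add: l S\<theta>)
  qed
  have cont_\<gamma>: "continuous_on UNIV \<gamma>"
    by (rule lipschitz_on_continuous_on[of C])
      (use lip' order_trans[OF zero_le_dist lip'[of 1 0]] in \<open>auto intro!: lipschitz_onI simp: dist_real_def\<close>)
  have g_cont: "continuous_on UNIV g"
    unfolding g_def by (rule continuous_on_compose2[OF cont_\<gamma> \<theta>_cont]) auto
  define p where "p t = g (L * t)" for t
  have path: "path p" unfolding path_def p_def
    by (rule continuous_on_compose2[OF g_cont]) (auto intro!: continuous_intros)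
  have \<theta>1: "\<theta> (s + L) = \<theta> s + 2 * pi" for s using \<theta>_per[of s 1] by simp
  have g_per: "g (s + L) = g s" for s by (simp add: g_def \<theta>1 per)
  have g_range: "range g = frontier \<Omega>"
  proof -
    have "range g = \<gamma> ` range \<theta>" by (auto simp: g_def)
    then show ?thesis using \<theta>_surj ran by (simp add: \<gamma>_def[abs_def])
  qed
  have loop: "pathfinish p = pathstart p" using g_per[of 0] by (simp add: pathfinish_def pathstart_def p_def)
  have simple: "simple_path p"
    unfolding simple_path_def loop_free_def
  proof (intro conjI path ballI impI)
    fix x y :: real assume xy: "x \<in> {0..1}" "y \<in> {0..1}" "p x = p y"
    then obtain k::int where "\<theta> (L * x) = \<theta> (L * y) + 2 * pi * of_int k" using inj by (auto simp: p_def g_def)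
    then have "L * x = L * y + of_int k * L" by (metis S\<theta> S_per)
    then have "L * x = L * (y + of_int k)" by (simp only: distrib_left mult.commute)
    then have k: "x = y + of_int k" using L by simp
    then have "-1 \<le> real_of_int k" "real_of_int k \<le> 1" using xy by auto
    then have "k = -1 \<or> k = 0 \<or> k = 1" by linarith
    then show "x = y \<or> x = 0 \<and> y = 1 \<or> x = 1 \<and> y = 0" using k xy by auto
  qed
  have wn0: "winding_number p z0 = 1"
  proof -
    \<comment> \<open>An explicit continuous logarithm of \<open>p - z0\<close>: log-radius plus
      \<open>\<i>\<close> times the polar angle. Over one period only the angle changes, by
      \<open>2 * pi\<close>.\<close>
    define q where "q t = of_real (ln (\<rho> (\<theta> (L * t)))) + \<i> * of_real (\<theta> (L * t))" for t
    have "\<rho> t = cmod (\<gamma> t - z0)" for t using rho(1)[of t] by (simp add: \<gamma>_def norm_mult)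
    then have cr: "continuous_on UNIV \<rho>" using cont_\<gamma> by (simp add: continuous_intros)
    have ct: "continuous_on {0..1} (\<lambda>t. \<theta> (L * t))"
      by (rule continuous_on_compose2[OF \<theta>_cont]) (auto intro!: continuous_intros)
    have "path q" unfolding path_def q_def
      by (intro continuous_intros continuous_on_compose2[OF cr] ct) (use rho(1) in \<open>auto simp: less_imp_neq[symmetric]\<close>)
    moreover have "p t = z0 + exp (q t)" for t
      using rho(1)[of "\<theta> (L * t)"] by (simp add: q_def exp_add p_def g_def \<gamma>_def cis_conv_exp exp_of_real)
    ultimately have "pathfinish q - pathstart q = 2 * of_real pi * \<i> * winding_number p z0"
      by (intro winding_number_continuous_log path)
    moreover have "pathfinish q - pathstart q = 2 * of_real pi * \<i>"
      using \<theta>1[of 0] rho(2)[of "\<theta> 0"] by (simp add: pathfinish_def pathstart_def q_def algebra_simps)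
    ultimately show ?thesis by simp
  qed
  have "path_image p \<subseteq> frontier \<Omega>" using g_range by (auto simp: path_image_def p_def)
  then have "winding_number p z = 1" if "z \<in> interior \<Omega>" for z
    using winding_number_interior[OF path loop _ that] wn0 by simp
  then have "arclength_parametrization \<Omega> L g"
    unfolding arclength_parametrization_def using L g_per g_range simple g_len
    by (auto simp: p_def[abs_def])
  then show ?thesis by blast
qed

subsection \<open>Corners\<close>

definition corners :: "complex set" where
  "corners = {\<zeta> \<in> frontier \<Omega>. \<exists>n m. unit_normal \<zeta> n \<and> unit_normal \<zeta> m \<and> n \<noteq> m}"

text \<open>The value 0 at corners and off the boundary makes the half-plane inequality and Borel
  measurability hold without exceptions.\<close>

definition normal :: "complex \<Rightarrow> complex" where
  "normal \<zeta> = (if \<zeta> \<in> frontier \<Omega> - corners then THE n. unit_normal \<zeta> n else 0)"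

text \<open>The normal cones at distinct boundary points have disjoint interiors, and a corner is a point whose
  normal cone has interior points.\<close>

lemma countable_corners: "countable corners"
proof -
  define NC where "NC \<zeta> = {w. \<forall>z\<in>\<Omega>. Re (cnj w * (z - \<zeta>)) \<le> 0}" for \<zeta>
  have ne: "interior (NC \<zeta>) \<noteq> {}" if "\<zeta> \<in> corners" for \<zeta>
  proof -
    obtain n m where nm: "unit_normal \<zeta> n" "unit_normal \<zeta> m" "n \<noteq> m"
      using \<open>\<zeta> \<in> corners\<close> unfolding corners_def by blast
    have *: "interior (NC \<zeta>) \<noteq> {}"
      if nm: "unit_normal \<zeta> n" "unit_normal \<zeta> m" and k: "0 < Im (cnj n * m)" for n m
    proof -
      define V where "V = {w. 0 < Im (cnj n * w)} \<inter> {w. 0 < Im (cnj w * m)}"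
      have "open V" unfolding V_def
        by (intro open_Int open_Collect_less continuous_intros)
      moreover have "n + m \<in> V" using k by (simp add: V_def algebra_simps)
      moreover have "V \<subseteq> NC \<zeta>"
      proof
        fix w assume w: "w \<in> V"
        define c d where "c = Im (cnj w * m)" and "d = Im (cnj n * w)"
        have cd: "0 < c" "0 < d" using w by (auto simp: V_def c_def d_def)
        \<comment> \<open>Cramer's rule: up to a positive factor, \<open>w\<close> is a combination
          of the two normals with positive coefficients.\<close>
        have eq: "of_real (Im (cnj n * m)) * w = of_real c * n + of_real d * m"
          by (simp add: complex_eq_iff c_def d_def algebra_simps)
        have "Re (cnj w * (z - \<zeta>)) \<le> 0" if z: "z \<in> \<Omega>" for z
        proof -
          have "of_real (Im (cnj n * m)) * (cnj w * (z - \<zeta>))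
              = of_real c * (cnj n * (z - \<zeta>)) + of_real d * (cnj m * (z - \<zeta>))"
            using arg_cong[OF eq, of "\<lambda>x. cnj x * (z - \<zeta>)"] by (simp add: algebra_simps)
          then have "Im (cnj n * m) * Re (cnj w * (z - \<zeta>))
              = c * Re (cnj n * (z - \<zeta>)) + d * Re (cnj m * (z - \<zeta>))"
          proof -
            have "Re (of_real k * v) = k * Re v" for k v by simp
            then show ?thesis
              using arg_cong[OF \<open>of_real (Im (cnj n * m)) * (cnj w * (z - \<zeta>)) = _\<close>, of Re]
              by (simp only: plus_complex.sel)
          qed
          also have "\<dots> \<le> 0"
            using cd unit_normalD(2)[OF nm(1) z] unit_normalD(2)[OF nm(2) z]
            by (intro add_nonpos_nonpos mult_nonneg_nonpos) auto
          finally show ?thesis using k by (simp add: mult_le_0_iff del: times_complex.sel)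
        qed
        then show "w \<in> NC \<zeta>" by (simp add: NC_def)
      qed
      ultimately show ?thesis using interior_maximal by blast
    qed
    \<comment> \<open>Distinct parallel unit normals are opposite, which would put \<open>z0\<close>
      strictly on both sides of one line.\<close>
    have "Im (cnj n * m) \<noteq> 0"
    proof
      assume im: "Im (cnj n * m) = 0"
      define s where "s = Re (cnj n * m)"
      have s: "cnj n * m = of_real s" using im by (simp add: complex_eq_iff s_def)
      have n1: "n * cnj n = 1" using complex_norm_square[of n] unit_normalD(1)[OF nm(1)] by simp
      have "m = (n * cnj n) * m" using n1 by simp
      also have "\<dots> = of_real s * n" using s by (simp add: mult.assoc mult.commute)
      finally have m: "m = of_real s * n" .
      then have "\<bar>s\<bar> = 1" using unit_normalD(1)[OF nm(1)] unit_normalD(1)[OF nm(2)]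
        by (simp add: norm_mult)
      then have "m = - n" using m nm(3) by (cases "s \<ge> 0") auto
      obtain r where r: "0 < r" "\<And>\<zeta> n. unit_normal \<zeta> n \<Longrightarrow> r \<le> Re (cnj n * (\<zeta> - z0))" using inradius by metis
      show False using r(2)[OF nm(1)] r(2)[OF nm(2)] r(1) \<open>m = - n\<close> by simp
    qed
    moreover have "Im (cnj m * n) = - Im (cnj n * m)" by simp
    ultimately show ?thesis using *[OF nm(1,2)] *[OF nm(2,1)] by linarith
  qed
  have disj: "interior (NC \<zeta>) \<inter> interior (NC \<eta>) = {}" if "\<zeta> \<in> corners" "\<eta> \<in> corners" "\<zeta> \<noteq> \<eta>" for \<zeta> \<eta>
  proof (rule ccontr)
    assume "interior (NC \<zeta>) \<inter> interior (NC \<eta>) \<noteq> {}"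
    then obtain w where w: "w \<in> interior (NC \<zeta>) \<inter> interior (NC \<eta>)" by blast
    moreover have "open (interior (NC \<zeta>) \<inter> interior (NC \<eta>))" by auto
    ultimately obtain e where e: "0 < e" "cball w e \<subseteq> interior (NC \<zeta>) \<inter> interior (NC \<eta>)"
      using open_contains_cball by blast
    have fr: "\<zeta> \<in> \<Omega>" "\<eta> \<in> \<Omega>" using that frontier_subset by (auto simp: corners_def)
    have z: "Re (cnj v * (\<eta> - \<zeta>)) = 0" if v: "v \<in> cball w e" for v
    proof -
      have "v \<in> NC \<zeta>" "v \<in> NC \<eta>" using e(2) v interior_subset by blast+
      then have "Re (cnj v * (\<eta> - \<zeta>)) \<le> 0" "Re (cnj v * (\<zeta> - \<eta>)) \<le> 0" using fr unfolding NC_def by blast+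
      moreover have "cnj v * (\<zeta> - \<eta>) = - (cnj v * (\<eta> - \<zeta>))" by (simp add: algebra_simps)
      ultimately show ?thesis by (simp only: uminus_complex.sel)
    qed
    \<comment> \<open>\<open>h\<close> is parallel to \<open>\<eta> - \<zeta>\<close>; but
      \<open>w\<close> and \<open>w + h\<close> are both orthogonal to that vector, so
      \<open>h\<close> would be as well.\<close>
    define h where "h = of_real e * sgn (\<eta> - \<zeta>)"
    have "w \<in> cball w e" "w + h \<in> cball w e" using e(1) by (auto simp: h_def dist_norm norm_mult norm_sgn)
    then have "Re (cnj (w + h) * (\<eta> - \<zeta>)) - Re (cnj w * (\<eta> - \<zeta>)) = 0"
      by (simp only: z diff_self)
    then have "Re (cnj h * (\<eta> - \<zeta>)) = 0" by (simp add: algebra_simps)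
    moreover have "cnj (sgn (\<eta> - \<zeta>)) * (\<eta> - \<zeta>) = of_real (cmod (\<eta> - \<zeta>))"
      using complex_norm_square[of "\<eta> - \<zeta>"] \<open>\<zeta> \<noteq> \<eta>\<close>
      by (simp add: sgn_eq mult.commute[of "cnj (\<eta> - \<zeta>)"] power2_eq_square field_simps)
    then have "cnj h * (\<eta> - \<zeta>) = of_real (e * cmod (\<eta> - \<zeta>))" by (simp add: h_def mult.assoc)
    ultimately show False using e(1) \<open>\<zeta> \<noteq> \<eta>\<close> by simp
  qed
  have "countable ((\<lambda>\<zeta>. interior (NC \<zeta>)) ` corners)"
  proof (rule countable_disjoint_open_subsets)
    show "pairwise disjnt ((\<lambda>\<zeta>. interior (NC \<zeta>)) ` corners)"
      unfolding pairwise_image pairwise_def disjnt_def using disj by blast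
  qed auto
  moreover have "inj_on (\<lambda>\<zeta>. interior (NC \<zeta>)) corners"
    by (rule inj_onI) (use ne disj in blast)
  ultimately show ?thesis by (rule countable_image_inj_on)
qed

lemma normal_unit_normal:
  assumes "\<zeta> \<in> frontier \<Omega> - corners"
  shows "unit_normal \<zeta> (normal \<zeta>)" "unit_normal \<zeta> n \<Longrightarrow> n = normal \<zeta>"
proof -
  have *: "\<exists>!n. unit_normal \<zeta> n" using assms unit_normal_exists unfolding corners_def by blast
  show "unit_normal \<zeta> (normal \<zeta>)" using theI'[OF *] assms by (simp add: normal_def)
  then show "unit_normal \<zeta> n \<Longrightarrow> n = normal \<zeta>" using * by blast
qed

lemma norm_normal_le: "cmod (normal \<zeta>) \<le> 1"
  and normal_halfplane: "z \<in> \<Omega> \<Longrightarrow> Re (cnj (normal \<zeta>) * (z - \<zeta>)) \<le> 0"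
proof (atomize (full), cases "\<zeta> \<in> frontier \<Omega> - corners")
  case True
  from unit_normalD[OF normal_unit_normal(1)[OF True]]
  show "cmod (normal \<zeta>) \<le> 1 \<and> (z \<in> \<Omega> \<longrightarrow> Re (cnj (normal \<zeta>) * (z - \<zeta>)) \<le> 0)" by auto
next
  case False
  then have "normal \<zeta> = 0" unfolding normal_def by (rule if_not_P)
  then show "cmod (normal \<zeta>) \<le> 1 \<and> (z \<in> \<Omega> \<longrightarrow> Re (cnj (normal \<zeta>) * (z - \<zeta>)) \<le> 0)" by simp
qed

lemma closed_unit_normal: "closed {p. unit_normal (fst p) (snd p)}"
proof -
  have "{p. unit_normal (fst p) (snd p)}
      = {p. cmod (snd p) = 1} \<inter> (\<Inter>z\<in>\<Omega>. {p. Re (cnj (snd p) * (z - fst p)) \<le> 0})"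
    unfolding unit_normal_def by blast
  also have "closed \<dots>"
    by (intro closed_Int closed_INT ballI closed_Collect_eq closed_Collect_le continuous_intros)
  finally show ?thesis .
qed

text \<open>Closed graph with compact codomain: off the corners the normal is unique, so the graph
  is the trace of the closed set of all pairs of a point and a unit normal.\<close>

lemma continuous_on_normal: "continuous_on (frontier \<Omega> - corners) normal"
proof -
  let ?E = "frontier \<Omega> - corners"
  have im: "normal \<in> frontier \<Omega> - corners \<rightarrow> sphere 0 1"
    using unit_normalD(1)[OF normal_unit_normal(1)] by simp
  have "(\<lambda>\<zeta>. (\<zeta>, normal \<zeta>)) ` ?E = (?E \<times> sphere 0 1) \<inter> {p. unit_normal (fst p) (snd p)}"
  proof (intro equalityI subsetI)
    fix p assume "p \<in> (\<lambda>\<zeta>. (\<zeta>, normal \<zeta>)) ` ?E"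
    then obtain \<zeta> where z: "\<zeta> \<in> ?E" "p = (\<zeta>, normal \<zeta>)" by blast
    have n: "unit_normal \<zeta> (normal \<zeta>)" by (rule normal_unit_normal(1)[OF z(1)])
    show "p \<in> (?E \<times> sphere 0 1) \<inter> {p. unit_normal (fst p) (snd p)}" using z n unit_normalD(1)[OF n] by simp
  next
    fix p assume p: "p \<in> (?E \<times> sphere 0 1) \<inter> {p. unit_normal (fst p) (snd p)}"
    then have a: "fst p \<in> ?E" "unit_normal (fst p) (snd p)" by auto
    have "snd p = normal (fst p)" by (rule normal_unit_normal(2)[OF a])
    then have "p = (fst p, normal (fst p))" by (simp add: prod_eq_iff)
    then show "p \<in> (\<lambda>\<zeta>. (\<zeta>, normal \<zeta>)) ` ?E" using a(1) by (rule image_eqI)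
  qed
  then have "closedin (top_of_set (?E \<times> sphere 0 1)) ((\<lambda>\<zeta>. (\<zeta>, normal \<zeta>)) ` ?E)"
    using closed_unit_normal by (simp add: closedin_closed_Int)
  then show ?thesis using continuous_closed_graph_eq[OF compact_sphere im] by blast
qed

lemma borel_corners: "corners \<in> sets borel"
  by (rule sets.countable[OF _ countable_corners]) simp

lemma borel_measurable_normal [measurable]: "normal \<in> borel_measurable borel"
proof -
  have E: "frontier \<Omega> - corners \<in> sets borel" using borel_corners by (auto simp: frontier_closed borel_closed)
  have "(\<lambda>\<zeta>. indicator (frontier \<Omega> - corners) \<zeta> *\<^sub>R normal \<zeta>) \<in> borel_measurable borel"
    using E continuous_on_normal by (rule borel_measurable_continuous_on_indicator)
  also have "(\<lambda>\<zeta>. indicator (frontier \<Omega> - corners) \<zeta> *\<^sub>R normal \<zeta>) = normal"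
    by (auto simp: fun_eq_iff normal_def indicator_def)
  finally show ?thesis .
qed

end

section \<open>Arclength parametrizations\<close>

text \<open>Stated for an arbitrary parametrization instead of \<open>boundary_curve\<close>, so
  that the same results apply to a shifted curve.\<close>

locale convex_curve = convex_body +
  fixes L :: real and g :: "real \<Rightarrow> complex"
  assumes param: "arclength_parametrization \<Omega> L g"
begin

lemma L_pos: "0 < L" and g_per: "g (t + L) = g t" and g_range: "range g = frontier \<Omega>"
  and g_simple: "simple_path (\<lambda>t. g (L * t))"
  and g_winding: "z \<in> interior \<Omega> \<Longrightarrow> winding_number (\<lambda>t. g (L * t)) z = 1"
  and g_length: "a \<le> b \<Longrightarrow> curve_length g a b = ennreal (b - a)"
  using param unfolding arclength_parametrization_def by auto

lemma g_frontier: "g t \<in> frontier \<Omega>" using g_range by blast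

lemma g_in: "g t \<in> \<Omega>" using g_frontier frontier_subset by blast

lemma g_not_interior: "g t \<notin> interior \<Omega>" using g_frontier frontier_eq by auto

lemma g_lip: "dist (g t) (g u) \<le> \<bar>t - u\<bar>"
proof -
  have "dist (g t) (g u) \<le> u - t" if "t \<le> u" for t u
    using dist_le_curve_length[OF that, of g] g_length[OF that] that by (simp add: ennreal_le_iff)
  from this[of t u] this[of u t] show ?thesis by (cases "t \<le> u") (auto simp: dist_commute)
qed

lemma continuous_on_g: "continuous_on S g"
  by (rule lipschitz_on_continuous_on[of 1]) (auto intro!: lipschitz_onI simp: g_lip dist_real_def)

lemma isCont_g: "isCont g t"
  using continuous_on_g[of UNIV] by (simp add: continuous_on_eq_continuous_at)

lemma borel_measurable_g [measurable]: "g \<in> borel_measurable borel"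
  by (intro borel_measurable_continuous_onI continuous_on_g)

lemma g_per_int: "g (t + of_int k * L) = g t"
proof (induction k rule: int_induct[of _ 0])
  case (step1 i)
  then show ?case using g_per[of "t + of_int i * L"] by (simp add: algebra_simps)
next
  case (step2 i)
  then show ?case using g_per[of "t + of_int (i - 1) * L"] by (simp add: algebra_simps)
qed simp

lemma period_reduce:
  obtains k :: int where "0 \<le> t + of_int k * L" "t + of_int k * L < L"
proof -
  define k where "k = - \<lfloor>t / L\<rfloor>"
  have "of_int \<lfloor>t / L\<rfloor> * L \<le> t" "t < (of_int \<lfloor>t / L\<rfloor> + 1) * L"
    using of_int_floor_le[of "t / L"] real_of_int_floor_add_one_gt[of "t / L"]
    by (simp_all only: pos_le_divide_eq[OF L_pos] pos_divide_less_eq[OF L_pos])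
  then show thesis by (intro that[of k]) (auto simp: k_def algebra_simps)
qed

text \<open>Any parameter can thus be moved to the start or to the middle of the period. On the unit
  interval the translation is \<open>shiftpath\<close>, with \<open>a\<close> the shift reduced
  modulo the period.\<close>

lemma shift: "convex_curve \<Omega> z0 L (\<lambda>t. g (t + c))"
proof -
  obtain k where k: "0 \<le> c + of_int k * L" "c + of_int k * L < L" by (rule period_reduce)
  define a where "a = (c + of_int k * L) / L"
  have a: "0 \<le> a" "a \<le> 1" "L * a = c + of_int k * L" using k L_pos by (auto simp: a_def)
  let ?p = "\<lambda>t. g (L * t)"
  have loop: "pathfinish ?p = pathstart ?p" using g_per[of 0] by (simp add: pathfinish_def pathstart_def)
  have eq: "(\<lambda>t. g (L * t + c)) = shiftpath a ?p"
  proof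
    fix t
    have "g (L * t + c) = g ((L * t + c) + of_int k * L)" by (rule g_per_int[symmetric])
    also have "\<dots> = g (L * (a + t))" using a(3) by (simp add: algebra_simps)
    also have "\<dots> = shiftpath a ?p t"
      using g_per[of "L * (a + t - 1)"] by (simp add: shiftpath_def algebra_simps)
    finally show "g (L * t + c) = shiftpath a ?p t" .
  qed
  have img: "path_image ?p \<subseteq> frontier \<Omega>" using g_frontier by (auto simp: path_image_def)
  have "range (\<lambda>t. g (t + c)) = range g"
  proof -
    have "range (\<lambda>t::real. t + c) = UNIV" by (rule surjI[of _ "\<lambda>t. t - c"]) simp
    then show ?thesis by (metis image_image)
  qed
  moreover have "simple_path (\<lambda>t. g (L * t + c))"
    unfolding eq by (rule simple_path_shiftpath[OF g_simple loop a(1,2)])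
  moreover have "winding_number (\<lambda>t. g (L * t + c)) z = 1" if z: "z \<in> interior \<Omega>" for z
    unfolding eq using g_winding[OF z] img z
    by (subst winding_number_shiftpath[OF simple_path_imp_path[OF g_simple] _ loop])
      (use a in \<open>auto simp: frontier_eq\<close>)
  moreover have "curve_length (\<lambda>t. g (t + c)) s u = ennreal (u - s)" if "s \<le> u" for s u
  proof -
    have "surj (\<lambda>t::real. t + c)" by (rule surjI[of _ "\<lambda>t. t - c"]) simp
    then show ?thesis using curve_length_reparam[of "\<lambda>t. t + c" g s u] g_length[of "s + c" "u + c"] that
      by (simp add: strict_mono_def)
  qed
  moreover have "g (t + L + c) = g (t + c)" for t using g_per[of "t + c"] by (simp add: algebra_simps)
  ultimately show ?thesis
    using L_pos g_range by unfold_locales (auto simp: arclength_parametrization_def)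
qed

lemma g_inj:
  assumes "g t = g u" "\<bar>t - u\<bar> < L"
  shows "t = u"
proof -
  have *: False if "0 < s" "s < L" "g (t + s) = g t" for t s
  proof -
    interpret s: convex_curve \<Omega> z0 L "\<lambda>x. g (x + t)" by (rule shift)
    have "g (L * (s / L) + t) = g (L * 0 + t)" using that L_pos by (simp add: add.commute)
    moreover have "s / L \<in> {0..1}" "(0::real) \<in> {0..1}" using that L_pos by auto
    ultimately have "s / L = 0 \<or> s / L = 0 \<and> (0::real) = 1 \<or> s / L = 1 \<and> (0::real) = 0"
      using s.g_simple unfolding simple_path_def loop_free_def by blast
    then show False using that L_pos by auto
  qed
  show ?thesis using *[of "t - u" u] *[of "u - t" t] assms by (cases t u rule: linorder_cases) auto
qed

text \<open>The continuous argument \<open>\<psi>\<close> of the curve about \<open>z0\<close> is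
  injective, since every ray meets the boundary once, and it gains \<open>2 * pi\<close> over a
  period; so it increases. Close to \<open>t\<close> it gains less than \<open>pi\<close>, and the
  imaginary part has the sign of the sine of the gain.\<close>

lemma orientation:
  obtains d where "0 < d"
    "\<And>u v. t - d < u \<Longrightarrow> u < v \<Longrightarrow> v < t + d \<Longrightarrow> 0 \<le> Im (cnj (g u - z0) * (g v - z0))"
proof -
  \<comment> \<open>Places \<open>t\<close> at the parameter 1/2 of the loop, away from its
    endpoints.\<close>
  define c where "c = t - L / 2"
  interpret s: convex_curve \<Omega> z0 L "\<lambda>x. g (x + c)" by (rule shift)
  let ?p = "\<lambda>x. g (L * x + c)"
  have path: "path ?p" using simple_path_imp_path[OF s.g_simple] .
  have "z0 \<notin> path_image ?p" using g_not_interior z0 by (auto simp: path_image_def)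
  then obtain q where q: "path q" "pathfinish q - pathstart q = 2 * of_real pi * \<i> * winding_number ?p z0"
    "\<And>x. x \<in> {0..1} \<Longrightarrow> ?p x = z0 + exp (q x)"
    using winding_number_as_continuous_log[OF path] by blast
  define \<psi> where "\<psi> x = Im (q x)" for x
  have \<psi>_cont: "continuous_on {0..1} \<psi>" using q(1) unfolding \<psi>_def path_def by (intro continuous_intros)
  have \<psi>01: "\<psi> 1 = \<psi> 0 + 2 * pi"
    using arg_cong[OF q(2), of Im] s.g_winding[OF z0] by (simp add: pathfinish_def pathstart_def \<psi>_def)
  have sgnp: "sgn (?p x - z0) = cis (\<psi> x)" if "x \<in> {0..1}" for x
    using q(3)[OF that] by (simp add: exp_eq_polar sgn_mult sgn_of_real \<psi>_def)
  have \<psi>_inj: "inj_on \<psi> {0..1}"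
  proof (rule inj_onI)
    fix x y assume xy: "x \<in> {0..1}" "y \<in> {0..1}" "\<psi> x = \<psi> y"
    then have "sgn (?p x - z0) = sgn (?p y - z0)" by (simp add: sgnp)
    then have "?p x = ?p y" by (rule frontier_same_ray[OF g_frontier g_frontier])
    then have "x = y \<or> x = 0 \<and> y = 1 \<or> x = 1 \<and> y = 0"
      using s.g_simple xy unfolding simple_path_def loop_free_def by blast
    then show "x = y" using \<psi>01 xy(3) by auto
  qed
  have \<psi>_mono: "\<psi> x < \<psi> y" if xy: "0 < x" "x < y" "y < 1" for x y
  proof -
    have a: "\<psi> 0 < \<psi> x \<and> \<psi> x < \<psi> 1"
    proof -
      have "x < 1" using xy by linarith
      then show ?thesis
        using continuous_inj_imp_mono[OF xy(1) _ \<psi>_cont \<psi>_inj] \<psi>01 pi_gt_zero by linarith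
    qed
    have "continuous_on {0..y} \<psi>" "inj_on \<psi> {0..y}"
      using continuous_on_subset[OF \<psi>_cont, of "{0..y}"] inj_on_subset[OF \<psi>_inj, of "{0..y}"] xy by auto
    from continuous_inj_imp_mono[OF xy(1,2) this] show ?thesis using a by linarith
  qed
  have "isCont \<psi> (1/2)"
    using \<psi>_cont by (rule continuous_on_interior) auto
  then obtain e where e: "0 < e" "\<And>x. dist x (1/2) < e \<Longrightarrow> dist (\<psi> x) (\<psi> (1/2)) < pi / 2"
    unfolding continuous_at_eps_delta using pi_half_gt_zero by blast
  define d where "d = L * min e (1/2)"
  have d: "0 < d" using e L_pos by (simp add: d_def)
  show thesis
  proof (rule that[OF d])
    fix u v assume uv: "t - d < u" "u < v" "v < t + d"
    define x y where "x = (u - c) / L" and "y = (v - c) / L"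
    have ux: "u = L * x + c" "v = L * y + c" using L_pos by (auto simp: x_def y_def)
    have tt: "t = L * (1/2) + c" by (simp add: c_def)
    have "L * (1/2 - min e (1/2)) < L * x" "L * x < L * y" "L * y < L * (1/2 + min e (1/2))"
      using uv unfolding ux tt d_def by (auto simp: algebra_simps)
    then have xy: "1/2 - min e (1/2) < x" "x < y" "y < 1/2 + min e (1/2)" using L_pos by simp_all
    then have xy': "0 < x" "y < 1" "dist x (1/2) < e" "dist y (1/2) < e" by (auto simp: dist_real_def)
    have "0 < \<psi> y - \<psi> x" using \<psi>_mono[of x y] xy xy' by simp
    moreover have "\<psi> y - \<psi> x < pi"
      using e(2)[OF xy'(3)] e(2)[OF xy'(4)] unfolding dist_real_def abs_less_iff by linarith
    ultimately have s: "0 < sin (\<psi> y - \<psi> x)" by (rule sin_gt_zero)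
    have polar: "g u - z0 = of_real (cmod (g u - z0)) * cis (\<psi> x)" "g v - z0 = of_real (cmod (g v - z0)) * cis (\<psi> y)"
    proof -
      have w: "w = of_real (cmod w) * sgn w" for w by (simp add: sgn_eq)
      have "sgn (g u - z0) = cis (\<psi> x)" "sgn (g v - z0) = cis (\<psi> y)"
        using sgnp[of x] sgnp[of y] xy xy' unfolding ux by auto
      then show "g u - z0 = of_real (cmod (g u - z0)) * cis (\<psi> x)"
        "g v - z0 = of_real (cmod (g v - z0)) * cis (\<psi> y)"
        using w[of "g u - z0"] w[of "g v - z0"] by simp_all
    qed
    have "cnj (g u - z0) * (g v - z0) = of_real (cmod (g u - z0) * cmod (g v - z0)) * cis (\<psi> y - \<psi> x)"
      by (subst polar(1), subst polar(2)) (simp add: cis_cnj cis_mult mult.assoc mult.left_commute)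
    then have "Im (cnj (g u - z0) * (g v - z0)) = cmod (g u - z0) * cmod (g v - z0) * sin (\<psi> y - \<psi> x)"
      by (simp only: Im_complex_of_real times_complex.sel Re_complex_of_real cis.sel)
    then show "0 \<le> Im (cnj (g u - z0) * (g v - z0))" using s by simp
  qed
qed

section \<open>The derivative of the boundary curve\<close>

definition corner_times :: "real set" where "corner_times = {t. g t \<in> corners}"

text \<open>The counter-clockwise unit tangent wherever the normal is unique, and 0 at corner times.
  Being built from \<open>normal\<close>, it is measurable before anything is known about
  differentiability.\<close>

definition velocity :: "real \<Rightarrow> complex" where "velocity t = \<i> * normal (g t)"

lemma countable_corner_times: "countable corner_times"
proof -
  have "countable {t \<in> {0..<L}. g t \<in> corners}"
  proof (rule countable_image_inj_on[of g])
    show "countable (g ` {t \<in> {0..<L}. g t \<in> corners})"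
      by (rule countable_subset[OF _ countable_corners]) auto
    show "inj_on g {t \<in> {0..<L}. g t \<in> corners}"
      by (rule inj_onI, rule g_inj) auto
  qed
  then have "countable (\<Union>k::int. (\<lambda>t. t + of_int k * L) ` {t \<in> {0..<L}. g t \<in> corners})" by auto
  moreover have "corner_times \<subseteq> (\<Union>k::int. (\<lambda>t. t + of_int k * L) ` {t \<in> {0..<L}. g t \<in> corners})"
  proof
    fix t assume t: "t \<in> corner_times"
    obtain k :: int where k: "0 \<le> t + of_int k * L" "t + of_int k * L < L" by (rule period_reduce)
    have "t = (t + of_int k * L) + of_int (- k) * L" by simp
    moreover have "t + of_int k * L \<in> {t \<in> {0..<L}. g t \<in> corners}"
      using k t g_per_int by (auto simp: corner_times_def)
    ultimately show "t \<in> (\<Union>k::int. (\<lambda>t. t + of_int k * L) ` {t \<in> {0..<L}. g t \<in> corners})" by blast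
  qed
  ultimately show ?thesis by (rule countable_subset[rotated])
qed

text \<open>Away from corners the chord directions converge: limits of supporting normals are supporting normals,
  so a limit of chord directions is orthogonal to the unique normal.\<close>

lemma chord_direction:
  assumes t: "t \<notin> corner_times" and e: "0 < e"
  obtains d where "0 < d" "\<And>u v. t - d < u \<Longrightarrow> u < v \<Longrightarrow> v < t + d \<Longrightarrow> cmod (sgn (g v - g u) - velocity t) < e"
proof (rule ccontr)
  define \<zeta> where "\<zeta> = g t"
  have \<zeta>: "\<zeta> \<in> frontier \<Omega> - corners" using t g_frontier by (auto simp: \<zeta>_def corner_times_def)
  obtain d0 where d0: "0 < d0"
    "\<And>u v. t - d0 < u \<Longrightarrow> u < v \<Longrightarrow> v < t + d0 \<Longrightarrow> 0 \<le> Im (cnj (g u - z0) * (g v - z0))"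
    using orientation by metis
  note obt = that
  assume nt: "\<not> thesis"
  have ex: "\<exists>u v. t - d < u \<and> u < v \<and> v < t + d \<and> e \<le> cmod (sgn (g v - g u) - velocity t)" if "0 < d" for d
    using nt that obt[of d] by (meson not_le)
  \<comment> \<open>Small enough for the orientation statement, for the chord not to degenerate
    (below half a period on each side), and for the endpoints to converge to
    \<open>t\<close>.\<close>
  define d where "d k = min d0 (min L (1 / real (Suc k))) / 2" for k
  have "0 < d k" for k using d0(1) L_pos by (simp add: d_def)
  then have "\<exists>u v. t - d k < u \<and> u < v \<and> v < t + d k \<and> e \<le> cmod (sgn (g v - g u) - velocity t)" for k
    by (rule ex)
  then obtain u v where uv: "\<And>k::nat. t - d k < u k" "\<And>k. u k < v k" "\<And>k. v k < t + d k"
      "\<And>k. e \<le> cmod (sgn (g (v k) - g (u k)) - velocity t)"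
    by metis
  have dk: "d k \<le> 1 / real (Suc k)" "d k \<le> d0" "d k \<le> L / 2" for k
  proof -
    define x where "x = min d0 (min L (1 / real (Suc k)))"
    have "x \<le> d0" "x \<le> L" "x \<le> 1 / real (Suc k)" "d k = x / 2" by (auto simp: x_def d_def)
    moreover have "0 \<le> 1 / real (Suc k)" by simp
    ultimately show "d k \<le> 1 / real (Suc k)" "d k \<le> d0" "d k \<le> L / 2"
      using d0(1) by linarith+
  qed
  have lim: "u \<longlonglongrightarrow> t" "v \<longlonglongrightarrow> t"
  proof -
    have "\<bar>u k - t\<bar> \<le> 1 / real (Suc k)" "\<bar>v k - t\<bar> \<le> 1 / real (Suc k)" for k
      using uv(1-3)[of k] dk(1)[of k] by linarith+
    then have "\<forall>\<^sub>F k in sequentially. norm (u k - t) \<le> 1 / real (Suc k)"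
      "\<forall>\<^sub>F k in sequentially. norm (v k - t) \<le> 1 / real (Suc k)"
      by (auto intro!: always_eventually)
    moreover have "(\<lambda>k. 1 / real (Suc k)) \<longlonglongrightarrow> 0" by (rule LIMSEQ_Suc[OF lim_1_over_n])
    ultimately show "u \<longlonglongrightarrow> t" "v \<longlonglongrightarrow> t"
      by (auto intro: LIM_zero_cancel[OF Lim_null_comparison])
  qed
  have ne: "g (v k) \<noteq> g (u k)" for k
    using g_inj[of "v k" "u k"] uv(1-3)[of k] dk(3)[of k] by force
  define D where "D k = sgn (g (v k) - g (u k))" for k
  have D1: "cmod (D k) = 1" for k using ne by (simp add: D_def norm_sgn)
  have "\<exists>n. unit_normal (g (u k)) n" "\<exists>n. unit_normal (g (v k)) n" for k
    using unit_normal_exists g_frontier by metis+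
  then obtain n m where nm: "\<And>k. unit_normal (g (u k)) (n k)" "\<And>k. unit_normal (g (v k)) (m k)" by metis
  define X where "X k = (D k, n k, m k)" for k
  have c: "seq_compact (sphere (0::complex) 1 \<times> sphere (0::complex) 1 \<times> sphere (0::complex) 1)"
    by (intro compact_imp_seq_compact compact_Times compact_sphere)
  have X: "\<forall>k. X k \<in> sphere 0 1 \<times> sphere 0 1 \<times> sphere 0 1"
    using D1 unit_normalD(1)[OF nm(1)] unit_normalD(1)[OF nm(2)] by (simp add: X_def)
  obtain l r where l: "l \<in> sphere 0 1 \<times> sphere 0 1 \<times> sphere 0 1" and r: "strict_mono r"
    and conv: "(X \<circ> r) \<longlonglongrightarrow> l"
    by (rule seq_compactE[OF c X])
  obtain D' n' m' where l': "l = (D', n', m')" by (cases l) auto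
  have cD: "(\<lambda>k. D (r k)) \<longlonglongrightarrow> D'" and cn: "(\<lambda>k. n (r k)) \<longlonglongrightarrow> n'" and cm: "(\<lambda>k. m (r k)) \<longlonglongrightarrow> m'"
    using tendsto_fst[OF conv] tendsto_fst[OF tendsto_snd[OF conv]] tendsto_snd[OF tendsto_snd[OF conv]]
    by (simp_all add: l' o_def X_def)
  have gu: "(\<lambda>k. g (u (r k))) \<longlonglongrightarrow> \<zeta>" and gv: "(\<lambda>k. g (v (r k))) \<longlonglongrightarrow> \<zeta>"
    unfolding \<zeta>_def
    by (intro isCont_tendsto_compose[OF isCont_g] LIMSEQ_subseq_LIMSEQ[OF lim(1) r, unfolded o_def]
        LIMSEQ_subseq_LIMSEQ[OF lim(2) r, unfolded o_def])+
  have "unit_normal \<zeta> n'"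
    using closed_sequentially[OF closed_unit_normal, of "\<lambda>k. (g (u (r k)), n (r k))" "(\<zeta>, n')"]
      nm tendsto_Pair[OF gu cn] by simp
  then have n': "n' = normal \<zeta>" by (rule normal_unit_normal(2)[OF \<zeta>])
  have "unit_normal \<zeta> m'"
    using closed_sequentially[OF closed_unit_normal, of "\<lambda>k. (g (v (r k)), m (r k))" "(\<zeta>, m')"]
      nm tendsto_Pair[OF gv cm] by simp
  then have m': "m' = normal \<zeta>" by (rule normal_unit_normal(2)[OF \<zeta>])
  have sgnmul: "Re (a * sgn w) = Re (a * w) / cmod w" "Im (a * sgn w) = Im (a * w) / cmod w" for a w
  proof -
    have "a * sgn w = of_real (1 / cmod w) * (a * w)" by (simp add: sgn_eq)
    then show "Re (a * sgn w) = Re (a * w) / cmod w" "Im (a * sgn w) = Im (a * w) / cmod w" by simp_all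
  qed
  \<comment> \<open>Seen from its first endpoint the chord points to the inner side of the normal
    there, and from its second endpoint the reversed chord does. Both normals tend to the same
    limit, which forces orthogonality.\<close>
  have "Re (cnj (n (r k)) * D (r k)) \<le> 0" for k
    unfolding D_def sgnmul using unit_normalD(2)[OF nm(1) g_in] by (intro divide_nonpos_nonneg) auto
  moreover have "(\<lambda>k. Re (cnj (n (r k)) * D (r k))) \<longlonglongrightarrow> Re (cnj (normal \<zeta>) * D')"
    unfolding n'[symmetric] by (intro tendsto_intros cn cD)
  ultimately have le: "Re (cnj (normal \<zeta>) * D') \<le> 0" by (intro LIMSEQ_le_const2) auto
  have "0 \<le> Re (cnj (m (r k)) * D (r k))" for k
  proof -
    have "Re (cnj (m (r k)) * (g (u (r k)) - g (v (r k)))) \<le> 0" by (rule unit_normalD(2)[OF nm(2) g_in])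
    moreover have "cnj (m (r k)) * (g (u (r k)) - g (v (r k))) = - (cnj (m (r k)) * (g (v (r k)) - g (u (r k))))"
      by (simp add: algebra_simps)
    ultimately have "0 \<le> Re (cnj (m (r k)) * (g (v (r k)) - g (u (r k))))" by (simp only: uminus_complex.sel)
    then show ?thesis unfolding D_def sgnmul by (intro divide_nonneg_nonneg) auto
  qed
  moreover have "(\<lambda>k. Re (cnj (m (r k)) * D (r k))) \<longlonglongrightarrow> Re (cnj (normal \<zeta>) * D')"
    unfolding m'[symmetric] by (intro tendsto_intros cm cD)
  ultimately have "0 \<le> Re (cnj (normal \<zeta>) * D')" by (intro LIMSEQ_le_const) auto
  with le have re0: "Re (cnj (normal \<zeta>) * D') = 0" by simp
  have "0 \<le> Im (cnj (g (u (r k)) - z0) * D (r k))" for k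
  proof -
    have "0 \<le> Im (cnj (g (u (r k)) - z0) * (g (v (r k)) - z0))"
      using uv(1-3)[of "r k"] dk(2)[of "r k"] by (intro d0(2)) linarith+
    also have "\<dots> = Im (cnj (g (u (r k)) - z0) * (g (v (r k)) - g (u (r k))))" by (simp add: algebra_simps)
    finally show ?thesis unfolding D_def sgnmul by (intro divide_nonneg_nonneg) auto
  qed
  moreover have "(\<lambda>k. Im (cnj (g (u (r k)) - z0) * D (r k))) \<longlonglongrightarrow> Im (cnj (\<zeta> - z0) * D')"
    by (intro tendsto_intros gu cD)
  ultimately have im: "0 \<le> Im (cnj (\<zeta> - z0) * D')" by (intro LIMSEQ_le_const) auto
  \<comment> \<open>Orthogonality leaves only the directions plus and minus
    \<open>\<i> * normal \<zeta>\<close>; the counter-clockwise sense together with the inradius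
    excludes the minus sign.\<close>
  define s where "s = Im (cnj (normal \<zeta>) * D')"
  have s: "cnj (normal \<zeta>) * D' = \<i> * of_real s" using re0 by (simp add: complex_eq_iff s_def)
  have n1: "cmod (normal \<zeta>) = 1" using unit_normalD(1)[OF normal_unit_normal(1)[OF \<zeta>]] .
  have "D' = (normal \<zeta> * cnj (normal \<zeta>)) * D'" using complex_norm_square[of "normal \<zeta>"] n1 by simp
  also have "\<dots> = of_real s * (\<i> * normal \<zeta>)" using s by (simp add: mult_ac)
  finally have D': "D' = of_real s * (\<i> * normal \<zeta>)" .
  have "cmod D' = 1" using l by (simp add: l')
  then have "\<bar>s\<bar> = 1" unfolding D' norm_mult n1 by simp
  moreover have "\<not> s < 0"
  proof
    assume "s < 0"
    have "Im (cnj (\<zeta> - z0) * D') = s * Re (cnj (normal \<zeta>) * (\<zeta> - z0))" unfolding D' by (simp add: algebra_simps)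
    moreover obtain R where "0 < R" "R \<le> Re (cnj (normal \<zeta>) * (\<zeta> - z0))"
      using inradius normal_unit_normal(1)[OF \<zeta>] by metis
    ultimately show False using im mult_neg_pos[OF \<open>s < 0\<close>] by (metis less_le_trans not_le)
  qed
  ultimately have "s = 1" by linarith
  then have "D' = velocity t" using D' by (simp add: velocity_def \<zeta>_def)
  then have "(\<lambda>k. cmod (D (r k) - velocity t)) \<longlonglongrightarrow> cmod (velocity t - velocity t)"
    using cD by (intro tendsto_intros) simp
  moreover have "e \<le> cmod (D (r k) - velocity t)" for k using uv(4) by (simp add: D_def)
  ultimately have "e \<le> cmod (velocity t - velocity t)" by (intro LIMSEQ_le_const) auto
  then show False using e by simp
qed

lemma norm_velocity: "t \<notin> corner_times \<Longrightarrow> cmod (velocity t) = 1"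
  using unit_normalD(1)[OF normal_unit_normal(1)] g_frontier
  by (simp add: velocity_def corner_times_def norm_mult)

lemma norm_velocity_le: "cmod (velocity t) \<le> 1"
  by (simp add: velocity_def norm_mult norm_normal_le)

text \<open>Unit speed: near a non-corner the projections of the chords on the tangent are almost as long as the
  chords, so the arc is almost as short as its chord.\<close>

lemma has_velocity:
  assumes t: "t \<notin> corner_times"
  shows "(g has_vector_derivative velocity t) (at t)"
proof -
  define w where "w = velocity t"
  have w1: "cmod w = 1" using norm_velocity[OF t] by (simp add: w_def)
  have est: "\<exists>d>0. \<forall>u v. t - d < u \<and> u < v \<and> v < t + d \<longrightarrow> cmod (g v - g u - (v - u) *\<^sub>R w) \<le> e * (v - u)"
    if e: "0 < e" for e
  proof -
    \<comment> \<open>The squared error will come out as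
      \<open>2 * \<epsilon> * (v - u)\<^sup>2\<close>, hence the square of \<open>e\<close>; the cap
      at 1 keeps \<open>1 - \<epsilon>\<close> nonnegative.\<close>
    define \<epsilon> where "\<epsilon> = min 1 (e\<^sup>2 / 2)"
    have \<epsilon>: "0 < \<epsilon>" "\<epsilon> \<le> 1" "2 * \<epsilon> \<le> e\<^sup>2" using e by (auto simp: \<epsilon>_def)
    obtain d where d: "0 < d"
      "\<And>u v. t - d < u \<Longrightarrow> u < v \<Longrightarrow> v < t + d \<Longrightarrow> cmod (sgn (g v - g u) - w) < \<epsilon>"
      using chord_direction[OF t \<epsilon>(1)] unfolding w_def by metis
    define p where "p x = Re (cnj w * g x)" for x
    have chord: "(1 - \<epsilon>) * dist (g u) (g v) \<le> p v - p u" if uv: "t - d < u" "u \<le> v" "v < t + d" for u v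
    proof (cases "u = v")
      case False
      define D where "D = sgn (g v - g u)"
      have "cmod (D - w) < \<epsilon>" unfolding D_def using False uv by (intro d(2)) auto
      have "Re (cnj w * (D - w)) \<ge> - cmod (cnj w * (D - w))" using abs_Re_le_cmod[of "cnj w * (D - w)"] by linarith
      moreover have "cmod (cnj w * (D - w)) < \<epsilon>" using \<open>cmod (D - w) < \<epsilon>\<close> w1 by (simp add: norm_mult)
      moreover have "Re (cnj w * (D - w)) = Re (cnj w * D) - 1"
      proof -
        have "cnj w * w = 1" using complex_norm_square[of w] w1 by (simp add: mult.commute)
        then show ?thesis by (simp add: right_diff_distrib del: times_complex.sel)
      qed
      ultimately have "1 - \<epsilon> \<le> Re (cnj w * D)" by linarith
      then have "(1 - \<epsilon>) * cmod (g v - g u) \<le> Re (cnj w * D) * cmod (g v - g u)" by (intro mult_right_mono) auto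
      also have "\<dots> = Re (cnj w * (D * of_real (cmod (g v - g u))))" by (simp add: algebra_simps)
      also have "D * of_real (cmod (g v - g u)) = g v - g u" by (simp add: D_def sgn_eq)
      finally show ?thesis by (simp add: p_def dist_norm norm_minus_commute right_diff_distrib del: times_complex.sel)
    qed simp
    show ?thesis
    proof (intro exI[of _ d] conjI d(1) allI impI)
      fix u v assume uv: "t - d < u \<and> u < v \<and> v < t + d"
      have poly: "(1 - \<epsilon>) * polygon_length (map g (x # xs)) \<le> p v - p x"
        if "sorted (x # xs)" "set (x # xs) \<subseteq> {u..v}" for x xs
        using that
      proof (induction xs arbitrary: x)
        case Nil
        then have "(1 - \<epsilon>) * dist (g x) (g v) \<le> p v - p x" using uv by (intro chord) auto
        moreover have "0 \<le> (1 - \<epsilon>) * dist (g x) (g v)" using \<epsilon> by simp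
        ultimately show ?case by simp
      next
        case (Cons y ys)
        have "(1 - \<epsilon>) * polygon_length (map g (y # ys)) \<le> p v - p y" using Cons.prems by (intro Cons.IH) auto
        moreover have "(1 - \<epsilon>) * dist (g x) (g y) \<le> p y - p x" using Cons.prems uv by (intro chord) auto
        ultimately show ?case by (simp add: algebra_simps)
      qed
      have puv: "0 \<le> p v - p u"
        using chord[of u v] uv \<epsilon> by (meson less_imp_le mult_nonneg_nonneg order_trans diff_ge_0_iff_ge zero_le_dist)
      \<comment> \<open>Arclength enters here: the arc has length exactly \<open>v - u\<close>, so a
        bound on all inscribed polygons bounds the advance along the tangent from below. An advance
        of almost \<open>v - u\<close> by a chord no longer than \<open>v - u\<close> determines the
        chord up to a small error.\<close>
      have len: "(1 - \<epsilon>) * (v - u) \<le> p v - p u"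
      proof (cases "\<epsilon> = 1")
        case False
        then have \<epsilon>1: "0 < 1 - \<epsilon>" using \<epsilon> by simp
        have "curve_length g u v \<le> ennreal ((p v - p u) / (1 - \<epsilon>))"
        proof (rule curve_length_least)
          fix ts assume ts: "sorted ts" "set ts \<subseteq> {u..v}"
          have "(1 - \<epsilon>) * polygon_length (map g ts) \<le> p v - p u"
          proof (cases ts)
            case (Cons x xs)
            then have "(1 - \<epsilon>) * polygon_length (map g ts) \<le> p v - p x" using poly[of x xs] ts by simp
            moreover have "(1 - \<epsilon>) * dist (g u) (g x) \<le> p x - p u" using ts uv Cons by (intro chord) auto
            then have "0 \<le> p x - p u" using \<epsilon>1 by (meson less_imp_le mult_nonneg_nonneg order_trans zero_le_dist)
            ultimately show ?thesis by linarith
          qed (use puv in simp)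
          then show "polygon_length (map g ts) \<le> (p v - p u) / (1 - \<epsilon>)" using \<epsilon>1 by (simp add: field_simps)
        qed
        then have "v - u \<le> (p v - p u) / (1 - \<epsilon>)" using g_length[of u v] uv puv \<epsilon>1 by (simp add: ennreal_le_iff)
        then show ?thesis using \<epsilon>1 by (simp add: field_simps)
      qed (use puv in simp)
      define h where "h = g v - g u"
      have h: "cmod h \<le> v - u" using g_lip[of v u] uv by (simp add: h_def dist_norm)
      have "(cmod (h - (v - u) *\<^sub>R w))\<^sup>2 = (cmod h)\<^sup>2 - 2 * (v - u) * Re (cnj w * h) + (v - u)\<^sup>2 * (cmod w)\<^sup>2"
        unfolding cmod_power2 by (simp add: power2_eq_square algebra_simps)
      also have "\<dots> \<le> (v - u)\<^sup>2 - 2 * (v - u) * ((1 - \<epsilon>) * (v - u)) + (v - u)\<^sup>2"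
      proof -
        have "(cmod h)\<^sup>2 \<le> (v - u)\<^sup>2" using h by (intro power_mono) auto
        moreover have "Re (cnj w * h) = p v - p u" by (simp add: p_def h_def right_diff_distrib del: times_complex.sel)
        then have "2 * (v - u) * ((1 - \<epsilon>) * (v - u)) \<le> 2 * (v - u) * Re (cnj w * h)"
          using len uv by (intro mult_left_mono) auto
        ultimately show ?thesis unfolding w1 by simp
      qed
      also have "\<dots> = (2 * \<epsilon>) * (v - u)\<^sup>2" by (simp add: power2_eq_square algebra_simps)
      also have "\<dots> \<le> (e * (v - u))\<^sup>2" using \<epsilon>(3) by (simp add: power_mult_distrib mult_right_mono)
      finally show "cmod (g v - g u - (v - u) *\<^sub>R w) \<le> e * (v - u)"
        unfolding h_def by (rule power2_le_imp_le) (use e uv in auto)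
    qed
  qed
  show ?thesis
    unfolding has_vector_derivative_def has_derivative_at_alt w_def[symmetric]
  proof (intro conjI allI impI)
    fix e :: real assume "0 < e"
    then obtain d where d: "0 < d"
      "\<And>u v. t - d < u \<Longrightarrow> u < v \<Longrightarrow> v < t + d \<Longrightarrow> cmod (g v - g u - (v - u) *\<^sub>R w) \<le> e * (v - u)"
      using est by metis
    show "\<exists>d>0. \<forall>y. norm (y - t) < d \<longrightarrow> norm (g y - g t - (y - t) *\<^sub>R w) \<le> e * norm (y - t)"
    proof (intro exI[of _ d] conjI allI impI d(1))
      fix y assume y: "norm (y - t) < d"
      show "norm (g y - g t - (y - t) *\<^sub>R w) \<le> e * norm (y - t)"
      proof (cases y t rule: linorder_cases)
        case less
        have "norm (g y - g t - (y - t) *\<^sub>R w) = norm (g t - g y - (t - y) *\<^sub>R w)"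
          by (subst norm_minus_cancel[symmetric]) (simp add: algebra_simps)
        then show ?thesis using d(2)[of y t] less y d(1) by auto
      qed (use d(2)[of t y] y d(1) in auto)
    qed
  qed (rule bounded_linear_scaleR_left)
qed

lemma borel_measurable_velocity [measurable]: "velocity \<in> borel_measurable borel"
  unfolding velocity_def by measurable

lemma velocity_halfplane:
  assumes "z \<in> \<Omega>"
  shows "0 \<le> Im (velocity t * cnj (g t - z))"
proof -
  have "Re (cnj (normal (g t)) * (z - g t)) \<le> 0" by (rule normal_halfplane[OF assms])
  then show ?thesis by (simp add: velocity_def algebra_simps)
qed

lemma velocity_per: "velocity (t + L) = velocity t" by (simp add: velocity_def g_per)

end

section \<open>Logarithmic integrals along the curve and the angle seen from a boundary
  point\<close>

lemma integrable_bounded_borel: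
  fixes F :: "real \<Rightarrow> 'a::euclidean_space"
  assumes F: "F \<in> borel_measurable borel" and B: "\<And>t. t \<in> {a..b} \<Longrightarrow> norm (F t) \<le> B"
  shows "F integrable_on {a..b}"
proof (rule measurable_bounded_by_integrable_imp_integrable[where g = "\<lambda>_. B"])
  have "F \<in> borel_measurable lborel" using F by simp
  then have "F \<in> borel_measurable lebesgue" by (rule measurable_completion)
  then show "F \<in> borel_measurable (lebesgue_on {a..b})" by (rule measurable_restrict_space1)
qed (use B in auto)

lemma has_integral_Im:
  fixes f :: "real \<Rightarrow> complex"
  assumes "(f has_integral I) S"
  shows "((\<lambda>t. Im (f t)) has_integral Im I) S"
  using has_integral_linear[OF assms bounded_linear_Im] by (simp add: o_def)

context convex_curve
begin

lemma FTC_curve: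
  assumes "a \<le> b" "open U" "g ` {a..b} \<subseteq> U" "\<And>z. z \<in> U \<Longrightarrow> (h has_field_derivative h' z) (at z)"
  shows "((\<lambda>t. h' (g t) * velocity t) has_integral h (g b) - h (g a)) {a..b}"
  by (rule FTC_compose[OF assms(1) countable_corner_times g_lip has_velocity assms(2-4)])

text \<open>The factor \<open>c\<close> turns the branch cut of \<open>Ln\<close> away from the
  arc.\<close>

lemma has_integral_log_derivative:
  assumes ab: "a \<le> b" and c: "c \<noteq> 0" and dom: "\<And>t. t \<in> {a..b} \<Longrightarrow> (g t - z) * c \<notin> \<real>\<^sub>\<le>\<^sub>0"
  shows "((\<lambda>t. velocity t / (g t - z)) has_integral Ln ((g b - z) * c) - Ln ((g a - z) * c)) {a..b}"
proof -
  define U where "U = (\<lambda>w. (w - z) * c) -` (- \<real>\<^sub>\<le>\<^sub>0)"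
  have "open U" unfolding U_def by (intro open_vimage open_Compl closed_nonpos_Reals_complex continuous_intros)
  moreover have "g ` {a..b} \<subseteq> U" using dom by (auto simp: U_def)
  moreover have "((\<lambda>w. Ln ((w - z) * c)) has_field_derivative 1 / (w - z)) (at w)" if w: "w \<in> U" for w
  proof -
    have "(w - z) * c \<notin> \<real>\<^sub>\<le>\<^sub>0" using w by (simp add: U_def)
    moreover from this have "w \<noteq> z" by auto
    ultimately show ?thesis using c by (auto intro!: derivative_eq_intros simp: field_simps)
  qed
  ultimately have "((\<lambda>t. 1 / (g t - z) * velocity t) has_integral Ln ((g b - z) * c) - Ln ((g a - z) * c)) {a..b}"
    by (rule FTC_curve[OF ab])
  then show ?thesis by simp
qed

text \<open>Connects the topological winding number with an integral over a merely Lipschitz curve.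
  The period is cut into pieces on which a continuous logarithm \<open>q\<close> moves by less than
  1; after division by the value at the left end the principal branch reproduces the increments of
  \<open>q\<close>, which add up.\<close>

lemma winding_integral:
  assumes z: "z \<in> interior \<Omega>"
  shows "((\<lambda>t. velocity t / (g t - z)) has_integral 2 * of_real pi * \<i>) {0..L}"
proof -
  let ?p = "\<lambda>x. g (L * x)"
  have path: "path ?p" using simple_path_imp_path[OF g_simple] .
  have "z \<notin> path_image ?p" using g_not_interior z by (auto simp: path_image_def)
  then obtain q where q: "path q" "pathfinish q - pathstart q = 2 * of_real pi * \<i> * winding_number ?p z"
    "\<And>x. x \<in> {0..1} \<Longrightarrow> ?p x = z + exp (q x)"
    using winding_number_as_continuous_log[OF path] by blast
  have "uniformly_continuous_on {0..1} q" using q(1) unfolding path_def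
    by (intro compact_uniformly_continuous) auto
  then obtain d where d: "0 < d" "\<And>x y. x \<in> {0..1} \<Longrightarrow> y \<in> {0..1} \<Longrightarrow> dist y x < d \<Longrightarrow> dist (q y) (q x) < 1"
    unfolding uniformly_continuous_on_def using zero_less_one by metis
  obtain N :: nat where N: "1 / d < real N" using reals_Archimedean2 by blast
  have "0 < 1 / d" using d by simp
  then have N0: "0 < real N" using N by linarith
  have Nd: "1 / real N < d" using N N0 d(1) by (simp add: field_simps)
  define s where "s j = real j / real N" for j :: nat
  have s: "s j \<in> {0..1}" if "j \<le> N" for j using that N0 by (simp add: s_def)
  have "((\<lambda>t. velocity t / (g t - z)) has_integral q (s j) - q 0) {0..L * s j}" if "j \<le> N" for j
    using that
  proof (induction j)
    case (Suc j)
    have step: "((\<lambda>t. velocity t / (g t - z)) has_integral q (s (Suc j)) - q (s j)) {L * s j..L * s (Suc j)}"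
    proof -
      let ?c = "inverse (exp (q (s j)))"
      have le: "s j \<le> s (Suc j)" using N0 by (simp add: s_def divide_right_mono)
      have quot: "(g (L * x) - z) * ?c = exp (q x - q (s j))" if "x \<in> {0..1}" for x
        using q(3)[OF that] by (simp add: exp_diff field_simps)
      have close: "cmod (q x - q (s j)) < 1" if "x \<in> {s j..s (Suc j)}" for x
      proof -
        have "s (Suc j) - s j = 1 / real N" using N0 by (simp add: s_def field_simps)
        then have "dist x (s j) < d" using that Nd by (simp add: dist_real_def)
        moreover have "x \<in> {0..1}" using that s[of j] s[of "Suc j"] Suc.prems by auto
        ultimately show ?thesis using d(2)[OF s[of j], of x] Suc.prems by (simp add: dist_norm)
      qed
      have Ln_exp': "Ln (exp (q x - q (s j))) = q x - q (s j)" if "x \<in> {s j..s (Suc j)}" for x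
        using close[OF that] abs_Im_le_cmod[of "q x - q (s j)"] pi_gt3 by (intro Ln_exp) linarith+
      have "((\<lambda>t. velocity t / (g t - z)) has_integral
          Ln ((g (L * s (Suc j)) - z) * ?c) - Ln ((g (L * s j) - z) * ?c)) {L * s j..L * s (Suc j)}"
      proof (rule has_integral_log_derivative)
        show "L * s j \<le> L * s (Suc j)" using le L_pos by simp
        fix t assume t: "t \<in> {L * s j..L * s (Suc j)}"
        define x where "x = t / L"
        have x: "t = L * x" "x \<in> {s j..s (Suc j)}" using t L_pos by (auto simp: x_def field_simps)
        moreover have "x \<in> {0..1}" using x(2) s[of j] s[of "Suc j"] Suc.prems by auto
        ultimately have eq: "(g t - z) * ?c = exp (q x - q (s j))" using quot by simp
        have "\<bar>Im (q x - q (s j))\<bar> < pi / 2"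
          using close[OF x(2)] abs_Im_le_cmod[of "q x - q (s j)"] pi_gt3 by linarith
        then have "0 < cos (Im (q x - q (s j)))" by (intro cos_gt_zero_pi) linarith+
        then have "0 < Re (exp (q x - q (s j)))" by (simp add: Re_exp)
        then show "(g t - z) * ?c \<notin> \<real>\<^sub>\<le>\<^sub>0" unfolding eq by (auto simp: complex_nonpos_Reals_iff)
      qed simp
      moreover have "s j \<in> {0..1}" "s (Suc j) \<in> {0..1}" using s Suc.prems by auto
      ultimately show ?thesis using Ln_exp'[of "s j"] Ln_exp'[of "s (Suc j)"] le by (simp add: quot)
    qed
    have "((\<lambda>t. velocity t / (g t - z)) has_integral (q (s j) - q 0) + (q (s (Suc j)) - q (s j))) {0..L * s (Suc j)}"
      using Suc step L_pos N0
      by (intro has_integral_combine[of 0 "L * s j" "L * s (Suc j)"]) (auto simp: s_def divide_right_mono)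
    then show ?case by simp
  qed (simp add: s_def has_integral_refl)
  from this[of N] have "((\<lambda>t. velocity t / (g t - z)) has_integral q 1 - q 0) {0..L}" using N0 by (simp add: s_def)
  then show ?thesis using q(2) g_winding[OF z] by (simp add: pathfinish_def pathstart_def)
qed

lemma density_nonneg: "z \<in> \<Omega> \<Longrightarrow> 0 \<le> Im (velocity t / (g t - z))"
proof -
  assume z: "z \<in> \<Omega>"
  have "velocity t / (g t - z) = velocity t * cnj (g t - z) / of_real ((cmod (g t - z))\<^sup>2)"
    by (metis complex_div_cnj complex_norm_square)
  then have "Im (velocity t / (g t - z)) = Im (velocity t * cnj (g t - z)) / (cmod (g t - z))\<^sup>2"
    by (metis Im_divide_of_real)
  then show ?thesis using velocity_halfplane[OF z, of t] by simp
qed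

text \<open>At a boundary point all directions to other boundary points lie in a half-plane, where a branch of the
  logarithm is available; the angle is monotone since its derivative is nonnegative.\<close>

lemma boundary_angle:
  obtains n \<beta>\<^sub>0 \<beta>\<^sub>1 where "cmod n = 1" "\<beta>\<^sub>0 < \<beta>\<^sub>1" "\<beta>\<^sub>1 \<le> \<beta>\<^sub>0 + pi"
    "((\<lambda>u. sgn (g u - g 0)) \<longlongrightarrow> n * cis \<beta>\<^sub>0) (at_right 0)"
    "((\<lambda>u. sgn (g u - g 0)) \<longlongrightarrow> n * cis \<beta>\<^sub>1) (at_left L)"
    "((\<lambda>t. Im (velocity t / (g t - g 0))) has_integral \<beta>\<^sub>1 - \<beta>\<^sub>0) {0..L}"
proof -
  define \<zeta> where "\<zeta> = g 0"
  obtain n0 where n0: "unit_normal \<zeta> n0" using unit_normal_exists[OF g_frontier] unfolding \<zeta>_def .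
  have n01: "cmod n0 = 1" "n0 * cnj n0 = 1"
    using unit_normalD(1)[OF n0] complex_norm_square[of n0] by auto
  \<comment> \<open>The rotation takes the supporting half-plane to the right half-plane, so one
    principal branch serves for the whole open period.\<close>
  define w where "w u = (g u - \<zeta>) * (- cnj n0)" for u
  define \<phi> where "\<phi> u = Im (Ln (w u))" for u
  have gu: "g u \<noteq> \<zeta>" if "0 < u" "u < L" for u using g_inj[of u 0] that by (auto simp: \<zeta>_def)
  have n00: "n0 \<noteq> 0" using n01 by auto
  have w0: "w u \<noteq> 0" if "0 < u" "u < L" for u using gu[OF that] n00 by (simp add: w_def)
  have wRe: "0 \<le> Re (w u)" for u
    using unit_normalD(2)[OF n0 g_in[of u]] by (simp add: w_def algebra_simps)
  have \<phi>_bd: "\<bar>\<phi> u\<bar> \<le> pi / 2" if "0 < u" "u < L" for u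
    using Re_Ln_pos_le[OF w0[OF that]] wRe[of u] by (simp add: \<phi>_def)
  have slit: "w u \<notin> \<real>\<^sub>\<le>\<^sub>0" if "0 < u" "u < L" for u
    using w0[OF that] wRe[of u] by (auto simp: complex_nonpos_Reals_iff complex_eq_iff)
  have int: "((\<lambda>t. Im (velocity t / (g t - \<zeta>))) has_integral \<phi> b - \<phi> a) {a..b}" if "0 < a" "a \<le> b" "b < L" for a b
    using has_integral_Im[OF has_integral_log_derivative[of a b "- cnj n0" \<zeta>]] slit that n00
    by (simp add: \<phi>_def w_def)
  have dens: "0 \<le> Im (velocity t / (g t - \<zeta>))" for t unfolding \<zeta>_def by (rule density_nonneg[OF g_in])
  have mono: "\<phi> a \<le> \<phi> b" if "0 < a" "a \<le> b" "b < L" for a b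
    using has_integral_nonneg[OF int[OF that]] dens by simp
  define \<beta>\<^sub>0 where "\<beta>\<^sub>0 = Inf (\<phi> ` {0<..<L})"
  define \<beta>\<^sub>1 where "\<beta>\<^sub>1 = Sup (\<phi> ` {0<..<L})"
  have bdd: "bdd_below (\<phi> ` {0<..<L})" "bdd_above (\<phi> ` {0<..<L})"
  proof -
    have "- (pi / 2) \<le> \<phi> u \<and> \<phi> u \<le> pi / 2" if "u \<in> {0<..<L}" for u
      using \<phi>_bd[of u] that by (auto simp: abs_le_iff)
    then show "bdd_below (\<phi> ` {0<..<L})" "bdd_above (\<phi> ` {0<..<L})"
      by (meson bdd_belowI2, meson bdd_aboveI2)
  qed
  have ne: "\<phi> ` {0<..<L} \<noteq> {}" using L_pos by auto
  have \<beta>_le: "\<beta>\<^sub>0 \<le> \<phi> u" "\<phi> u \<le> \<beta>\<^sub>1" if "0 < u" "u < L" for u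
    using that bdd unfolding \<beta>\<^sub>0_def \<beta>\<^sub>1_def by (auto intro!: cInf_lower cSup_upper)
  have b0: "- (pi / 2) \<le> \<beta>\<^sub>0" unfolding \<beta>\<^sub>0_def
    by (rule cInf_greatest[OF ne]) (use \<phi>_bd in \<open>force simp: abs_le_iff\<close>)
  have b1: "\<beta>\<^sub>1 \<le> pi / 2" unfolding \<beta>\<^sub>1_def
    by (rule cSup_least[OF ne]) (use \<phi>_bd in \<open>force simp: abs_le_iff\<close>)
  have lim0: "(\<phi> \<longlongrightarrow> \<beta>\<^sub>0) (at_right 0)"
  proof (rule order_tendstoI)
    fix y assume y: "\<beta>\<^sub>0 < y"
    then obtain u where u: "0 < u" "u < L" "\<phi> u < y"
      unfolding \<beta>\<^sub>0_def using cInf_less_iff[OF ne bdd(1)] by auto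
    then have "\<phi> v < y" if "0 < v" "v < u" for v using mono[of v u] that by linarith
    then show "\<forall>\<^sub>F v in at_right 0. \<phi> v < y" unfolding eventually_at_right_field using u by blast
  next
    fix y assume "y < \<beta>\<^sub>0"
    then have "y < \<phi> v" if "0 < v" "v < L" for v using \<beta>_le(1)[OF that] by linarith
    then show "\<forall>\<^sub>F v in at_right 0. y < \<phi> v" unfolding eventually_at_right_field using L_pos by blast
  qed
  have lim1: "(\<phi> \<longlongrightarrow> \<beta>\<^sub>1) (at_left L)"
  proof (rule order_tendstoI)
    fix y assume y: "y < \<beta>\<^sub>1"
    then obtain u where u: "0 < u" "u < L" "y < \<phi> u"
      unfolding \<beta>\<^sub>1_def using less_cSup_iff[OF ne bdd(2)] by auto
    then have "y < \<phi> v" if "u < v" "v < L" for v using mono[of u v] that by linarith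
    then show "\<forall>\<^sub>F v in at_left L. y < \<phi> v" unfolding eventually_at_left_field using u by blast
  next
    fix y assume "\<beta>\<^sub>1 < y"
    then have "\<phi> v < y" if "0 < v" "v < L" for v using \<beta>_le(2)[OF that] by linarith
    then show "\<forall>\<^sub>F v in at_left L. \<phi> v < y" unfolding eventually_at_left_field using L_pos by blast
  qed
  have sgn_eq': "sgn (g u - \<zeta>) = - n0 * cis (\<phi> u)" if u: "0 < u" "u < L" for u
  proof -
    have "cis (\<phi> u) = sgn (w u)" using w0[OF u] by (metis Arg_eq_Im_Ln \<phi>_def cis_Arg)
    also have "\<dots> = sgn (g u - \<zeta>) * (- cnj n0)" using n01(1) by (simp add: w_def sgn_mult sgn_eq[of "cnj n0"] sgn_minus)
    finally have "- n0 * cis (\<phi> u) = (n0 * cnj n0) * sgn (g u - \<zeta>)" by (simp add: algebra_simps)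
    then show ?thesis using n01 by simp
  qed
  have t0: "((\<lambda>u. sgn (g u - g 0)) \<longlongrightarrow> - n0 * cis \<beta>\<^sub>0) (at_right 0)"
  proof (rule Lim_transform_eventually)
    show "((\<lambda>u. - n0 * cis (\<phi> u)) \<longlongrightarrow> - n0 * cis \<beta>\<^sub>0) (at_right 0)"
      using lim0 by (intro tendsto_intros) auto
    show "\<forall>\<^sub>F u in at_right 0. - n0 * cis (\<phi> u) = sgn (g u - g 0)"
      unfolding eventually_at_right_field using sgn_eq' L_pos by (auto simp: \<zeta>_def)
  qed
  have t1: "((\<lambda>u. sgn (g u - g 0)) \<longlongrightarrow> - n0 * cis \<beta>\<^sub>1) (at_left L)"
  proof (rule Lim_transform_eventually)
    show "((\<lambda>u. - n0 * cis (\<phi> u)) \<longlongrightarrow> - n0 * cis \<beta>\<^sub>1) (at_left L)"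
      using lim1 by (intro tendsto_intros) auto
    show "\<forall>\<^sub>F u in at_left L. - n0 * cis (\<phi> u) = sgn (g u - g 0)"
      unfolding eventually_at_left_field using sgn_eq' L_pos by (auto simp: \<zeta>_def)
  qed
  \<comment> \<open>Were the angle constant, the whole boundary would lie on one line through
    \<open>\<zeta>\<close>; but the two rays from \<open>z0\<close> perpendicular to it, in opposite
    directions, both meet the boundary. Strictness is what keeps \<open>\<beta> - \<alpha>\<close>
    below \<open>pi\<close> in \<open>tangent_angles\<close>.\<close>
  have lt: "\<beta>\<^sub>0 < \<beta>\<^sub>1"
  proof (rule ccontr)
    assume "\<not> \<beta>\<^sub>0 < \<beta>\<^sub>1"
    then have c: "\<phi> u = \<beta>\<^sub>0" if "0 < u" "u < L" for u using \<beta>_le[OF that] by linarith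
    define v where "v = - n0 * cis \<beta>\<^sub>0"
    have v1: "cmod v = 1" using n01 by (simp add: v_def norm_mult)
    have line: "Im (cnj v * (z - \<zeta>)) = 0" if z: "z \<in> frontier \<Omega>" for z
    proof -
      obtain u' where u': "z = g u'" using z g_range by blast
      obtain k :: int where k: "0 \<le> u' + of_int k * L" "u' + of_int k * L < L" by (rule period_reduce)
      define u where "u = u' + of_int k * L"
      have u: "z = g u" "0 \<le> u" "u < L" using k u' g_per_int by (auto simp: u_def)
      show ?thesis
      proof (cases "u = 0")
        case False
        have "sgn (g u - \<zeta>) = v" using sgn_eq'[of u] c[of u] u False by (simp add: v_def)
        moreover have "g u - \<zeta> = sgn (g u - \<zeta>) * of_real (cmod (g u - \<zeta>))" by (simp add: sgn_eq)
        ultimately have "cnj v * (z - \<zeta>) = (v * cnj v) * of_real (cmod (g u - \<zeta>))" using u(1) by (metis mult.commute mult.assoc)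
        also have "v * cnj v = of_real ((cmod v)\<^sup>2)" by (rule complex_norm_square[symmetric])
        finally show ?thesis by (simp del: of_real_power)
      qed (simp add: u \<zeta>_def)
    qed
    have ray: "\<exists>d>0. Im (cnj v * (z0 - \<zeta>)) + s * d = 0" if s: "s = 1 \<or> s = -1" for s :: real
    proof -
      have "of_real s * (\<i> * v) \<noteq> 0" using s v1 by auto
      then obtain d where d: "0 < d" "z0 + d *\<^sub>R (of_real s * (\<i> * v)) \<in> frontier \<Omega>"
        using ray_to_frontier[OF compact_imp_bounded[OF compact] z0] by metis
      have "cnj v * (z0 + d *\<^sub>R (of_real s * (\<i> * v)) - \<zeta>) = cnj v * (z0 - \<zeta>) + of_real (d * s) * \<i> * (v * cnj v)"
        by (simp add: scaleR_conv_of_real algebra_simps)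
      also have "v * cnj v = 1" using v1 complex_norm_square[of v] by simp
      finally have e: "cnj v * (z0 + d *\<^sub>R (of_real s * (\<i> * v)) - \<zeta>) = cnj v * (z0 - \<zeta>) + of_real (d * s) * \<i>" by simp
      have "Im (of_real x * \<i>) = x" for x by simp
      then have "Im (cnj v * (z0 - \<zeta>)) + d * s = 0" using line[OF d(2)] unfolding e by (simp only: plus_complex.sel)
      then show ?thesis using d(1) by (auto simp: mult.commute)
    qed
    show False using ray[of 1] ray[of "-1"] by auto
  qed
  \<comment> \<open>The density may be singular at both ends of the period. As it is nonnegative,
    monotone convergence passes from compact subintervals to the full period.\<close>
  have total: "((\<lambda>t. Im (velocity t / (g t - \<zeta>))) has_integral \<beta>\<^sub>1 - \<beta>\<^sub>0) {0..L}"
  proof -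
    define e where "e k = L / real (k + 3)" for k :: nat
    have e: "0 < e k" "e k < L - e k" "e (Suc k) \<le> e k" for k
    proof -
      show "0 < e k" using L_pos by (simp add: e_def)
      have "e k \<le> L / 3" unfolding e_def using L_pos by (intro divide_left_mono) auto
      then show "e k < L - e k" using L_pos by linarith
      show "e (Suc k) \<le> e k" unfolding e_def using L_pos by (intro divide_left_mono) auto
    qed
    have e_lim: "e \<longlonglongrightarrow> 0"
    proof -
      have "(\<lambda>k. L * (1 / real (k + 3))) \<longlonglongrightarrow> L * 0"
        using LIMSEQ_ignore_initial_segment[OF lim_1_over_n, of 3] by (intro tendsto_intros) simp
      then show ?thesis by (simp add: e_def[abs_def])
    qed
    define \<rho> where "\<rho> t = Im (velocity t / (g t - \<zeta>))" for t
    define f where "f k t = (if t \<in> {e k..L - e k} then \<rho> t else 0)" for k t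
    have f_int: "(f k has_integral \<phi> (L - e k) - \<phi> (e k)) {0..L}" for k
    proof -
      have "(\<rho> has_integral \<phi> (L - e k) - \<phi> (e k)) {e k..L - e k}"
        unfolding \<rho>_def using e[of k] by (intro int) auto
      then show ?thesis unfolding f_def
        using e[of k] by (subst has_integral_restrict) auto
    qed
    have conv: "(\<lambda>k. f k t) \<longlonglongrightarrow> \<rho> t" if t: "t \<in> {0..L}" for t
    proof (cases "t = 0 \<or> t = L")
      case True
      then have "\<rho> t = 0" using g_per[of 0] by (auto simp: \<rho>_def \<zeta>_def)
      then have "f k t = \<rho> t" for k by (simp add: f_def)
      then show ?thesis by simp
    next
      case False
      then have "0 < min t (L - t)" using t by auto
      then have "\<forall>\<^sub>F k in sequentially. e k < min t (L - t)" using e_lim by (rule order_tendstoD(2)[rotated])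
      then have "\<forall>\<^sub>F k in sequentially. f k t = \<rho> t" by eventually_elim (auto simp: f_def)
      then show ?thesis by (rule tendsto_eventually)
    qed
    have val: "(\<lambda>k. integral {0..L} (f k)) \<longlonglongrightarrow> \<beta>\<^sub>1 - \<beta>\<^sub>0"
    proof -
      have e0: "e k \<noteq> 0" for k using e(1)[of k] by simp
      have l0: "filterlim e (at_right 0) sequentially"
        using e_lim e(1) e0 by (auto simp: filterlim_at)
      have l1: "filterlim (\<lambda>k. L - e k) (at_left L) sequentially"
      proof -
        have "(\<lambda>k. L - e k) \<longlonglongrightarrow> L - 0" using e_lim by (intro tendsto_intros)
        then show ?thesis using e(1) e0 by (auto simp: filterlim_at)
      qed
      have "(\<lambda>k. \<phi> (L - e k) - \<phi> (e k)) \<longlonglongrightarrow> \<beta>\<^sub>1 - \<beta>\<^sub>0"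
        by (intro tendsto_diff filterlim_compose[OF lim1 l1] filterlim_compose[OF lim0 l0])
      then show ?thesis by (simp add: integral_unique[OF f_int])
    qed
    have "\<rho> integrable_on {0..L} \<and> (\<lambda>k. integral {0..L} (f k)) \<longlonglongrightarrow> integral {0..L} \<rho>"
    proof (rule monotone_convergence_increasing)
      show "f k integrable_on {0..L}" for k using f_int by blast
      show "f k t \<le> f (Suc k) t" for k t using e(3)[of k] dens[of t] by (auto simp: f_def \<rho>_def)
      show "bounded (range (\<lambda>k. integral {0..L} (f k)))" using val convergent_imp_bounded by blast
    qed (rule conv)
    then show ?thesis using val LIMSEQ_unique unfolding \<rho>_def[symmetric] by (metis has_integral_integral)
  qed
  show thesis
    by (rule that[of "- n0" \<beta>\<^sub>0 \<beta>\<^sub>1]) (use lt b0 b1 t0 t1 total n01 in \<open>auto simp: \<zeta>_def\<close>)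
qed

end

section \<open>One-sided tangents at arbitrary boundary points\<close>

lemma tendsto_at_left_iff_at_right_0:
  fixes f :: "real \<Rightarrow> 'a::topological_space"
  shows "(f \<longlongrightarrow> l) (at_left t) \<longleftrightarrow> ((\<lambda>x. f (t - x)) \<longlongrightarrow> l) (at_right 0)"
  by (simp add: filterlim_at_left_to_right filterlim_at_right_to_0[of _ _ "- t"])

lemma has_integral_periodic:
  fixes f :: "real \<Rightarrow> real"
  assumes per: "\<And>t. f (t + L) = f t" and a: "0 \<le> a" "a \<le> L" and f: "(f has_integral I) {a..a + L}"
  shows "(f has_integral I) {0..L}"
proof -
  have i: "f integrable_on {a..a + L}" using f by blast
  have 1: "f integrable_on {a..L}" and 2: "f integrable_on {L..a + L}"
    using a by (auto intro!: integrable_subinterval_real[OF i])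
  have I: "integral {a..L} f + integral {L..a + L} f = I"
    using Henstock_Kurzweil_Integration.integral_combine[OF _ _ i, of L] a f by (simp add: integral_unique)
  have "((\<lambda>x. f (x + L)) has_integral integral {L..a + L} f) {L - L..a + L - L}"
    using integrable_integral[OF 2] by (simp only: has_integral_shift_real_ivl)
  then have "(f has_integral integral {L..a + L} f) {0..a}" by (simp add: per)
  from has_integral_combine[OF a this integrable_integral[OF 1]] show ?thesis using I by (simp add: add.commute)
qed

context convex_curve
begin

text \<open>\<open>boundary_angle\<close> carried from the parameter 0 to every parameter of
  \<open>\<zeta>\<close>: since \<open>tangent_angles\<close> only asks for some parameter,
  uniqueness of the angles needs all of them. The sign in the incoming limit comes from reversing
  the chord. Off the boundary the limits are vacuous and any angles will do.\<close>

lemma one_sided_tangents: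
  obtains n \<beta>\<^sub>0 \<beta>\<^sub>1 where "cmod n = 1" "\<beta>\<^sub>0 < \<beta>\<^sub>1" "\<beta>\<^sub>1 \<le> \<beta>\<^sub>0 + pi"
    "\<And>t. g t = \<zeta> \<Longrightarrow> ((\<lambda>u. sgn (g u - \<zeta>)) \<longlongrightarrow> n * cis \<beta>\<^sub>0) (at_right t)"
    "\<And>t. g t = \<zeta> \<Longrightarrow> ((\<lambda>u. sgn (\<zeta> - g u)) \<longlongrightarrow> - n * cis \<beta>\<^sub>1) (at_left t)"
    "\<zeta> \<in> frontier \<Omega> \<Longrightarrow> ((\<lambda>t. Im (velocity t / (g t - \<zeta>))) has_integral \<beta>\<^sub>1 - \<beta>\<^sub>0) {0..L}"
proof (cases "\<zeta> \<in> frontier \<Omega>")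
  case False
  then have "g t \<noteq> \<zeta>" for t using g_frontier by blast
  then show thesis using False that[of 1 0 pi] pi_gt_zero by auto
next
  case True
  then obtain t' where t': "\<zeta> = g t'" using g_range by blast
  obtain k :: int where k: "0 \<le> t' + of_int k * L" "t' + of_int k * L < L" by (rule period_reduce)
  define a where "a = t' + of_int k * L"
  have a: "\<zeta> = g a" "0 \<le> a" "a < L" using k t' g_per_int by (auto simp: a_def)
  interpret s: convex_curve \<Omega> z0 L "\<lambda>x. g (x + a)" by (rule shift)
  obtain n \<beta>\<^sub>0 \<beta>\<^sub>1 where n: "cmod n = 1" "\<beta>\<^sub>0 < \<beta>\<^sub>1" "\<beta>\<^sub>1 \<le> \<beta>\<^sub>0 + pi"
    and lim0: "((\<lambda>u. sgn (g (u + a) - g (0 + a))) \<longlongrightarrow> n * cis \<beta>\<^sub>0) (at_right 0)"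
    and lim1: "((\<lambda>u. sgn (g (u + a) - g (0 + a))) \<longlongrightarrow> n * cis \<beta>\<^sub>1) (at_left L)"
    and int: "((\<lambda>t. Im (s.velocity t / (g (t + a) - g (0 + a)))) has_integral \<beta>\<^sub>1 - \<beta>\<^sub>0) {0..L}"
    by (rule s.boundary_angle) blast
  define \<rho> where "\<rho> t = Im (velocity t / (g t - \<zeta>))" for t
  have "((\<lambda>t. \<rho> (t + a)) has_integral \<beta>\<^sub>1 - \<beta>\<^sub>0) {a - a..(a + L) - a}"
    using int by (simp add: \<rho>_def s.velocity_def velocity_def a(1))
  then have "(\<rho> has_integral \<beta>\<^sub>1 - \<beta>\<^sub>0) {a..a + L}" by (rule has_integral_shift_real_ivl_iff[THEN iffD2])
  then have total: "(\<rho> has_integral \<beta>\<^sub>1 - \<beta>\<^sub>0) {0..L}"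
    by (rule has_integral_periodic[rotated 3]) (use a in \<open>auto simp: \<rho>_def velocity_per g_per\<close>)
  have per: "\<exists>j::int. t = a + of_int j * L" if "g t = \<zeta>" for t
  proof -
    obtain j :: int where j: "0 \<le> t + of_int j * L" "t + of_int j * L < L" by (rule period_reduce)
    have "g (t + of_int j * L) = g a" using that a(1) g_per_int by simp
    then have "t + of_int j * L = a" using j a by (intro g_inj) auto
    then show ?thesis by (intro exI[of _ "- j"]) auto
  qed
  have R: "((\<lambda>u. sgn (g u - \<zeta>)) \<longlongrightarrow> n * cis \<beta>\<^sub>0) (at_right t)" if "g t = \<zeta>" for t
  proof -
    obtain j :: int where j: "t = a + of_int j * L" using per[OF \<open>g t = \<zeta>\<close>] by blast
    have "g (x + t) = g (x + a)" for x using g_per_int[of "x + a" j] by (simp add: j algebra_simps)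
    then show ?thesis using lim0 by (simp add: filterlim_at_right_to_0[of _ _ t] a(1))
  qed
  have S: "((\<lambda>u. sgn (\<zeta> - g u)) \<longlongrightarrow> - n * cis \<beta>\<^sub>1) (at_left t)" if "g t = \<zeta>" for t
  proof -
    obtain j :: int where j: "t = a + of_int j * L" using per[OF \<open>g t = \<zeta>\<close>] by blast
    have "g (t - x) = g (L - x + a)" for x
      using g_per_int[of "a - x" j] g_per[of "a - x"] by (simp add: j algebra_simps)
    then have "((\<lambda>x. sgn (g (t - x) - \<zeta>)) \<longlongrightarrow> n * cis \<beta>\<^sub>1) (at_right 0)"
      using lim1 by (simp add: tendsto_at_left_iff_at_right_0[of _ _ L] a(1))
    then have "((\<lambda>x. - sgn (g (t - x) - \<zeta>)) \<longlongrightarrow> - (n * cis \<beta>\<^sub>1)) (at_right 0)" by (rule tendsto_minus)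
    then show ?thesis by (simp add: tendsto_at_left_iff_at_right_0[of _ _ t] sgn_minus[symmetric])
  qed
  show thesis by (rule that[OF n R S]) (use total in \<open>simp_all add: \<rho>_def[abs_def]\<close>)
qed

lemma tangent_at_noncorner:
  assumes t: "t \<notin> corner_times"
  shows "((\<lambda>u. sgn (g u - g t)) \<longlongrightarrow> velocity t) (at_right t)"
    "((\<lambda>u. sgn (g t - g u)) \<longlongrightarrow> velocity t) (at_left t)"
proof -
  show "((\<lambda>u. sgn (g u - g t)) \<longlongrightarrow> velocity t) (at_right t)"
  proof (rule tendstoI)
    fix e :: real assume "0 < e"
    obtain d where d: "0 < d" "\<And>u v. t - d < u \<Longrightarrow> u < v \<Longrightarrow> v < t + d \<Longrightarrow> cmod (sgn (g v - g u) - velocity t) < e"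
      using chord_direction[OF t \<open>0 < e\<close>] by metis
    then show "\<forall>\<^sub>F u in at_right t. dist (sgn (g u - g t)) (velocity t) < e"
      unfolding eventually_at_right_field dist_norm by (intro exI[of _ "t + d"]) auto
  qed
  show "((\<lambda>u. sgn (g t - g u)) \<longlongrightarrow> velocity t) (at_left t)"
  proof (rule tendstoI)
    fix e :: real assume "0 < e"
    obtain d where d: "0 < d" "\<And>u v. t - d < u \<Longrightarrow> u < v \<Longrightarrow> v < t + d \<Longrightarrow> cmod (sgn (g v - g u) - velocity t) < e"
      using chord_direction[OF t \<open>0 < e\<close>] by metis
    then show "\<forall>\<^sub>F u in at_left t. dist (sgn (g t - g u)) (velocity t) < e"
      unfolding eventually_at_left_field dist_norm by (intro exI[of _ "t - d"]) auto
  qed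
qed

text \<open>Subtracting \<open>f z\<close> cancels the singularity of the kernel, with a bound that
  does not depend on \<open>z\<close> and so survives the passage to the boundary.\<close>

lemma density_difference_bound:
  assumes "\<And>z w. z \<in> \<Omega> \<Longrightarrow> w \<in> \<Omega> \<Longrightarrow> cmod (f z - f w) \<le> C * cmod (z - w)" "z \<in> \<Omega>" "0 \<le> C"
  shows "cmod (of_real (Im (velocity t / (g t - z))) * (f (g t) - f z)) \<le> C"
proof (cases "g t = z")
  case False
  let ?d = "cmod (g t - z)"
  have "\<bar>Im (velocity t / (g t - z))\<bar> \<le> cmod (velocity t) / ?d"
    using abs_Im_le_cmod[of "velocity t / (g t - z)"] by (simp add: norm_divide)
  also have "\<dots> \<le> 1 / ?d" by (intro divide_right_mono norm_velocity_le) auto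
  finally have "\<bar>Im (velocity t / (g t - z))\<bar> * cmod (f (g t) - f z) \<le> 1 / ?d * (C * ?d)"
    using assms(1)[OF g_in assms(2)] by (intro mult_mono) auto
  then show ?thesis using False by (simp add: norm_mult)
qed (use assms in simp)

end

section \<open>The Neumann--Poincare operator\<close>

context convex_body
begin

lemma boundary_curve: "convex_curve \<Omega> z0 (perimeter \<Omega>) (boundary_curve \<Omega>)"
proof unfold_locales
  have "\<exists>p. (case p of (L, g) \<Rightarrow> arclength_parametrization \<Omega> L g)"
    using arclength_parametrization_exists by auto
  from someI_ex[OF this] show "arclength_parametrization \<Omega> (perimeter \<Omega>) (boundary_curve \<Omega>)"
    unfolding perimeter_def boundary_curve_def by (simp only: case_prod_unfold)
qed

interpretation bc: convex_curve \<Omega> z0 "perimeter \<Omega>" "boundary_curve \<Omega>" by (rule boundary_curve)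

text \<open>The angle swept out by the boundary as seen from \<open>\<zeta>\<close> is the interior
  angle, so the density part of \<open>np_measure\<close> has mass \<open>\<theta> / pi\<close>.
  Tangent angles are known only modulo full turns, but their difference lies between 0 and
  \<open>pi\<close>, where the cosine is injective.\<close>

lemma interior_angle_integral:
  assumes \<zeta>: "\<zeta> \<in> frontier \<Omega>"
  shows "0 < interior_angle \<Omega> \<zeta>" "interior_angle \<Omega> \<zeta> \<le> pi"
    "((\<lambda>t. Im (bc.velocity t / (boundary_curve \<Omega> t - \<zeta>))) has_integral interior_angle \<Omega> \<zeta>) {0..perimeter \<Omega>}"
proof -
  obtain n \<beta>\<^sub>0 \<beta>\<^sub>1 where n: "cmod n = 1" "\<beta>\<^sub>0 < \<beta>\<^sub>1" "\<beta>\<^sub>1 \<le> \<beta>\<^sub>0 + pi"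
    and R: "\<And>t. boundary_curve \<Omega> t = \<zeta> \<Longrightarrow> ((\<lambda>u. sgn (boundary_curve \<Omega> u - \<zeta>)) \<longlongrightarrow> n * cis \<beta>\<^sub>0) (at_right t)"
    and S: "\<And>t. boundary_curve \<Omega> t = \<zeta> \<Longrightarrow> ((\<lambda>u. sgn (\<zeta> - boundary_curve \<Omega> u)) \<longlongrightarrow> - n * cis \<beta>\<^sub>1) (at_left t)"
    and int: "((\<lambda>t. Im (bc.velocity t / (boundary_curve \<Omega> t - \<zeta>))) has_integral \<beta>\<^sub>1 - \<beta>\<^sub>0) {0..perimeter \<Omega>}"
    using bc.one_sided_tangents[of \<zeta> thesis] \<zeta> by blast
  obtain t where t: "boundary_curve \<Omega> t = \<zeta>" using \<zeta> bc.g_range by (metis rangeE)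
  define \<omega> where "\<omega> = Arg n"
  have n0: "n \<noteq> 0" using n(1) by auto
  have n\<omega>: "n = cis \<omega>" using cis_Arg[OF n0] n(1) by (simp add: \<omega>_def sgn_eq)
  have minus: "- n * cis \<beta>\<^sub>1 = cis (\<omega> + \<beta>\<^sub>1 - pi)"
  proof -
    have "cis (\<omega> + \<beta>\<^sub>1 - pi) = cis (\<omega> + \<beta>\<^sub>1) / cis pi" by (rule cis_divide[symmetric])
    then show ?thesis by (simp add: n\<omega> cis_mult)
  qed
  have ex: "tangent_angles \<Omega> \<zeta> (\<omega> + \<beta>\<^sub>1 - pi) (\<omega> + \<beta>\<^sub>0)"
    unfolding tangent_angles_def
    using n(2,3) R[OF t] S[OF t] t minus by (auto simp: n\<omega> cis_mult intro!: exI[of _ t])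
  have unique: "pi - \<beta> + \<alpha> = \<beta>\<^sub>1 - \<beta>\<^sub>0" if ta: "tangent_angles \<Omega> \<zeta> \<alpha> \<beta>" for \<alpha> \<beta>
  proof -
    obtain u where u: "boundary_curve \<Omega> u = \<zeta>"
      "((\<lambda>v. sgn (\<zeta> - boundary_curve \<Omega> v)) \<longlongrightarrow> cis \<alpha>) (at_left u)"
      "((\<lambda>v. sgn (boundary_curve \<Omega> v - \<zeta>)) \<longlongrightarrow> cis \<beta>) (at_right u)"
      and ab: "0 \<le> \<beta> - \<alpha>" "\<beta> - \<alpha> < pi"
      using ta unfolding tangent_angles_def by blast
    have "cis \<beta> = cis (\<omega> + \<beta>\<^sub>0)"
      using tendsto_unique[OF trivial_limit_at_right_real u(3) R[OF u(1)]] by (simp add: n\<omega> cis_mult)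
    moreover have "cis \<alpha> = cis (\<omega> + \<beta>\<^sub>1 - pi)"
      using tendsto_unique[OF trivial_limit_at_left_real u(2) S[OF u(1)]] minus by simp
    ultimately have "cis (\<beta> - \<alpha>) = cis ((\<omega> + \<beta>\<^sub>0) - (\<omega> + \<beta>\<^sub>1 - pi))" by (simp only: cis_divide[symmetric])
    then have "cos (\<beta> - \<alpha>) = cos ((\<omega> + \<beta>\<^sub>0) - (\<omega> + \<beta>\<^sub>1 - pi))" by (metis cis.sel(1))
    then have "\<beta> - \<alpha> = (\<omega> + \<beta>\<^sub>0) - (\<omega> + \<beta>\<^sub>1 - pi)" using ab n(2,3) by (rule_tac cos_inj_pi) auto
    then show ?thesis by simp
  qed
  have "interior_angle \<Omega> \<zeta> = \<beta>\<^sub>1 - \<beta>\<^sub>0"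
    unfolding interior_angle_def
  proof (rule the_equality)
    show "\<exists>\<alpha> \<beta>. tangent_angles \<Omega> \<zeta> \<alpha> \<beta> \<and> \<beta>\<^sub>1 - \<beta>\<^sub>0 = pi - \<beta> + \<alpha>" using ex by force
  qed (use unique in metis)
  then show "0 < interior_angle \<Omega> \<zeta>" "interior_angle \<Omega> \<zeta> \<le> pi"
    "((\<lambda>t. Im (bc.velocity t / (boundary_curve \<Omega> t - \<zeta>))) has_integral interior_angle \<Omega> \<zeta>) {0..perimeter \<Omega>}"
    using n int by simp_all
qed

text \<open>The bridge from supporting lines to the tangent notions of the statement: where the
  supporting line is unique, both one-sided tangents equal
  \<open>\<i> * normal \<sigma>\<close>.\<close>

lemma noncorner:
  assumes \<sigma>: "\<sigma> \<in> frontier \<Omega> - corners"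
  shows "\<not> corner \<Omega> \<sigma>" "outward_normal \<Omega> \<sigma> = normal \<sigma>"
proof -
  define v where "v = \<i> * normal \<sigma>"
  have v1: "cmod v = 1" using unit_normalD(1)[OF normal_unit_normal(1)[OF \<sigma>]] by (simp add: v_def norm_mult)
  have lim: "((\<lambda>u. sgn (boundary_curve \<Omega> u - \<sigma>)) \<longlongrightarrow> v) (at_right t)"
    "((\<lambda>u. sgn (\<sigma> - boundary_curve \<Omega> u)) \<longlongrightarrow> v) (at_left t)" if "boundary_curve \<Omega> t = \<sigma>" for t
    using bc.tangent_at_noncorner[of t] that \<sigma> by (auto simp: bc.corner_times_def bc.velocity_def v_def)
  have ta: "cis \<alpha> = v \<and> cis \<beta> = v \<and> \<alpha> = \<beta>" if ta: "tangent_angles \<Omega> \<sigma> \<alpha> \<beta>" for \<alpha> \<beta>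
  proof -
    obtain u where u: "boundary_curve \<Omega> u = \<sigma>"
      "((\<lambda>v. sgn (\<sigma> - boundary_curve \<Omega> v)) \<longlongrightarrow> cis \<alpha>) (at_left u)"
      "((\<lambda>v. sgn (boundary_curve \<Omega> v - \<sigma>)) \<longlongrightarrow> cis \<beta>) (at_right u)"
      and ab: "0 \<le> \<beta> - \<alpha>" "\<beta> - \<alpha> < pi"
      using ta unfolding tangent_angles_def by blast
    have eq: "cis \<beta> = v" "cis \<alpha> = v"
      using tendsto_unique[OF trivial_limit_at_right_real u(3) lim(1)[OF u(1)]]
        tendsto_unique[OF trivial_limit_at_left_real u(2) lim(2)[OF u(1)]] by simp_all
    then have "cis (\<beta> - \<alpha>) = 1" using v1 unfolding cis_divide[symmetric] by auto
    then have "cos (\<beta> - \<alpha>) = cos 0" by (metis cis.sel(1) cos_zero one_complex.sel(1))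
    then have "\<beta> - \<alpha> = 0" using ab by (rule_tac cos_inj_pi) auto
    then show ?thesis using eq by simp
  qed
  show "\<not> corner \<Omega> \<sigma>" unfolding corner_def using ta by force
  obtain t where t: "boundary_curve \<Omega> t = \<sigma>" using \<sigma> bc.g_range by (metis DiffD1 rangeE)
  have v0: "v \<noteq> 0" using v1 by auto
  have cv: "cis (Arg v) = v" using cis_Arg[OF v0] v1 by (simp add: sgn_eq)
  have "tangent_angles \<Omega> \<sigma> (Arg v) (Arg v)"
    unfolding tangent_angles_def using lim[OF t] t by (auto simp: cv)
  then have "unit_tangent \<Omega> \<sigma> = v"
    unfolding unit_tangent_def by (intro the_equality) (use cv ta in \<open>metis\<close>)+
  then show "outward_normal \<Omega> \<sigma> = normal \<sigma>" by (simp add: outward_normal_def v_def)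
qed

text \<open>A Borel version of \<open>np_kernel\<close>, defined on the whole plane; on the boundary
  the two can differ only on the countable set \<open>corners\<close>, which arclength does not
  charge.\<close>

definition density_kernel :: "complex \<Rightarrow> complex \<Rightarrow> real" where
  "density_kernel \<zeta> \<sigma> = Re (normal \<sigma> / (\<sigma> - \<zeta>)) / pi"

lemma np_kernel_noncorner: "\<sigma> \<in> frontier \<Omega> - corners \<Longrightarrow> np_kernel \<Omega> \<zeta> \<sigma> = density_kernel \<zeta> \<sigma>"
  using noncorner[of \<sigma>] by (simp add: np_kernel_def density_kernel_def)

lemma borel_measurable_density_kernel [measurable]: "density_kernel \<zeta> \<in> borel_measurable borel"
  unfolding density_kernel_def by measurable

lemma density_kernel_curve: "density_kernel \<zeta> (boundary_curve \<Omega> t) = Im (bc.velocity t / (boundary_curve \<Omega> t - \<zeta>)) / pi"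
proof -
  have "Im (\<i> * normal (boundary_curve \<Omega> t) / (boundary_curve \<Omega> t - \<zeta>)) = Re (normal (boundary_curve \<Omega> t) / (boundary_curve \<Omega> t - \<zeta>))"
    using Im_i_times[of "normal (boundary_curve \<Omega> t) / (boundary_curve \<Omega> t - \<zeta>)"] by (simp only: times_divide_eq_right)
  then show ?thesis by (simp add: density_kernel_def bc.velocity_def)
qed

lemma density_kernel_nonneg: "\<sigma> \<in> frontier \<Omega> \<Longrightarrow> \<zeta> \<in> \<Omega> \<Longrightarrow> 0 \<le> density_kernel \<zeta> \<sigma>"
proof -
  assume "\<sigma> \<in> frontier \<Omega>" "\<zeta> \<in> \<Omega>"
  then obtain t where "\<sigma> = boundary_curve \<Omega> t" using bc.g_range by blast
  then show ?thesis using bc.density_nonneg[OF \<open>\<zeta> \<in> \<Omega>\<close>, of t] by (simp add: density_kernel_curve)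
qed

section \<open>The measures of the statement, expressed through the curve\<close>

lemma sets_arclength: "sets (arclength_measure \<Omega>) = sets (restrict_space borel (frontier \<Omega>))"
  and space_arclength: "space (arclength_measure \<Omega>) = frontier \<Omega>"
  by (simp_all add: arclength_measure_def space_restrict_space)

lemma measurable_boundary_curve:
  "boundary_curve \<Omega> \<in> measurable (restrict_space lborel {0..<perimeter \<Omega>}) (restrict_space borel (frontier \<Omega>))"
  by (intro measurable_restrict_space1 measurable_restrict_space2) (use bc.g_frontier in auto)

lemma AE_arclength_noncorner: "AE \<sigma> in arclength_measure \<Omega>. \<sigma> \<notin> corners"
proof -
  have set: "{\<sigma> \<in> space (restrict_space borel (frontier \<Omega>)). \<sigma> \<notin> corners} \<in> sets (restrict_space borel (frontier \<Omega>))"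
  proof -
    have "frontier \<Omega> - corners \<in> sets borel" using borel_corners by (auto simp: frontier_closed borel_closed)
    moreover have "{\<sigma> \<in> space (restrict_space borel (frontier \<Omega>)). \<sigma> \<notin> corners} = frontier \<Omega> - corners"
      by (auto simp: space_restrict_space)
    ultimately show ?thesis by (simp add: sets_restrict_space_iff frontier_closed borel_closed)
  qed
  have "AE t in lborel. t \<notin> bc.corner_times"
    using AE_not_in[OF countable_imp_null_set_lborel[OF bc.countable_corner_times]] .
  then have "AE t in restrict_space lborel {0..<perimeter \<Omega>}. boundary_curve \<Omega> t \<notin> corners"
    by (subst AE_restrict_space_iff) (auto simp: bc.corner_times_def elim: AE_mp)
  then show ?thesis unfolding arclength_measure_def
    by (subst AE_distr_iff[OF measurable_boundary_curve set])
qed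

lemma density_arclength:
  "density (arclength_measure \<Omega>) (\<lambda>\<sigma>. ennreal (np_kernel \<Omega> \<zeta> \<sigma>))
    = density (arclength_measure \<Omega>) (\<lambda>\<sigma>. ennreal (density_kernel \<zeta> \<sigma>))"
proof (rule density_cong)
  have dk: "density_kernel \<zeta> \<in> borel_measurable (arclength_measure \<Omega>)"
    using measurable_restrict_space1[OF borel_measurable_density_kernel] measurable_cong_sets[OF sets_arclength refl] by blast
  then show "(\<lambda>\<sigma>. ennreal (density_kernel \<zeta> \<sigma>)) \<in> borel_measurable (arclength_measure \<Omega>)" by measurable
  have "np_kernel \<Omega> \<zeta> \<in> borel_measurable (arclength_measure \<Omega>)"
  proof (rule measurable_discrete_difference[OF dk countable_corners])
    show "{x} \<in> sets (arclength_measure \<Omega>)" if "x \<in> corners" for x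
      using that unfolding sets_arclength by (auto simp: sets_restrict_space_iff frontier_closed borel_closed corners_def)
    show "density_kernel \<zeta> x = np_kernel \<Omega> \<zeta> x" if "x \<in> space (arclength_measure \<Omega>)" "x \<notin> corners" for x
      using np_kernel_noncorner that by (simp add: space_arclength)
  qed auto
  then show "(\<lambda>\<sigma>. ennreal (np_kernel \<Omega> \<zeta> \<sigma>)) \<in> borel_measurable (arclength_measure \<Omega>)" by measurable
  show "AE \<sigma> in arclength_measure \<Omega>. ennreal (np_kernel \<Omega> \<zeta> \<sigma>) = ennreal (density_kernel \<zeta> \<sigma>)"
    using AE_arclength_noncorner AE_space
    by eventually_elim (simp add: np_kernel_noncorner space_arclength)
qed

lemma sets_np: "sets (np_measure \<Omega> \<zeta>) = sets (restrict_space borel (frontier \<Omega>))"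
  and space_np: "space (np_measure \<Omega> \<zeta>) = frontier \<Omega>"
proof -
  have sp: "space (restrict_space borel (frontier \<Omega>)) = frontier \<Omega>" by (simp add: space_restrict_space)
  then show "space (np_measure \<Omega> \<zeta>) = frontier \<Omega>" unfolding np_measure_def
    by (subst space_measure_of) (use sets.space_closed[of "restrict_space borel (frontier \<Omega>)"] in auto)
  have "sigma_sets (frontier \<Omega>) (sets (restrict_space borel (frontier \<Omega>))) = sets (restrict_space borel (frontier \<Omega>))"
    using sets.sigma_sets_eq[of "restrict_space borel (frontier \<Omega>)"] sp by simp
  then show "sets (np_measure \<Omega> \<zeta>) = sets (restrict_space borel (frontier \<Omega>))" unfolding np_measure_def
    by (subst sets_measure_of) (use sets.space_closed[of "restrict_space borel (frontier \<Omega>)"] sp in auto)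
qed

text \<open>The point mass \<open>1 - \<theta> / pi\<close> and the density mass
  \<open>\<theta> / pi\<close> add up to 1. Hence the operator averages, which gives its contraction
  property modulo constants.\<close>

lemma emeasure_np_space:
  assumes \<zeta>: "\<zeta> \<in> frontier \<Omega>"
  shows "emeasure (np_measure \<Omega> \<zeta>) (space (np_measure \<Omega> \<zeta>)) = 1"
proof -
  have fs: "frontier \<Omega> \<in> sets (restrict_space borel (frontier \<Omega>))"
    by (metis sets.top space_restrict_space2 frontier_closed borel_closed)
  have dk: "(\<lambda>\<sigma>. ennreal (density_kernel \<zeta> \<sigma>)) \<in> borel_measurable (restrict_space borel (frontier \<Omega>))"
    by (intro measurable_restrict_space1) measurable
  have "emeasure (density (arclength_measure \<Omega>) (\<lambda>\<sigma>. ennreal (density_kernel \<zeta> \<sigma>))) (frontier \<Omega>)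
      = (\<integral>\<^sup>+\<sigma>. ennreal (density_kernel \<zeta> \<sigma>) * indicator (frontier \<Omega>) \<sigma> \<partial>arclength_measure \<Omega>)"
    by (rule emeasure_density) (use dk fs in \<open>auto simp: sets_arclength cong: measurable_cong_sets\<close>)
  also have "\<dots> = (\<integral>\<^sup>+\<sigma>. ennreal (density_kernel \<zeta> \<sigma>) \<partial>arclength_measure \<Omega>)"
    by (rule nn_integral_cong) (simp add: space_arclength)
  also have "\<dots> = (\<integral>\<^sup>+t. ennreal (density_kernel \<zeta> (boundary_curve \<Omega> t)) \<partial>restrict_space lborel {0..<perimeter \<Omega>})"
    unfolding arclength_measure_def by (rule nn_integral_distr[OF measurable_boundary_curve]) (use dk in simp)
  also have "\<dots> = (\<integral>\<^sup>+t. ennreal (density_kernel \<zeta> (boundary_curve \<Omega> t)) * indicator {0..<perimeter \<Omega>} t \<partial>lborel)"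
    by (rule nn_integral_restrict_space) simp
  also have "\<dots> = ennreal (interior_angle \<Omega> \<zeta> / pi)"
  proof (rule nn_integral_has_integral_lebesgue')
    show "0 \<le> density_kernel \<zeta> (boundary_curve \<Omega> t)" for t
      using \<zeta> frontier_subset bc.g_frontier by (intro density_kernel_nonneg) auto
    have "((\<lambda>t. density_kernel \<zeta> (boundary_curve \<Omega> t)) has_integral interior_angle \<Omega> \<zeta> / pi) {0..perimeter \<Omega>}"
      unfolding density_kernel_curve by (intro has_integral_divide interior_angle_integral \<zeta>)
    then show "((\<lambda>t. density_kernel \<zeta> (boundary_curve \<Omega> t)) has_integral interior_angle \<Omega> \<zeta> / pi) {0..<perimeter \<Omega>}"
      by (rule has_integral_spike_set_eq[THEN iffD1, rotated 2]) (auto intro: negligible_subset[of "{perimeter \<Omega>}"])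
  qed
  finally have "emeasure (np_measure \<Omega> \<zeta>) (frontier \<Omega>) = ennreal (1 - interior_angle \<Omega> \<zeta> / pi) + ennreal (interior_angle \<Omega> \<zeta> / pi)"
    using \<zeta> by (simp add: emeasure_np_measure[OF fs] density_arclength)
  also have "\<dots> = ennreal 1"
    using interior_angle_integral(1,2)[OF \<zeta>] by (subst ennreal_plus[symmetric]) (auto simp: field_simps)
  finally show ?thesis by (simp add: space_np)
qed

lemma borel_measurable_np:
  "continuous_on (frontier \<Omega>) f \<Longrightarrow> f \<in> borel_measurable (np_measure \<Omega> \<zeta>)"
  using borel_measurable_continuous_on_restrict[of "frontier \<Omega>" f] measurable_cong_sets[OF sets_np refl] by blast

lemma integrable_np:
  fixes f :: "complex \<Rightarrow> complex"
  assumes \<zeta>: "\<zeta> \<in> frontier \<Omega>" and f: "continuous_on (frontier \<Omega>) f"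
  shows "integrable (np_measure \<Omega> \<zeta>) f"
proof -
  interpret finite_measure "np_measure \<Omega> \<zeta>" by (rule finite_measureI) (simp add: emeasure_np_space[OF \<zeta>])
  have total: "measure (np_measure \<Omega> \<zeta>) (space (np_measure \<Omega> \<zeta>)) = 1"
    by (simp add: measure_def emeasure_np_space[OF \<zeta>])
  have "bounded (f ` frontier \<Omega>)" using compact_continuous_image[OF f compact_frontier] by (rule compact_imp_bounded)
  then obtain B where "\<And>\<sigma>. \<sigma> \<in> frontier \<Omega> \<Longrightarrow> norm (f \<sigma>) \<le> B" unfolding bounded_iff by auto
  then show ?thesis using borel_measurable_np[OF f] by (intro integrable_const_bound[of _ B]) (auto simp: space_np)
qed

lemma np_operator_bound:
  assumes \<zeta>: "\<zeta> \<in> frontier \<Omega>" and f: "continuous_on (frontier \<Omega>) f"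
    and B: "\<And>\<sigma>. \<sigma> \<in> frontier \<Omega> \<Longrightarrow> cmod (f \<sigma> - c) \<le> B"
  shows "cmod (np_operator \<Omega> f \<zeta> - c) \<le> B"
proof -
  interpret finite_measure "np_measure \<Omega> \<zeta>" by (rule finite_measureI) (simp add: emeasure_np_space[OF \<zeta>])
  have total: "measure (np_measure \<Omega> \<zeta>) (space (np_measure \<Omega> \<zeta>)) = 1"
    by (simp add: measure_def emeasure_np_space[OF \<zeta>])
  have fc: "integrable (np_measure \<Omega> \<zeta>) (\<lambda>\<sigma>. f \<sigma> - c)"
    by (intro integrable_np \<zeta> continuous_intros f)
  have "np_operator \<Omega> f \<zeta> - c = (\<integral>\<sigma>. f \<sigma> - c \<partial>np_measure \<Omega> \<zeta>)"
    unfolding np_operator_def using integrable_np[OF \<zeta> f] by (simp add: total)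
  also have "cmod \<dots> \<le> (\<integral>\<sigma>. cmod (f \<sigma> - c) \<partial>np_measure \<Omega> \<zeta>)" by (rule integral_norm_bound)
  also have "\<dots> \<le> (\<integral>\<sigma>. B \<partial>np_measure \<Omega> \<zeta>)"
    using fc B by (intro integral_mono) (auto simp: space_np)
  also have "\<dots> = B" by (simp add: total)
  finally show ?thesis .
qed

lemma poly_lipschitz:
  obtains C where "0 \<le> C" "\<And>z w. z \<in> \<Omega> \<Longrightarrow> w \<in> \<Omega> \<Longrightarrow> cmod (poly f z - poly f w) \<le> C * cmod (z - w)"
proof -
  have "bounded (poly (pderiv f) ` \<Omega>)"
    by (intro compact_imp_bounded compact_continuous_image compact continuous_intros)
  then obtain C where C: "0 < C" "\<And>z. z \<in> \<Omega> \<Longrightarrow> cmod (poly (pderiv f) z) \<le> C" unfolding bounded_pos by auto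
  have "cmod (poly f z - poly f w) \<le> C * cmod (z - w)" if "z \<in> \<Omega>" "w \<in> \<Omega>" for z w
    by (rule field_differentiable_bound[OF convex _ C(2) that(1,2)])
      (auto intro: poly_DERIV has_field_derivative_at_within)
  then show thesis using C(1) that[of C] by simp
qed

text \<open>After subtraction of the value at \<open>\<zeta>\<close> the integrand vanishes there,
  so the point mass drops out, and what remains is a bounded integrand over the parameter interval.
  This is the form that extends to the interior.\<close>

lemma np_operator_poly:
  assumes \<zeta>: "\<zeta> \<in> frontier \<Omega>"
  shows "np_operator \<Omega> (poly f) \<zeta> = poly f \<zeta> + integral {0..perimeter \<Omega>}
    (\<lambda>t. of_real (Im (bc.velocity t / (boundary_curve \<Omega> t - \<zeta>))) * (poly f (boundary_curve \<Omega> t) - poly f \<zeta>)) / pi"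
proof -
  interpret finite_measure "np_measure \<Omega> \<zeta>" by (rule finite_measureI) (simp add: emeasure_np_space[OF \<zeta>])
  have total: "measure (np_measure \<Omega> \<zeta>) (space (np_measure \<Omega> \<zeta>)) = 1"
    by (simp add: measure_def emeasure_np_space[OF \<zeta>])
  let ?R = "restrict_space (borel::complex measure) (frontier \<Omega>)"
  define D where "D = density (arclength_measure \<Omega>) (\<lambda>\<sigma>. ennreal (density_kernel \<zeta> \<sigma>))"
  define E where "E = frontier \<Omega> - {\<zeta>}"
  define h where "h \<sigma> = poly f \<sigma> - poly f \<zeta>" for \<sigma>
  have Eb: "E \<in> sets borel" unfolding E_def by (auto simp: frontier_closed borel_closed)
  have Es: "E \<inter> frontier \<Omega> = E" by (auto simp: E_def)
  have ER: "E \<in> sets ?R" using Eb by (auto simp: sets_restrict_space_iff frontier_closed borel_closed E_def)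
  have sD: "sets D = sets ?R" "space D = frontier \<Omega>" by (simp_all add: D_def sets_arclength space_arclength)
  have cont_h: "continuous_on S h" for S unfolding h_def by (intro continuous_intros)
  have hb: "h \<in> borel_measurable borel" by (rule borel_measurable_continuous_onI[OF cont_h])
  have eqr: "restrict_space (np_measure \<Omega> \<zeta>) E = restrict_space D E"
  proof (rule measure_eqI)
    show "sets (restrict_space (np_measure \<Omega> \<zeta>) E) = sets (restrict_space D E)"
      by (simp add: sets_restrict_space sets_np sD)
    fix A assume "A \<in> sets (restrict_space (np_measure \<Omega> \<zeta>) E)"
    then have A: "A \<in> sets ?R" "A \<subseteq> E" using ER Es by (auto simp: sets_restrict_space_iff space_np sets_np)
    then have "\<zeta> \<notin> A" by (auto simp: E_def)
    then have "emeasure (np_measure \<Omega> \<zeta>) A = emeasure D A"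
      using emeasure_np_measure[OF A(1), of \<zeta>] by (simp add: D_def density_arclength)
    then show "emeasure (restrict_space (np_measure \<Omega> \<zeta>) E) A = emeasure (restrict_space D E) A"
      using A ER Es by (simp add: emeasure_restrict_space space_np sets_np sD)
  qed
  have ind: "indicator E \<sigma> *\<^sub>R h \<sigma> = h \<sigma>" if "\<sigma> \<in> frontier \<Omega>" for \<sigma>
    using that by (auto simp: E_def h_def indicator_def)
  have "np_operator \<Omega> (poly f) \<zeta> = poly f \<zeta> + (\<integral>\<sigma>. h \<sigma> \<partial>np_measure \<Omega> \<zeta>)"
  proof -
    have "continuous_on (frontier \<Omega>) (poly f)" by (intro continuous_intros)
    then show ?thesis unfolding np_operator_def h_def using integrable_np[OF \<zeta>] by (simp add: total)
  qed
  also have "(\<integral>\<sigma>. h \<sigma> \<partial>np_measure \<Omega> \<zeta>) = (\<integral>\<sigma>. indicator E \<sigma> *\<^sub>R h \<sigma> \<partial>np_measure \<Omega> \<zeta>)"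
    by (rule Bochner_Integration.integral_cong) (auto simp: space_np ind)
  also have "\<dots> = (\<integral>\<sigma>. h \<sigma> \<partial>restrict_space (np_measure \<Omega> \<zeta>) E)"
    by (rule integral_restrict_space[symmetric]) (use ER Es in \<open>auto simp: space_np sets_np\<close>)
  also have "\<dots> = (\<integral>\<sigma>. indicator E \<sigma> *\<^sub>R h \<sigma> \<partial>D)"
    unfolding eqr by (rule integral_restrict_space) (use ER Es in \<open>auto simp: sD\<close>)
  also have "\<dots> = (\<integral>\<sigma>. h \<sigma> \<partial>D)"
    by (rule Bochner_Integration.integral_cong) (auto simp: sD ind)
  also have "\<dots> = (\<integral>\<sigma>. density_kernel \<zeta> \<sigma> *\<^sub>R h \<sigma> \<partial>arclength_measure \<Omega>)"
    unfolding D_def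
  proof (rule integral_density)
    show "h \<in> borel_measurable (arclength_measure \<Omega>)"
      using measurable_restrict_space1[OF hb] measurable_cong_sets[OF sets_arclength refl] by blast
    show "density_kernel \<zeta> \<in> borel_measurable (arclength_measure \<Omega>)"
      using measurable_restrict_space1[OF borel_measurable_density_kernel] measurable_cong_sets[OF sets_arclength refl] by blast
    show "AE \<sigma> in arclength_measure \<Omega>. 0 \<le> density_kernel \<zeta> \<sigma>"
      using \<zeta> frontier_subset by (intro AE_I2 density_kernel_nonneg) (auto simp: space_arclength)
  qed
  also have "\<dots> = (\<integral>t. density_kernel \<zeta> (boundary_curve \<Omega> t) *\<^sub>R h (boundary_curve \<Omega> t) \<partial>restrict_space lborel {0..<perimeter \<Omega>})"
    unfolding arclength_measure_def
    by (rule integral_distr[OF measurable_boundary_curve]) (intro measurable_restrict_space1 borel_measurable_scaleR hb borel_measurable_density_kernel)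
  also have "\<dots> = (LINT t:{0..<perimeter \<Omega>}|lborel. density_kernel \<zeta> (boundary_curve \<Omega> t) *\<^sub>R h (boundary_curve \<Omega> t))"
    unfolding set_lebesgue_integral_def by (rule integral_restrict_space) simp
  also have "\<dots> = integral {0..<perimeter \<Omega>} (\<lambda>t. density_kernel \<zeta> (boundary_curve \<Omega> t) *\<^sub>R h (boundary_curve \<Omega> t))"
  proof (rule set_borel_integral_eq_integral(2))
    obtain C where C: "0 \<le> C" "\<And>z w. z \<in> \<Omega> \<Longrightarrow> w \<in> \<Omega> \<Longrightarrow> cmod (poly f z - poly f w) \<le> C * cmod (z - w)"
      by (rule poly_lipschitz) blast
    have "\<zeta> \<in> \<Omega>" using \<zeta> frontier_subset by blast
    have bd: "norm (density_kernel \<zeta> (boundary_curve \<Omega> t) *\<^sub>R h (boundary_curve \<Omega> t)) \<le> C / pi" for t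
    proof -
      have "norm (density_kernel \<zeta> (boundary_curve \<Omega> t) *\<^sub>R h (boundary_curve \<Omega> t))
        = cmod (of_real (Im (bc.velocity t / (boundary_curve \<Omega> t - \<zeta>))) * (poly f (boundary_curve \<Omega> t) - poly f \<zeta>)) / pi"
        by (simp add: density_kernel_curve h_def norm_mult)
      also have "\<dots> \<le> C / pi"
        by (intro divide_right_mono bc.density_difference_bound C \<open>\<zeta> \<in> \<Omega>\<close>) auto
      finally show ?thesis .
    qed
    have "(\<lambda>t. density_kernel \<zeta> (boundary_curve \<Omega> t) *\<^sub>R h (boundary_curve \<Omega> t)) \<in> borel_measurable borel"
      using hb by measurable
    then show "set_integrable lborel {0..<perimeter \<Omega>} (\<lambda>t. density_kernel \<zeta> (boundary_curve \<Omega> t) *\<^sub>R h (boundary_curve \<Omega> t))"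
      unfolding set_integrable_def using bd bc.L_pos
      by (intro integrableI_bounded_set_indicator[where B = "C / pi"]) auto
  qed
  also have "\<dots> = integral {0..perimeter \<Omega>} (\<lambda>t. density_kernel \<zeta> (boundary_curve \<Omega> t) *\<^sub>R h (boundary_curve \<Omega> t))"
    by (rule integral_spike_set) (auto intro: negligible_subset[of "{perimeter \<Omega>}"])
  also have "\<dots> = integral {0..perimeter \<Omega>} (\<lambda>t. (of_real (Im (bc.velocity t / (boundary_curve \<Omega> t - \<zeta>))) * (poly f (boundary_curve \<Omega> t) - poly f \<zeta>)) / pi)"
    by (simp add: density_kernel_curve h_def scaleR_conv_of_real)
  also have "\<dots> = integral {0..perimeter \<Omega>} (\<lambda>t. of_real (Im (bc.velocity t / (boundary_curve \<Omega> t - \<zeta>))) * (poly f (boundary_curve \<Omega> t) - poly f \<zeta>)) / pi"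
    by (rule integral_divide)
  finally show ?thesis .
qed

end

section \<open>The analytic configuration constant\<close>

context convex_body
begin

lemma frontier_nonempty: "frontier \<Omega> \<noteq> {}"
  using convex_curve.g_frontier[OF boundary_curve] by blast

text \<open>\<open>INF\<close> and \<open>SUP\<close> of reals carry information only for bounded
  families; the one bound by \<open>B\<close> around \<open>c\<close> makes the supremum around
  every other centre finite.\<close>

lemma quotient_norm_least:
  assumes B: "\<And>\<zeta>. \<zeta> \<in> frontier \<Omega> \<Longrightarrow> cmod (g \<zeta> - c) \<le> B"
  shows "0 \<le> boundary_quotient_norm \<Omega> g" "boundary_quotient_norm \<Omega> g \<le> B"
    "\<And>b. boundary_quotient_norm \<Omega> g < b \<Longrightarrow> \<exists>c. \<forall>\<zeta>\<in>frontier \<Omega>. cmod (g \<zeta> - c) \<le> b"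
proof -
  let ?S = "\<lambda>c. SUP \<zeta>\<in>frontier \<Omega>. cmod (g \<zeta> - c)"
  have bdd: "bdd_above ((\<lambda>\<zeta>. cmod (g \<zeta> - d)) ` frontier \<Omega>)" for d
  proof (rule bdd_aboveI2)
    fix \<zeta> assume "\<zeta> \<in> frontier \<Omega>"
    then show "cmod (g \<zeta> - d) \<le> B + cmod (c - d)"
      using B[of \<zeta>] norm_triangle_ineq[of "g \<zeta> - c" "c - d"] by simp
  qed
  have pos: "0 \<le> ?S d" for d
  proof -
    obtain \<zeta> where "\<zeta> \<in> frontier \<Omega>" using frontier_nonempty by blast
    then have "cmod (g \<zeta> - d) \<le> ?S d" by (rule cSUP_upper[OF _ bdd])
    then show ?thesis using norm_ge_zero order_trans by blast
  qed
  then have bb: "bdd_below (range ?S)" by (intro bdd_belowI[of _ 0]) auto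
  show "0 \<le> boundary_quotient_norm \<Omega> g"
    unfolding boundary_quotient_norm_def using pos by (intro cINF_greatest) auto
  have "boundary_quotient_norm \<Omega> g \<le> ?S c"
    unfolding boundary_quotient_norm_def by (rule cINF_lower[OF bb]) simp
  also have "\<dots> \<le> B" by (rule cSUP_least[OF frontier_nonempty B])
  finally show "boundary_quotient_norm \<Omega> g \<le> B" .
  show "\<exists>c. \<forall>\<zeta>\<in>frontier \<Omega>. cmod (g \<zeta> - c) \<le> b" if b: "boundary_quotient_norm \<Omega> g < b" for b
  proof -
    have "\<exists>d\<in>UNIV. ?S d < b"
      using b unfolding boundary_quotient_norm_def by (subst (asm) cINF_less_iff[OF _ bb]) auto
    then obtain d where d: "?S d < b" by blast
    have "cmod (g \<zeta> - d) \<le> b" if "\<zeta> \<in> frontier \<Omega>" for \<zeta>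
      using cSUP_upper[OF that bdd, of d] d by linarith
    then show ?thesis by blast
  qed
qed

lemma np_operator_contraction:
  assumes f: "continuous_on (frontier \<Omega>) f"
  shows "0 \<le> boundary_quotient_norm \<Omega> f" "0 \<le> boundary_quotient_norm \<Omega> (np_operator \<Omega> f)"
    "boundary_quotient_norm \<Omega> (np_operator \<Omega> f) \<le> boundary_quotient_norm \<Omega> f"
proof -
  have "bounded (f ` frontier \<Omega>)" using compact_continuous_image[OF f compact_frontier] by (rule compact_imp_bounded)
  then obtain B where B: "\<And>\<sigma>. \<sigma> \<in> frontier \<Omega> \<Longrightarrow> cmod (f \<sigma> - 0) \<le> B" unfolding bounded_iff by auto
  have KB: "cmod (np_operator \<Omega> f \<zeta> - 0) \<le> B" if "\<zeta> \<in> frontier \<Omega>" for \<zeta>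
    by (rule np_operator_bound[OF that f B])
  show "0 \<le> boundary_quotient_norm \<Omega> f" by (rule quotient_norm_least(1)[OF B])
  show "0 \<le> boundary_quotient_norm \<Omega> (np_operator \<Omega> f)" by (rule quotient_norm_least(1)[OF KB])
  show "boundary_quotient_norm \<Omega> (np_operator \<Omega> f) \<le> boundary_quotient_norm \<Omega> f"
  proof (rule dense_ge)
    fix b assume "boundary_quotient_norm \<Omega> f < b"
    then obtain c where c: "\<And>\<zeta>. \<zeta> \<in> frontier \<Omega> \<Longrightarrow> cmod (f \<zeta> - c) \<le> b"
      using quotient_norm_least(3)[where g = f and c = 0 and B = B and b = b, OF B] by blast
    show "boundary_quotient_norm \<Omega> (np_operator \<Omega> f) \<le> b"
      by (rule quotient_norm_least(2)[of _ c]) (rule np_operator_bound[OF _ f c])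
  qed
qed

lemma analytic_imp_continuous_frontier: "f \<in> analytic_functions \<Omega> \<Longrightarrow> continuous_on (frontier \<Omega>) f"
  using continuous_on_subset[OF _ frontier_subset] by (auto simp: analytic_functions_def)

lemma poly_analytic_function: "poly f \<in> analytic_functions \<Omega>"
proof -
  have "poly f holomorphic_on interior \<Omega>" by (intro holomorphic_intros)
  then show ?thesis
    unfolding analytic_functions_def by (auto simp: analytic_on_open intro!: continuous_intros)
qed

text \<open>Bounds the family whose supremum is the configuration constant, so that every ratio lies
  below that supremum.\<close>

lemma configuration_ratio_le_1:
  assumes "f \<in> analytic_functions \<Omega>"
  shows "boundary_quotient_norm \<Omega> (np_operator \<Omega> f) / boundary_quotient_norm \<Omega> f \<le> 1"
  using np_operator_contraction[OF analytic_imp_continuous_frontier[OF assms]]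
  by (cases "boundary_quotient_norm \<Omega> f = 0") (auto simp: divide_le_eq)

lemma configuration_ratio_le:
  assumes "f \<in> analytic_functions \<Omega>"
  shows "boundary_quotient_norm \<Omega> (np_operator \<Omega> f) / boundary_quotient_norm \<Omega> f \<le> analytic_configuration_constant \<Omega>"
  unfolding analytic_configuration_constant_def using assms
  by (intro cSUP_upper bdd_aboveI2[OF configuration_ratio_le_1])

lemma configuration_constant_nonneg: "0 \<le> analytic_configuration_constant \<Omega>"
proof -
  have "0 \<le> boundary_quotient_norm \<Omega> (np_operator \<Omega> (poly 0)) / boundary_quotient_norm \<Omega> (poly 0)"
    by (intro divide_nonneg_nonneg np_operator_contraction analytic_imp_continuous_frontier poly_analytic_function)
  then show ?thesis using configuration_ratio_le[OF poly_analytic_function[of 0]] by linarith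
qed

text \<open>The slack \<open>e\<close> replaces attainment of the infimum in the quotient norm. The
  bound on \<open>c\<close> follows because the transform itself has modulus at most 1.\<close>

lemma np_operator_near_constant:
  assumes f: "\<And>z. z \<in> \<Omega> \<Longrightarrow> cmod (poly f z) \<le> 1" and e: "0 < e"
  obtains c where "cmod c \<le> 1 + analytic_configuration_constant \<Omega> + e"
    "\<And>\<zeta>. \<zeta> \<in> frontier \<Omega> \<Longrightarrow> cmod (np_operator \<Omega> (poly f) \<zeta> - c) \<le> analytic_configuration_constant \<Omega> + e"
proof -
  let ?a = "analytic_configuration_constant \<Omega>"
  have cont: "continuous_on (frontier \<Omega>) (poly f)" by (intro continuous_intros)
  have f1: "cmod (poly f \<zeta> - 0) \<le> 1" if "\<zeta> \<in> frontier \<Omega>" for \<zeta> using f[of \<zeta>] that frontier_subset by auto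
  have K1: "cmod (np_operator \<Omega> (poly f) \<zeta> - 0) \<le> 1" if "\<zeta> \<in> frontier \<Omega>" for \<zeta>
    by (rule np_operator_bound[OF that cont f1])
  note con = np_operator_contraction[OF cont]
  have q1: "boundary_quotient_norm \<Omega> (poly f) \<le> 1" by (rule quotient_norm_least(2)[OF f1])
  have "boundary_quotient_norm \<Omega> (np_operator \<Omega> (poly f)) \<le> ?a"
  proof (cases "boundary_quotient_norm \<Omega> (poly f) = 0")
    case True
    then show ?thesis using con(3) configuration_constant_nonneg by linarith
  next
    case False
    then have "boundary_quotient_norm \<Omega> (np_operator \<Omega> (poly f)) \<le> ?a * boundary_quotient_norm \<Omega> (poly f)"
      using configuration_ratio_le[OF poly_analytic_function[of f]] con(1) by (simp add: divide_le_eq)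
    also have "\<dots> \<le> ?a * 1" by (rule mult_left_mono[OF q1 configuration_constant_nonneg])
    finally show ?thesis by simp
  qed
  then have "boundary_quotient_norm \<Omega> (np_operator \<Omega> (poly f)) < ?a + e" using e by linarith
  then obtain c where c: "\<And>\<zeta>. \<zeta> \<in> frontier \<Omega> \<Longrightarrow> cmod (np_operator \<Omega> (poly f) \<zeta> - c) \<le> ?a + e"
    using quotient_norm_least(3)[where g = "np_operator \<Omega> (poly f)" and c = 0 and B = 1 and b = "?a + e", OF K1]
    by blast
  obtain \<zeta> where z: "\<zeta> \<in> frontier \<Omega>" using frontier_nonempty by blast
  have "cmod c \<le> cmod (np_operator \<Omega> (poly f) \<zeta>) + cmod (np_operator \<Omega> (poly f) \<zeta> - c)"
    by (metis norm_minus_commute norm_triangle_sub)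
  then have "cmod c \<le> 1 + ?a + e" using c[OF z] K1[OF z] by simp
  then show thesis using c that by blast
qed

end

section \<open>Cauchy integrals over the boundary\<close>

context convex_curve
begin

lemma integrable_curve:
  fixes F :: "real \<Rightarrow> complex"
  assumes "F \<in> borel_measurable borel" "\<And>t. t \<in> {a..b} \<Longrightarrow> cmod (F t) \<le> B"
  shows "(\<lambda>t. F t * velocity t) integrable_on {a..b}"
proof (rule integrable_bounded_borel)
  show "(\<lambda>t. F t * velocity t) \<in> borel_measurable borel" using assms(1) by measurable
  fix t assume "t \<in> {a..b}"
  then have "cmod (F t) * cmod (velocity t) \<le> B * 1"
    using assms(2)[of t] norm_velocity_le[of t] by (intro mult_mono) (auto intro: order_trans[OF norm_ge_zero])
  then show "norm (F t * velocity t) \<le> B" by (simp add: norm_mult)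
qed

lemma poly_integral_zero: "((\<lambda>t. poly f (g t) * velocity t) has_integral 0) {0..L}"
proof -
  obtain h where h: "\<And>z. z \<in> UNIV \<Longrightarrow> (h has_field_derivative poly f z) (at z)"
  proof -
    have "poly f holomorphic_on UNIV" by (intro holomorphic_intros)
    then show thesis using that holomorphic_convex_primitive'[OF convex_UNIV open_UNIV] by metis
  qed
  show ?thesis using FTC_curve[of 0 L UNIV h "poly f"] h L_pos g_per[of 0] by simp
qed

text \<open>Division by the linear factor leaves a polynomial, whose integral over the closed curve
  vanishes, and a constant times the winding integral.\<close>

lemma Cauchy_poly:
  assumes z: "z \<in> interior \<Omega>"
  shows "((\<lambda>t. poly f (g t) * velocity t / (g t - z)) has_integral 2 * of_real pi * \<i> * poly f z) {0..L}"
proof -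
  have "poly (f - [:poly f z:]) z = 0" by simp
  then obtain q where q: "f - [:poly f z:] = [:- z, 1:] * q" using poly_eq_0_iff_dvd by (metis dvdE)
  have fq: "poly f w = (w - z) * poly q w + poly f z" for w
    using arg_cong[OF q, of "\<lambda>p. poly p w"] by (simp add: algebra_simps)
  have ne: "g t - z \<noteq> 0" for t using g_not_interior z by (metis eq_iff_diff_eq_0)
  have "((\<lambda>t. poly q (g t) * velocity t + poly f z * (velocity t / (g t - z))) has_integral
      0 + poly f z * (2 * of_real pi * \<i>)) {0..L}"
    by (intro has_integral_add poly_integral_zero has_integral_mult_right winding_integral[OF z])
  moreover have "poly q (g t) * velocity t + poly f z * (velocity t / (g t - z)) = poly f (g t) * velocity t / (g t - z)" for t
    unfolding fq[of "g t"] using ne[of t] by (simp add: field_simps)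
  ultimately show ?thesis by (simp add: mult.commute)
qed

text \<open>On \<open>\<Omega>\<close> this is the double layer potential of \<open>f\<close> minus \<open>f\<close>, written so that the integrand is bounded;
  on the boundary it is \<open>K f\<close>, in the interior the conjugate of the Cauchy transform of \<open>cnj f\<close>.\<close>

definition layer_potential :: "complex poly \<Rightarrow> complex \<Rightarrow> complex" where
  "layer_potential f z = poly f z + integral {0..L}
    (\<lambda>t. of_real (Im (velocity t / (g t - z))) * (poly f (g t) - poly f z)) / of_real pi"

text \<open>Dominated convergence: the integrand is bounded by the Lipschitz constant of
  \<open>f\<close>, uniformly in \<open>z\<close>, boundary points included.\<close>

lemma continuous_on_layer_potential: "continuous_on \<Omega> (layer_potential f)"
proof -
  obtain C where C: "0 \<le> C" "\<And>z w. z \<in> \<Omega> \<Longrightarrow> w \<in> \<Omega> \<Longrightarrow> cmod (poly f z - poly f w) \<le> C * cmod (z - w)"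
    by (rule poly_lipschitz) blast
  define k where "k z t = of_real (Im (velocity t / (g t - z))) * (poly f (g t) - poly f z)" for z t
  have k_le: "norm (k z t) \<le> C" if "z \<in> \<Omega>" for z t
    unfolding k_def by (rule density_difference_bound[OF C(2) that C(1)])
  have k_int: "k z integrable_on {0..L}" if "z \<in> \<Omega>" for z
  proof (rule integrable_bounded_borel[of _ _ _ C])
    have [measurable]: "poly f \<in> borel_measurable borel" by (intro borel_measurable_continuous_onI continuous_intros)
    show "k z \<in> borel_measurable borel" unfolding k_def by measurable
  qed (rule k_le[OF that])
  have "continuous_on \<Omega> (\<lambda>z. integral {0..L} (k z))"
    unfolding continuous_on_sequentially o_def
  proof (intro allI ballI impI, elim conjE)
    fix x w assume w: "w \<in> \<Omega>" and x: "\<forall>n. x n \<in> \<Omega>" and lim: "x \<longlonglongrightarrow> w"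
    \<comment> \<open>Pointwise convergence may fail where \<open>g t = w\<close>; there are
      finitely many such \<open>t\<close>, and the integrand is set to 0 at them.\<close>
    define k' where "k' z t = (if g t = w then 0 else k z t)" for z t
    have neg: "negligible {t \<in> {0..L}. g t = w}"
    proof -
      have "{t \<in> {0..L}. g t = w} \<subseteq> insert L {t \<in> {0..<L}. g t = w}" by auto
      moreover have "finite {t \<in> {0..<L}. g t = w}"
      proof (cases "\<exists>a\<in>{0..<L}. g a = w")
        case True
        then obtain a where "a \<in> {0..<L}" "g a = w" by blast
        then have "{t \<in> {0..<L}. g t = w} \<subseteq> {a}" using g_inj by auto
        then show ?thesis using finite_subset by blast
      next
        case False
        then have "{t \<in> {0..<L}. g t = w} = {}" by blast
        then show ?thesis by (simp only: finite.emptyI)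
      qed
      ultimately show ?thesis by (meson finite.insertI finite_subset negligible_finite)
    qed
    have eq: "integral {0..L} (k' z) = integral {0..L} (k z)" for z
      by (rule integral_spike[OF neg]) (auto simp: k'_def)
    have int': "k' z integrable_on {0..L}" if "z \<in> \<Omega>" for z
      by (rule integrable_spike[OF k_int[OF that] neg]) (auto simp: k'_def)
    have "(\<lambda>n. integral {0..L} (k' (x n))) \<longlonglongrightarrow> integral {0..L} (k' w)"
    proof (rule dominated_convergence(2)[where h = "\<lambda>_. C"])
      show "k' (x n) integrable_on {0..L}" for n using int' x by blast
      show "norm (k' (x n) t) \<le> C" for n t using k_le x C(1) by (auto simp: k'_def)
      fix t assume "t \<in> {0..L}"
      show "(\<lambda>n. k' (x n) t) \<longlonglongrightarrow> k' w t"
      proof (cases "g t = w")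
        case False
        then show ?thesis unfolding k'_def k_def
          by (simp, intro tendsto_intros lim) auto
      qed (simp add: k'_def)
    qed auto
    then show "(\<lambda>n. integral {0..L} (k (x n))) \<longlonglongrightarrow> integral {0..L} (k w)" by (simp add: eq)
  qed
  then show ?thesis unfolding layer_potential_def[abs_def] k_def[symmetric]
    by (intro continuous_intros) auto
qed

text \<open>With \<open>E = velocity / (g - z)\<close>, the identity
  \<open>2 * \<i> * Im E = E - cnj E\<close> writes the conjugate of the integrand as
  \<open>f * E\<close> minus \<open>2 * \<i> * f * Im E\<close>. The first part is Cauchy's formula;
  the second is the layer potential plus another copy of \<open>f z\<close>.\<close>

lemma layer_potential_interior:
  assumes z: "z \<in> interior \<Omega>"
  shows "((\<lambda>t. cnj (poly f (g t)) / (g t - z) * velocity t) has_integral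
    2 * of_real pi * \<i> * cnj (layer_potential f z)) {0..L}"
proof -
  define E where "E t = velocity t / (g t - z)" for t
  define F where "F t = poly f (g t) * E t" for t
  have F: "(F has_integral 2 * of_real pi * \<i> * poly f z) {0..L}"
    unfolding F_def E_def using Cauchy_poly[OF z, of f] by simp
  have W: "(E has_integral 2 * of_real pi * \<i>) {0..L}" unfolding E_def by (rule winding_integral[OF z])
  obtain C where C: "0 \<le> C" "\<And>z w. z \<in> \<Omega> \<Longrightarrow> w \<in> \<Omega> \<Longrightarrow> cmod (poly f z - poly f w) \<le> C * cmod (z - w)"
    by (rule poly_lipschitz) blast
  have z\<Omega>: "z \<in> \<Omega>" using z interior_subset by blast
  have [measurable]: "poly f \<in> borel_measurable borel" by (intro borel_measurable_continuous_onI continuous_intros)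
  have "(\<lambda>t. of_real (Im (E t)) * (poly f (g t) - poly f z)) integrable_on {0..L}"
  proof (rule integrable_bounded_borel[of _ _ _ C])
    show "(\<lambda>t. of_real (Im (E t)) * (poly f (g t) - poly f z)) \<in> borel_measurable borel"
      unfolding E_def by measurable
    show "norm (of_real (Im (E t)) * (poly f (g t) - poly f z)) \<le> C" for t
      unfolding E_def by (rule density_difference_bound[OF C(2) z\<Omega> C(1)])
  qed
  then obtain I where I: "((\<lambda>t. of_real (Im (E t)) * (poly f (g t) - poly f z)) has_integral I) {0..L}" by blast
  have lp: "layer_potential f z = poly f z + I / of_real pi"
    unfolding layer_potential_def E_def[symmetric] using integral_unique[OF I] by (simp add: integral_divide)
  have ImE: "((\<lambda>t. complex_of_real (Im (E t))) has_integral 2 * of_real pi) {0..L}"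
    using has_integral_of_real[OF has_integral_Im[OF W]] by simp
  have fI: "((\<lambda>t. of_real (Im (E t)) * (poly f (g t) - poly f z) + of_real (Im (E t)) * poly f z)
      has_integral I + 2 * of_real pi * poly f z) {0..L}"
    by (intro has_integral_add I has_integral_mult_left ImE)
  have "((\<lambda>t. F t - 2 * \<i> * (of_real (Im (E t)) * (poly f (g t) - poly f z) + of_real (Im (E t)) * poly f z))
      has_integral 2 * of_real pi * \<i> * poly f z - 2 * \<i> * (I + 2 * of_real pi * poly f z)) {0..L}"
    by (intro has_integral_diff F has_integral_mult_right fI)
  moreover have "F t - 2 * \<i> * (of_real (Im (E t)) * (poly f (g t) - poly f z) + of_real (Im (E t)) * poly f z)
      = cnj (cnj (poly f (g t)) * E t)" for t
  proof -
    have "2 * \<i> * of_real (Im (E t)) = E t - cnj (E t)" by (simp add: complex_diff_cnj)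
    then have "poly f (g t) * (2 * \<i> * of_real (Im (E t))) = poly f (g t) * (E t - cnj (E t))" by simp
    then show ?thesis by (simp add: F_def algebra_simps)
  qed
  ultimately have "((\<lambda>t. cnj (cnj (poly f (g t)) * E t)) has_integral - (2 * \<i> * of_real pi * layer_potential f z)) {0..L}"
    by (simp add: lp algebra_simps)
  from has_integral_linear[OF this bounded_linear_cnj]
  have "((\<lambda>t. cnj (poly f (g t)) * E t) has_integral 2 * of_real pi * \<i> * cnj (layer_potential f z)) {0..L}"
    by (simp add: o_def algebra_simps)
  then show ?thesis by (simp add: E_def)
qed

text \<open>The increments of \<open>g\<close> are the exact integrals of the velocity, so on a
  piece of length \<open>h\<close> only the variation of \<open>F\<close>, at most
  \<open>C * h\<close>, contributes: an error \<open>C * h\<^sup>2\<close> for each piece.\<close>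

lemma Riemann_sum:
  fixes F :: "real \<Rightarrow> complex"
  assumes lip: "\<And>t u. cmod (F t - F u) \<le> C * \<bar>t - u\<bar>" and N: "0 < N"
  defines "p \<equiv> \<lambda>j. L * real j / real N"
  shows "cmod (integral {0..L} (\<lambda>t. F t * velocity t) - (\<Sum>j<N. F (p j) * (g (p (Suc j)) - g (p j)))) \<le> C * L\<^sup>2 / real N"
proof -
  have C0: "0 \<le> C" using order_trans[OF norm_ge_zero lip[of 1 0]] by simp
  have contF: "continuous_on S F" for S
    by (rule lipschitz_on_continuous_on[of C]) (auto intro!: lipschitz_onI simp: lip dist_real_def dist_norm C0)
  have Fb: "F \<in> borel_measurable borel" by (rule borel_measurable_continuous_onI[OF contF])
  have int: "(\<lambda>t. F t * velocity t) integrable_on {a..b}" for a b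
  proof -
    have "bounded (F ` {a..b})" by (intro compact_imp_bounded compact_continuous_image contF) auto
    then obtain B where "\<forall>t\<in>{a..b}. cmod (F t) \<le> B" unfolding bounded_iff by auto
    then show ?thesis by (intro integrable_curve[OF Fb, of _ _ B]) blast
  qed
  define h where "h = L / real N"
  have h: "0 < h" "p (Suc j) - p j = h" "0 \<le> p j" for j
    using L_pos N by (auto simp: h_def p_def field_simps)
  have "cmod (integral {0..p n} (\<lambda>t. F t * velocity t) - (\<Sum>j<n. F (p j) * (g (p (Suc j)) - g (p j)))) \<le> real n * (C * h\<^sup>2)" for n
  proof (induction n)
    case 0
    then show ?case by (simp add: p_def)
  next
    case (Suc n)
    have pn: "p n \<le> p (Suc n)" using h(1) h(2)[of n] by linarith
    have comb: "integral {0..p n} (\<lambda>t. F t * velocity t) + integral {p n..p (Suc n)} (\<lambda>t. F t * velocity t)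
        = integral {0..p (Suc n)} (\<lambda>t. F t * velocity t)"
      using h(3)[of n] pn int by (intro Henstock_Kurzweil_Integration.integral_combine) auto
    have vel: "(velocity has_integral g (p (Suc n)) - g (p n)) {p n..p (Suc n)}"
      using FTC_curve[OF pn, of UNIV "\<lambda>z. z" "\<lambda>_. 1"] by simp
    have "((\<lambda>t. F t * velocity t - F (p n) * velocity t) has_integral
        integral {p n..p (Suc n)} (\<lambda>t. F t * velocity t) - F (p n) * (g (p (Suc n)) - g (p n))) {p n..p (Suc n)}"
      by (intro has_integral_diff integrable_integral int has_integral_mult_right vel)
    then have hi: "((\<lambda>t. F t * velocity t - F (p n) * velocity t) has_integral
        integral {p n..p (Suc n)} (\<lambda>t. F t * velocity t) - F (p n) * (g (p (Suc n)) - g (p n))) (cbox (p n) (p (Suc n)))"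
      by simp
    have "cmod (integral {p n..p (Suc n)} (\<lambda>t. F t * velocity t) - F (p n) * (g (p (Suc n)) - g (p n)))
        \<le> (C * h) * measure lborel (cbox (p n) (p (Suc n)))"
    proof (rule has_integral_bound[OF _ hi])
      fix t assume t: "t \<in> cbox (p n) (p (Suc n))"
      have "cmod (F t * velocity t - F (p n) * velocity t) = cmod (F t - F (p n)) * cmod (velocity t)"
        by (simp add: norm_mult[symmetric] left_diff_distrib)
      also have "\<dots> \<le> (C * \<bar>t - p n\<bar>) * 1" using lip norm_velocity_le C0 by (intro mult_mono) auto
      also have "\<dots> \<le> C * h" using t h(2)[of n] C0 by (auto intro!: mult_left_mono)
      finally show "cmod (F t * velocity t - F (p n) * velocity t) \<le> C * h" .
    qed (use C0 h in auto)
    also have "measure lborel (cbox (p n) (p (Suc n))) = h" using pn h(2)[of n] by simp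
    finally have step: "cmod (integral {p n..p (Suc n)} (\<lambda>t. F t * velocity t) - F (p n) * (g (p (Suc n)) - g (p n))) \<le> C * h\<^sup>2"
      by (simp add: power2_eq_square)
    have "cmod (integral {0..p (Suc n)} (\<lambda>t. F t * velocity t) - (\<Sum>j<Suc n. F (p j) * (g (p (Suc j)) - g (p j))))
      \<le> cmod (integral {0..p n} (\<lambda>t. F t * velocity t) - (\<Sum>j<n. F (p j) * (g (p (Suc j)) - g (p j))))
        + cmod (integral {p n..p (Suc n)} (\<lambda>t. F t * velocity t) - F (p n) * (g (p (Suc n)) - g (p n)))"
      unfolding comb[symmetric] by (rule order_trans[OF _ norm_triangle_ineq]) (simp add: algebra_simps)
    then show ?case using Suc step by (simp add: algebra_simps)
  qed
  from this[of N] show ?thesis using N by (simp add: p_def h_def power2_eq_square)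
qed

end

section \<open>Resolvents of operators with separated numerical range\<close>

lemma bounded_clinear_norm:
  assumes "bounded_clinear A"
  obtains M where "0 < M" "\<And>x. norm (A x) \<le> M * norm x"
  using bounded_linear.pos_bounded[OF bounded_clinearD(1)[OF assms]] by (metis mult.commute)

text \<open>In the expanded square the cross term gives \<open>- 2 * \<delta> / \<rho>\<close>, and
  the last term at most \<open>\<delta> / \<rho>\<close> because of
  \<open>M\<^sup>2 \<le> \<delta> * \<rho>\<close>. Used both for solving equations and for the
  geometric series that approximates the resolvent.\<close>

lemma coercive_contraction:
  fixes A :: "'h::complex_inner \<Rightarrow> 'h"
  assumes n: "cmod n = 1" and \<rho>: "0 < \<rho>"
    and coer: "\<delta> * (norm x)\<^sup>2 \<le> Re (cnj n * cinner (A x) x)"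
    and M: "norm (A x) \<le> M * norm x" "M\<^sup>2 \<le> \<delta> * \<rho>"
  shows "(norm (x - (cnj n / of_real \<rho>) *\<^sub>C A x))\<^sup>2 \<le> (1 - \<delta> / \<rho>) * (norm x)\<^sup>2"
proof -
  let ?c = "cnj n / of_real \<rho>"
  have c: "cmod ?c = 1 / \<rho>" using n \<rho> by (simp add: norm_divide)
  have e: "x - ?c *\<^sub>C A x = x + (- ?c) *\<^sub>C A x" by (simp add: scaleC_minus_left)
  have "Re (cinner x ((- ?c) *\<^sub>C A x)) = Re ((- ?c) * cinner (A x) x)"
    by (subst Re_cinner_commute) (simp add: cinner_scaleC_left)
  also have "(- ?c) * cinner (A x) x = - (cnj n * cinner (A x) x) / of_real \<rho>" by simp
  also have "Re \<dots> = - Re (cnj n * cinner (A x) x) / \<rho>" by (simp only: Re_divide_of_real uminus_complex.sel)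
  finally have re: "Re (cinner x ((- ?c) *\<^sub>C A x)) = - Re (cnj n * cinner (A x) x) / \<rho>" .
  have "(norm ((- ?c) *\<^sub>C A x))\<^sup>2 = (norm (A x))\<^sup>2 / \<rho>\<^sup>2"
    unfolding norm_scaleC norm_minus_cancel c by (simp add: power_divide power_mult_distrib)
  also have "\<dots> \<le> (\<delta> * \<rho> * (norm x)\<^sup>2) / \<rho>\<^sup>2"
  proof (rule divide_right_mono)
    have "(norm (A x))\<^sup>2 \<le> (M * norm x)\<^sup>2" using M(1) by (intro power_mono) auto
    also have "\<dots> \<le> \<delta> * \<rho> * (norm x)\<^sup>2" using M(2) by (simp add: power_mult_distrib mult_right_mono)
    finally show "(norm (A x))\<^sup>2 \<le> \<delta> * \<rho> * (norm x)\<^sup>2" .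
  qed simp
  also have "\<dots> = \<delta> / \<rho> * (norm x)\<^sup>2" using \<rho> by (simp add: power2_eq_square)
  finally have sq: "(norm ((- ?c) *\<^sub>C A x))\<^sup>2 \<le> \<delta> / \<rho> * (norm x)\<^sup>2" .
  define P where "P = Re (cnj n * cinner (A x) x) / \<rho>"
  have "\<delta> * (norm x)\<^sup>2 / \<rho> \<le> P" unfolding P_def using \<rho> by (intro divide_right_mono coer) auto
  then have P: "\<delta> / \<rho> * (norm x)\<^sup>2 \<le> P" by simp
  have re': "Re (cinner x ((- ?c) *\<^sub>C A x)) = - P" unfolding re P_def by (rule minus_divide_left[symmetric])
  have "(norm (x - ?c *\<^sub>C A x))\<^sup>2 = (norm x)\<^sup>2 + 2 * (- P) + (norm ((- ?c) *\<^sub>C A x))\<^sup>2"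
    unfolding e norm_add_sq re' ..
  then show ?thesis unfolding left_diff_distrib using sq P by linarith
qed

lemma coercive_norm_le:
  fixes A :: "'h::complex_inner \<Rightarrow> 'h"
  assumes n: "cmod n = 1" and coer: "\<delta> * (norm x)\<^sup>2 \<le> Re (cnj n * cinner (A x) x)"
  shows "\<delta> * norm x \<le> norm (A x)"
proof (cases "x = 0")
  case False
  have "\<delta> * (norm x)\<^sup>2 \<le> cmod (cnj n * cinner (A x) x)" using coer complex_Re_le_cmod order_trans by blast
  also have "\<dots> \<le> norm (A x) * norm x" using cinner_norm_le[of "A x" x] n by (simp add: norm_mult)
  finally show ?thesis using False by (simp add: power2_eq_square mult.assoc[symmetric])
qed simp

text \<open>The inverse of a coercive operator is the fixed point of a contraction (Lax--Milgram).\<close>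

lemma coercive_bijective:
  fixes A :: "'h::chilbert_space \<Rightarrow> 'h"
  assumes A: "bounded_clinear A" and n: "cmod n = 1" and \<delta>: "0 < \<delta>"
    and coer: "\<And>x. \<delta> * (norm x)\<^sup>2 \<le> Re (cnj n * cinner (A x) x)"
  shows "\<exists>!x. A x = y"
proof -
  obtain M where M: "0 < M" "\<And>x. norm (A x) \<le> M * norm x" by (rule bounded_clinear_norm[OF A]) blast
  \<comment> \<open>The first summand gives \<open>M\<^sup>2 \<le> \<delta> * \<rho>\<close>; the
    second makes \<open>\<rho> \<ge> \<delta>\<close>, so that the square root below is
    real.\<close>
  define \<rho> where "\<rho> = M\<^sup>2 / \<delta> + \<delta>"
  have \<rho>: "0 < \<rho>" "M\<^sup>2 \<le> \<delta> * \<rho>" "\<delta> \<le> \<rho>"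
    using \<delta> M(1) by (auto simp: \<rho>_def add_pos_pos algebra_simps divide_simps)
  define c where "c = cnj n / of_real \<rho>"
  have c0: "c \<noteq> 0" using n \<rho> by (auto simp: c_def)
  define \<kappa> where "\<kappa> = sqrt (1 - \<delta> / \<rho>)"
  have \<kappa>: "0 \<le> \<kappa>" "\<kappa> < 1" using \<rho> \<delta> by (auto simp: \<kappa>_def)
  have step: "norm (x - c *\<^sub>C A x) \<le> \<kappa> * norm x" for x
  proof (rule power2_le_imp_le)
    have "(norm (x - c *\<^sub>C A x))\<^sup>2 \<le> (1 - \<delta> / \<rho>) * (norm x)\<^sup>2"
      unfolding c_def by (rule coercive_contraction[where M = M, OF n \<rho>(1) coer M(2) \<rho>(2)])
    also have "1 - \<delta> / \<rho> = \<kappa>\<^sup>2" using \<rho> by (simp add: \<kappa>_def)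
    finally show "(norm (x - c *\<^sub>C A x))\<^sup>2 \<le> (\<kappa> * norm x)\<^sup>2" by (simp add: power_mult_distrib)
  qed (use \<kappa> in simp)
  have "\<exists>!x\<in>UNIV. (x - c *\<^sub>C A x) + c *\<^sub>C y = x"
  proof (rule Banach_fix)
    show "complete (UNIV :: 'h set)" by (rule complete_UNIV)
    show "dist ((x - c *\<^sub>C A x) + c *\<^sub>C y) ((w - c *\<^sub>C A w) + c *\<^sub>C y) \<le> \<kappa> * dist x w" for x w
    proof -
      have eq: "(x - c *\<^sub>C A x) + c *\<^sub>C y - ((w - c *\<^sub>C A w) + c *\<^sub>C y) = (x - w) - c *\<^sub>C A (x - w)"
        by (simp add: bounded_clinearD[OF A] scaleC_diff_right)
      show ?thesis unfolding dist_norm eq by (rule step)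
    qed
  qed (use \<kappa> in auto)
  moreover have "(x - c *\<^sub>C A x) + c *\<^sub>C y = x \<longleftrightarrow> A x = y" for x
  proof -
    have "(x - c *\<^sub>C A x) + c *\<^sub>C y = x \<longleftrightarrow> c *\<^sub>C (y - A x) = 0" by (simp add: scaleC_diff_right algebra_simps)
    also have "\<dots> \<longleftrightarrow> y - A x = 0" using c0 by (metis norm_scaleC mult_eq_0_iff norm_eq_zero)
    finally show ?thesis by auto
  qed
  ultimately show ?thesis by auto
qed

section \<open>Gaps to the supporting lines, and resolvents at boundary points\<close>

context convex_body
begin

text \<open>\<open>\<delta>\<close> bounds from below the distance of the numerical range of \<open>S\<close> to every supporting line.\<close>

definition separated :: "('h::chilbert_space \<Rightarrow> 'h) \<Rightarrow> real \<Rightarrow> bool" where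
  "separated S \<delta> \<longleftrightarrow> bounded_clinear S \<and>
    (\<forall>\<sigma> n x. unit_normal \<sigma> n \<longrightarrow> \<delta> * (norm x)\<^sup>2 \<le> Re (cnj n * cinner (\<sigma> *\<^sub>C x - S x) x))"

text \<open>The scalar analogue of \<open>separated\<close>: with the same gap, one polynomial
  approximates the resolvent of the operator and the Cauchy kernel at these points.\<close>

definition core :: "real \<Rightarrow> complex set" where
  "core \<delta> = {z \<in> \<Omega>. \<forall>\<sigma> n. unit_normal \<sigma> n \<longrightarrow> \<delta> \<le> Re (cnj n * (\<sigma> - z))}"

definition dilate :: "real \<Rightarrow> ('h::chilbert_space \<Rightarrow> 'h) \<Rightarrow> 'h \<Rightarrow> 'h" where
  "dilate s S x = (of_real (1 - s) * z0) *\<^sub>C x + of_real s *\<^sub>C S x"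

definition resolvent :: "('h::chilbert_space \<Rightarrow> 'h) \<Rightarrow> complex \<Rightarrow> 'h \<Rightarrow> 'h" where
  "resolvent S \<sigma> y = (THE x. \<sigma> *\<^sub>C x - S x = y)"

lemma separatedD:
  assumes "separated S \<delta>"
  shows "bounded_clinear S" "unit_normal \<sigma> n \<Longrightarrow> \<delta> * (norm x)\<^sup>2 \<le> Re (cnj n * cinner (\<sigma> *\<^sub>C x - S x) x)"
  using assms unfolding separated_def by blast+

lemma separated_mono: "separated S \<delta> \<Longrightarrow> \<delta>' \<le> \<delta> \<Longrightarrow> separated S \<delta>'"
  unfolding separated_def by (meson mult_right_mono order_trans zero_le_power2)

lemma separated_numerical_range:
  assumes T: "bounded_clinear T" and W: "numerical_range T \<subseteq> \<Omega>"
  shows "separated T 0"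
  unfolding separated_def
proof (intro conjI allI impI T)
  fix \<sigma> n x assume n: "unit_normal \<sigma> n"
  show "0 * (norm x)\<^sup>2 \<le> Re (cnj n * cinner (\<sigma> *\<^sub>C x - T x) x)"
  proof (cases "x = 0")
    case False
    define w where "w = cinner (T x) x / of_real ((norm x)\<^sup>2)"
    have "w \<in> \<Omega>" using cinner_in_numerical_range[OF T False] W by (auto simp: w_def)
    then have "Re (cnj n * (w - \<sigma>)) \<le> 0" by (rule unit_normalD(2)[OF n])
    then have "0 \<le> (norm x)\<^sup>2 * - Re (cnj n * (w - \<sigma>))" by (intro mult_nonneg_nonneg) auto
    also have "\<dots> = Re (of_real ((norm x)\<^sup>2) * (cnj n * (\<sigma> - w)))" by (simp add: algebra_simps)
    also have "of_real ((norm x)\<^sup>2) * (cnj n * (\<sigma> - w)) = cnj n * cinner (\<sigma> *\<^sub>C x - T x) x"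
      using False by (simp add: w_def cinner_diff_left cinner_scaleC_left cinner_self field_simps)
    finally show ?thesis by simp
  qed simp
qed

text \<open>The gap is affine in the operator, and the scalar operator \<open>z0\<close> has gap at
  least \<open>r\<close>. Even a gap 0 thus becomes positive for \<open>s < 1\<close>.\<close>

lemma separated_dilate:
  assumes S: "separated S \<delta>" and s: "0 \<le> s" "s \<le> 1"
    and r: "\<And>\<zeta> n. unit_normal \<zeta> n \<Longrightarrow> r \<le> Re (cnj n * (\<zeta> - z0))"
  shows "separated (dilate s S) ((1 - s) * r + s * \<delta>)"
  unfolding separated_def
proof (intro conjI allI impI)
  show "bounded_clinear (dilate s S)"
    unfolding dilate_def[abs_def] by (rule bounded_clinear_affine[OF separatedD(1)[OF S]])
  fix \<sigma> n x assume n: "unit_normal \<sigma> n"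
  have "\<sigma> *\<^sub>C x - dilate s S x = of_real (1 - s) *\<^sub>C ((\<sigma> - z0) *\<^sub>C x) + of_real s *\<^sub>C (\<sigma> *\<^sub>C x - S x)"
    by (simp add: dilate_def scaleC_diff_right scaleC_scaleC scaleC_diff_left algebra_simps)
  then have ce: "cinner (\<sigma> *\<^sub>C x - dilate s S x) x
      = of_real (1 - s) * ((\<sigma> - z0) * cinner x x) + of_real s * cinner (\<sigma> *\<^sub>C x - S x) x"
    by (simp only: cinner_add_left cinner_scaleC_left)
  have "cnj n * cinner (\<sigma> *\<^sub>C x - dilate s S x) x
      = of_real ((1 - s) * (norm x)\<^sup>2) * (cnj n * (\<sigma> - z0)) + of_real s * (cnj n * cinner (\<sigma> *\<^sub>C x - S x) x)"
    unfolding ce by (simp add: cinner_self algebra_simps)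
  then have "Re (cnj n * cinner (\<sigma> *\<^sub>C x - dilate s S x) x)
      = (1 - s) * (norm x)\<^sup>2 * Re (cnj n * (\<sigma> - z0)) + s * Re (cnj n * cinner (\<sigma> *\<^sub>C x - S x) x)"
  proof -
    have "Re (of_real k * v + of_real l * w) = k * Re v + l * Re w" for k l v w by simp
    then show ?thesis using \<open>cnj n * cinner (\<sigma> *\<^sub>C x - dilate s S x) x = _\<close> by metis
  qed
  moreover have "(1 - s) * (norm x)\<^sup>2 * r \<le> (1 - s) * (norm x)\<^sup>2 * Re (cnj n * (\<sigma> - z0))"
    using r[OF n] s by (intro mult_left_mono) auto
  moreover have "s * (\<delta> * (norm x)\<^sup>2) \<le> s * Re (cnj n * cinner (\<sigma> *\<^sub>C x - S x) x)"
    using separatedD(2)[OF S n] s by (intro mult_left_mono) auto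
  ultimately show "((1 - s) * r + s * \<delta>) * (norm x)\<^sup>2 \<le> Re (cnj n * cinner (\<sigma> *\<^sub>C x - dilate s S x) x)"
    by (simp add: algebra_simps)
qed

lemma core_dilate:
  assumes z: "z \<in> \<Omega>" and s: "0 \<le> s" "s \<le> 1"
    and r: "\<And>\<zeta> n. unit_normal \<zeta> n \<Longrightarrow> r \<le> Re (cnj n * (\<zeta> - z0))"
  shows "of_real (1 - s) * z0 + of_real s * z \<in> core ((1 - s) * r)"
  unfolding core_def
proof (intro CollectI conjI allI impI)
  have "(1 - s) *\<^sub>R z0 + s *\<^sub>R z \<in> \<Omega>"
    using z z0 s interior_subset by (intro convexD[OF convex]) auto
  then show "of_real (1 - s) * z0 + of_real s * z \<in> \<Omega>" by (simp add: scaleR_conv_of_real)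
  fix \<sigma> n assume n: "unit_normal \<sigma> n"
  have "cnj n * (\<sigma> - (of_real (1 - s) * z0 + of_real s * z))
      = of_real (1 - s) * (cnj n * (\<sigma> - z0)) - of_real s * (cnj n * (z - \<sigma>))"
    by (simp add: algebra_simps)
  moreover have "Re (of_real k * v - of_real l * w) = k * Re v - l * Re w" for k l v w by simp
  ultimately have "Re (cnj n * (\<sigma> - (of_real (1 - s) * z0 + of_real s * z)))
      = (1 - s) * Re (cnj n * (\<sigma> - z0)) - s * Re (cnj n * (z - \<sigma>))" by metis
  moreover have "(1 - s) * r \<le> (1 - s) * Re (cnj n * (\<sigma> - z0))" using r[OF n] s by (intro mult_left_mono) auto
  moreover have "s * Re (cnj n * (z - \<sigma>)) \<le> 0" using unit_normalD(2)[OF n z] s by (simp add: mult_nonneg_nonpos del: times_complex.sel)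
  ultimately show "(1 - s) * r \<le> Re (cnj n * (\<sigma> - (of_real (1 - s) * z0 + of_real s * z)))" by linarith
qed

context
  fixes S :: "'h::chilbert_space \<Rightarrow> 'h" and \<delta> :: real
  assumes S: "separated S \<delta>" and \<delta>: "0 < \<delta>"
begin

lemma shift_clinear: "bounded_clinear (\<lambda>x. \<sigma> *\<^sub>C x - S x)"
  using bounded_clinear_affine[OF separatedD(1)[OF S], of \<sigma> "- 1"] by (simp add: scaleC_minus_left scaleC_one)

lemma resolvent_unique: "\<sigma> \<in> frontier \<Omega> \<Longrightarrow> \<exists>!x. \<sigma> *\<^sub>C x - S x = y"
proof -
  assume "\<sigma> \<in> frontier \<Omega>"
  then obtain n where n: "unit_normal \<sigma> n" using unit_normal_exists by blast
  show ?thesis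
    by (rule coercive_bijective[OF shift_clinear unit_normalD(1)[OF n] \<delta> separatedD(2)[OF S n]])
qed

lemma resolvent_right: "\<sigma> \<in> frontier \<Omega> \<Longrightarrow> \<sigma> *\<^sub>C resolvent S \<sigma> y - S (resolvent S \<sigma> y) = y"
  unfolding resolvent_def by (rule theI'[OF resolvent_unique])

lemma resolvent_left: "\<sigma> \<in> frontier \<Omega> \<Longrightarrow> resolvent S \<sigma> (\<sigma> *\<^sub>C x - S x) = x"
  unfolding resolvent_def by (rule the1_equality[OF resolvent_unique]) auto

lemma resolvent_norm: "\<sigma> \<in> frontier \<Omega> \<Longrightarrow> norm (resolvent S \<sigma> y) \<le> norm y / \<delta>"
proof -
  assume \<sigma>: "\<sigma> \<in> frontier \<Omega>"
  then obtain n where n: "unit_normal \<sigma> n" using unit_normal_exists by blast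
  have "\<delta> * norm (resolvent S \<sigma> y) \<le> norm (\<sigma> *\<^sub>C resolvent S \<sigma> y - S (resolvent S \<sigma> y))"
    by (rule coercive_norm_le[OF unit_normalD(1)[OF n] separatedD(2)[OF S n]])
  then show ?thesis using \<delta> by (simp add: resolvent_right[OF \<sigma>] field_simps)
qed

lemma resolvent_add: "\<sigma> \<in> frontier \<Omega> \<Longrightarrow> resolvent S \<sigma> (x + y) = resolvent S \<sigma> x + resolvent S \<sigma> y"
proof -
  assume \<sigma>: "\<sigma> \<in> frontier \<Omega>"
  have "x + y = \<sigma> *\<^sub>C (resolvent S \<sigma> x + resolvent S \<sigma> y) - S (resolvent S \<sigma> x + resolvent S \<sigma> y)"
    using resolvent_right[OF \<sigma>, of x] resolvent_right[OF \<sigma>, of y]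
    by (simp add: bounded_clinearD[OF separatedD(1)[OF S]] scaleC_add_right algebra_simps) 
  then show ?thesis using resolvent_left[OF \<sigma>] by metis
qed

lemma resolvent_scale: "\<sigma> \<in> frontier \<Omega> \<Longrightarrow> resolvent S \<sigma> (c *\<^sub>C x) = c *\<^sub>C resolvent S \<sigma> x"
proof -
  assume \<sigma>: "\<sigma> \<in> frontier \<Omega>"
  have "c *\<^sub>C x = c *\<^sub>C (\<sigma> *\<^sub>C resolvent S \<sigma> x - S (resolvent S \<sigma> x))" by (simp add: resolvent_right[OF \<sigma>])
  also have "\<dots> = \<sigma> *\<^sub>C (c *\<^sub>C resolvent S \<sigma> x) - S (c *\<^sub>C resolvent S \<sigma> x)"
    by (simp add: bounded_clinearD[OF separatedD(1)[OF S]] scaleC_diff_right scaleC_scaleC mult.commute)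
  finally show ?thesis using resolvent_left[OF \<sigma>] by metis
qed

lemma resolvent_identity:
  assumes "\<sigma> \<in> frontier \<Omega>" "\<tau> \<in> frontier \<Omega>"
  shows "resolvent S \<sigma> y - resolvent S \<tau> y = (\<tau> - \<sigma>) *\<^sub>C resolvent S \<sigma> (resolvent S \<tau> y)"
proof -
  have "\<sigma> *\<^sub>C resolvent S \<tau> y - S (resolvent S \<tau> y) = (\<sigma> - \<tau>) *\<^sub>C resolvent S \<tau> y + y"
    using resolvent_right[OF assms(2), of y] by (simp add: scaleC_diff_left algebra_simps)
  then have "resolvent S \<tau> y = (\<sigma> - \<tau>) *\<^sub>C resolvent S \<sigma> (resolvent S \<tau> y) + resolvent S \<sigma> y"
    by (metis resolvent_left[OF assms(1)] resolvent_add[OF assms(1)] resolvent_scale[OF assms(1)])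
  then have "resolvent S \<sigma> y - resolvent S \<tau> y = - ((\<sigma> - \<tau>) *\<^sub>C resolvent S \<sigma> (resolvent S \<tau> y))"
    by (simp add: algebra_simps)
  then show ?thesis by (simp add: scaleC_minus_left[symmetric])
qed

lemma resolvent_form_le:
  assumes "\<sigma> \<in> frontier \<Omega>"
  shows "cmod (cinner (resolvent S \<sigma> x) y) \<le> norm x * norm y / \<delta>"
proof -
  have "cmod (cinner (resolvent S \<sigma> x) y) \<le> norm (resolvent S \<sigma> x) * norm y" by (rule cinner_norm_le)
  also have "\<dots> \<le> norm x / \<delta> * norm y" using resolvent_norm[OF assms] by (intro mult_right_mono) auto
  finally show ?thesis by simp
qed

lemma resolvent_lipschitz:
  assumes "\<sigma> \<in> frontier \<Omega>" "\<tau> \<in> frontier \<Omega>"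
  shows "norm (resolvent S \<sigma> x - resolvent S \<tau> x) \<le> cmod (\<sigma> - \<tau>) * norm x / \<delta>\<^sup>2"
proof -
  have "norm (resolvent S \<sigma> (resolvent S \<tau> x)) \<le> norm x / \<delta> / \<delta>"
    using resolvent_norm[OF assms(1), of "resolvent S \<tau> x"] divide_right_mono[OF resolvent_norm[OF assms(2), of x], of \<delta>] \<delta>
    by linarith
  then have "cmod (\<tau> - \<sigma>) * norm (resolvent S \<sigma> (resolvent S \<tau> x)) \<le> cmod (\<tau> - \<sigma>) * (norm x / \<delta> / \<delta>)"
    by (intro mult_left_mono) auto
  then show ?thesis
    by (simp add: resolvent_identity[OF assms] norm_minus_commute power2_eq_square)
qed

text \<open>Partial sums of the Neumann series about a far away centre on the inner normal converge both for the
  operator and on the core.\<close>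

lemma resolvent_polynomial:
  assumes \<sigma>: "\<sigma> \<in> frontier \<Omega>" and e: "0 < e"
  obtains p where "\<And>y. norm (poly_operator p S y - resolvent S \<sigma> y) \<le> e * norm y"
    "\<And>z. z \<in> core \<delta> \<Longrightarrow> cmod (poly p z - 1 / (\<sigma> - z)) \<le> e"
proof -
  obtain n where n: "unit_normal \<sigma> n" using unit_normal_exists[OF \<sigma>] .
  note n1 = unit_normalD(1)[OF n]
  define A where "A x = \<sigma> *\<^sub>C x - S x" for x
  have A: "bounded_clinear A" unfolding A_def[abs_def] by (rule shift_clinear)
  note Sl = separatedD(1)[OF S]
  obtain M1 where M1: "0 < M1" "\<And>x. norm (A x) \<le> M1 * norm x" by (rule bounded_clinear_norm[OF A]) blast
  have "bounded ((\<lambda>z. \<sigma> - z) ` \<Omega>)"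
    by (intro compact_imp_bounded compact_continuous_image compact continuous_intros)
  then obtain M2 where M2: "\<And>z. z \<in> \<Omega> \<Longrightarrow> cmod (\<sigma> - z) \<le> M2" unfolding bounded_iff by auto
  define M where "M = max M1 M2"
  have M: "0 < M" "\<And>x. norm (A x) \<le> M * norm x" "\<And>z. z \<in> \<Omega> \<Longrightarrow> cmod (\<sigma> - z) \<le> M"
  proof -
    show "0 < M" using M1(1) by (simp add: M_def less_max_iff_disj)
    show "norm (A x) \<le> M * norm x" for x
      by (rule order_trans[OF M1(2) mult_right_mono]) (auto simp: M_def)
    show "cmod (\<sigma> - z) \<le> M" if "z \<in> \<Omega>" for z using M2[OF that] by (simp add: M_def le_max_iff_disj)
  qed
  define \<rho> where "\<rho> = M\<^sup>2 / \<delta> + \<delta>"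
  have \<rho>: "0 < \<rho>" "M\<^sup>2 \<le> \<delta> * \<rho>" "\<delta> \<le> \<rho>"
    using \<delta> M(1) by (auto simp: \<rho>_def add_pos_pos algebra_simps divide_simps)
  define c where "c = cnj n / of_real \<rho>"
  define \<kappa> where "\<kappa> = sqrt (1 - \<delta> / \<rho>)"
  have \<kappa>: "0 \<le> \<kappa>" "\<kappa> < 1" "1 - \<delta> / \<rho> = \<kappa>\<^sup>2" using \<rho> \<delta> by (auto simp: \<kappa>_def)
  \<comment> \<open>The factor \<open>1 - c * (\<sigma> - z)\<close> is a contraction both at the
    operator and on the core; \<open>c\<close> times its geometric series sums to
    \<open>1 / (\<sigma> - z)\<close>.\<close>
  define X where "X = [:1 - c * \<sigma>, c:]"
  have Xop: "poly_operator X S x = x - c *\<^sub>C A x" for x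
    by (simp add: X_def poly_operator_pCons[OF Sl] A_def scaleC_diff_left scaleC_diff_right scaleC_scaleC
        scaleC_one bounded_clinearD[OF Sl])
  have Xz: "poly X z = 1 - c * (\<sigma> - z)" for z by (simp add: X_def algebra_simps)
  have Xop_le: "norm (poly_operator X S x) \<le> \<kappa> * norm x" for x
  proof (rule power2_le_imp_le)
    have "\<delta> * (norm x)\<^sup>2 \<le> Re (cnj n * cinner (A x) x)" unfolding A_def by (rule separatedD(2)[OF S n])
    from coercive_contraction[where M = M and A = A and x = x and \<delta> = \<delta>, OF n1 \<rho>(1) this M(2) \<rho>(2)]
    show "(norm (poly_operator X S x))\<^sup>2 \<le> (\<kappa> * norm x)\<^sup>2"
      by (simp add: Xop c_def \<kappa>(3) power_mult_distrib)
  qed (use \<kappa> in simp)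
  have Xz_le: "cmod (poly X z) \<le> \<kappa>" if z: "z \<in> core \<delta>" for z
  proof (rule power2_le_imp_le)
    have z': "z \<in> \<Omega>" "\<delta> \<le> Re (cnj n * (\<sigma> - z))" using z n by (auto simp: core_def)
    have "(cmod (1 - c * (\<sigma> - z)))\<^sup>2 = 1 - 2 * Re (c * (\<sigma> - z)) + (cmod (c * (\<sigma> - z)))\<^sup>2"
      unfolding cmod_power2 by (simp add: power2_eq_square algebra_simps)
    also have "Re (c * (\<sigma> - z)) = Re (cnj n * (\<sigma> - z)) / \<rho>"
    proof -
      have "c * (\<sigma> - z) = cnj n * (\<sigma> - z) / of_real \<rho>" by (simp add: c_def)
      then show ?thesis by (simp only: Re_divide_of_real)
    qed
    also have "(cmod (c * (\<sigma> - z)))\<^sup>2 = (cmod (\<sigma> - z))\<^sup>2 / \<rho>\<^sup>2"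
      using n1 \<rho> by (simp add: c_def norm_mult norm_divide power_divide power_mult_distrib)
    also have "1 - 2 * (Re (cnj n * (\<sigma> - z)) / \<rho>) + (cmod (\<sigma> - z))\<^sup>2 / \<rho>\<^sup>2 \<le> 1 - 2 * (\<delta> / \<rho>) + \<delta> * \<rho> / \<rho>\<^sup>2"
    proof -
      have "(cmod (\<sigma> - z))\<^sup>2 \<le> M\<^sup>2" using M(3)[OF z'(1)] by (intro power_mono) auto
      then have "(cmod (\<sigma> - z))\<^sup>2 / \<rho>\<^sup>2 \<le> \<delta> * \<rho> / \<rho>\<^sup>2" using \<rho>(2) by (intro divide_right_mono) auto
      moreover have "\<delta> / \<rho> \<le> Re (cnj n * (\<sigma> - z)) / \<rho>" using z'(2) \<rho>(1) by (intro divide_right_mono) auto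
      ultimately show ?thesis by linarith
    qed
    also have "\<dots> = \<kappa>\<^sup>2" unfolding \<kappa>(3)[symmetric] using \<rho>(1) by (simp add: power2_eq_square)
    finally show "(cmod (poly X z))\<^sup>2 \<le> \<kappa>\<^sup>2" unfolding Xz .
  qed (rule \<kappa>(1))
  have Xpow: "norm (poly_operator (X ^ k) S x) \<le> \<kappa> ^ k * norm x" for k x
  proof (induction k)
    case 0
    then show ?case using poly_operator_const[OF Sl, of 1 x] by (simp add: scaleC_one flip: one_pCons)
  next
    case (Suc k)
    have "norm (poly_operator (X ^ Suc k) S x) \<le> \<kappa> * norm (poly_operator (X ^ k) S x)"
      using Xop_le by (simp add: poly_operator_mult[OF Sl])
    also have "\<dots> \<le> \<kappa> * (\<kappa> ^ k * norm x)" by (rule mult_left_mono[OF Suc \<kappa>(1)])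
    finally show ?case by simp
  qed
  have "(\<lambda>k. \<kappa> ^ k) \<longlonglongrightarrow> 0" using \<kappa> by (intro LIMSEQ_power_zero) auto
  \<comment> \<open>After \<open>k\<close> terms both remainders are at most
    \<open>\<kappa> ^ k / \<delta>\<close>.\<close>
  then have "\<forall>\<^sub>F k in sequentially. \<kappa> ^ k < e * \<delta>" using e \<delta> by (intro order_tendstoD) auto
  then obtain k where k: "\<kappa> ^ k < e * \<delta>" by (auto simp: eventually_sequentially)
  define p where "p = smult c (\<Sum>i<k. X ^ i)"
  have geo: "p * [:\<sigma>, - 1:] = 1 - X ^ k"
  proof -
    have "smult c [:\<sigma>, - 1:] = 1 - X" by (simp add: X_def one_pCons)
    then have "(1 - X) * (\<Sum>i<k. X ^ i) = smult c ([:\<sigma>, - 1:] * (\<Sum>i<k. X ^ i))"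
      by (simp only: mult_smult_left[symmetric])
    then have "p * [:\<sigma>, - 1:] = (1 - X) * (\<Sum>i<k. X ^ i)"
      by (simp only: p_def mult_smult_left mult.commute[of "[:\<sigma>, - 1:]"])
    then show ?thesis by (simp add: one_diff_power_eq)
  qed
  show thesis
  proof (rule that)
    fix y
    define x where "x = resolvent S \<sigma> y"
    have Ax: "poly_operator [:\<sigma>, - 1:] S x = y"
      using resolvent_right[OF \<sigma>, of y]
      by (simp add: x_def poly_operator_pCons[OF Sl] scaleC_minus_left scaleC_one bounded_clinearD[OF Sl] scaleC_minus_right
          linear_neg[OF bounded_linear.linear[OF bounded_clinearD(1)[OF Sl]]])
    have "poly_operator p S y = poly_operator (1 - X ^ k) S x"
      unfolding geo[symmetric] poly_operator_mult[OF Sl] Ax ..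
    also have "\<dots> = x - poly_operator (X ^ k) S x"
      using poly_operator_const[OF Sl, of 1 x] by (simp add: poly_operator_diff[OF Sl] scaleC_one flip: one_pCons)
    finally have "norm (poly_operator p S y - x) = norm (poly_operator (X ^ k) S x)" by simp
    also have "\<dots> \<le> \<kappa> ^ k * norm x" by (rule Xpow)
    also have "\<dots> \<le> (e * \<delta>) * (norm y / \<delta>)"
      using k resolvent_norm[OF \<sigma>, of y] \<kappa>(1) e \<delta> by (intro mult_mono) (auto simp: x_def)
    finally show "norm (poly_operator p S y - resolvent S \<sigma> y) \<le> e * norm y" using \<delta> by (simp add: x_def)
  next
    fix z assume z: "z \<in> core \<delta>"
    have d: "\<delta> \<le> cmod (\<sigma> - z)"
    proof -
      have "\<delta> \<le> Re (cnj n * (\<sigma> - z))" using z n by (auto simp: core_def)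
      also have "\<dots> \<le> cmod (cnj n * (\<sigma> - z))" by (rule complex_Re_le_cmod)
      finally show ?thesis by (simp add: norm_mult n1)
    qed
    then have ne: "\<sigma> - z \<noteq> 0" using \<delta> by auto
    have "poly p z * (\<sigma> - z) = 1 - poly X z ^ k"
    proof -
      have "poly p z * poly [:\<sigma>, - 1:] z = 1 - poly X z ^ k"
        unfolding poly_mult[symmetric] geo by (simp add: poly_power)
      then show ?thesis by simp
    qed
    then have "poly p z = (1 - poly X z ^ k) / (\<sigma> - z)" using ne by (simp add: eq_divide_eq)
    then have "poly p z - 1 / (\<sigma> - z) = - (poly X z ^ k) / (\<sigma> - z)"
      by (simp add: diff_divide_distrib)
    then have "cmod (poly p z - 1 / (\<sigma> - z)) = cmod (poly X z) ^ k / cmod (\<sigma> - z)"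
      by (simp add: norm_divide norm_power)
    also have "\<dots> \<le> \<kappa> ^ k / \<delta>"
      using Xz_le[OF z] d \<delta> \<kappa>(1) by (intro frac_le power_mono) auto
    also have "\<dots> \<le> e" using k \<delta> by (simp add: divide_le_eq)
    finally show "cmod (poly p z - 1 / (\<sigma> - z)) \<le> e" .
  qed
qed

end

end

section \<open>The functional calculus as a boundary integral\<close>

text \<open>Derivatives of resolvent expressions are found by subtracting the expected linear term
  and estimating the remainder quadratically.\<close>

lemma has_vector_derivative_quadratic:
  fixes E :: "real \<Rightarrow> complex"
  assumes "\<And>u. u \<in> T \<Longrightarrow> cmod (E u - E t) \<le> C * (u - t)\<^sup>2"
  shows "(E has_vector_derivative 0) (at t within T)"
  unfolding has_vector_derivative_def has_derivative_within_alt
proof (intro conjI allI impI)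
  fix e :: real assume e: "0 < e"
  show "\<exists>d>0. \<forall>y\<in>T. norm (y - t) < d \<longrightarrow> norm (E y - E t - (y - t) *\<^sub>R 0) \<le> e * norm (y - t)"
  proof (intro exI[of _ "e / (\<bar>C\<bar> + 1)"] conjI ballI impI)
    fix y assume y: "y \<in> T" "norm (y - t) < e / (\<bar>C\<bar> + 1)"
    have "C * (y - t)\<^sup>2 \<le> (\<bar>C\<bar> + 1) * (y - t)\<^sup>2" by (intro mult_right_mono) auto
    also have "\<dots> = ((\<bar>C\<bar> + 1) * \<bar>y - t\<bar>) * \<bar>y - t\<bar>" by (simp add: power2_eq_square)
    also have "\<dots> \<le> e * \<bar>y - t\<bar>" using y(2) by (intro mult_right_mono) (auto simp: field_simps)
    finally show "norm (E y - E t - (y - t) *\<^sub>R 0) \<le> e * norm (y - t)" using assms[OF y(1)] by simp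
  qed (use e in auto)
qed (simp add: bounded_linear_zero)

context convex_curve
begin

lemma integrable_lipschitz:
  assumes lip: "\<And>t u. cmod (F t - F u) \<le> C * \<bar>t - u\<bar>"
  shows "(\<lambda>t. F t * velocity t) integrable_on {a..b}" "F \<in> borel_measurable borel"
proof -
  have C0: "0 \<le> C" using order_trans[OF norm_ge_zero lip[of 1 0]] by simp
  have contF: "continuous_on S F" for S
    by (rule lipschitz_on_continuous_on[of C]) (auto intro!: lipschitz_onI simp: lip dist_real_def dist_norm C0)
  show Fb: "F \<in> borel_measurable borel" by (rule borel_measurable_continuous_onI[OF contF])
  have "bounded (F ` {a..b})" by (intro compact_imp_bounded compact_continuous_image contF) auto
  then obtain B where "\<forall>t\<in>{a..b}. cmod (F t) \<le> B" unfolding bounded_iff by auto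
  then show "(\<lambda>t. F t * velocity t) integrable_on {a..b}" by (intro integrable_curve[OF Fb, of _ _ B]) blast
qed

context
  fixes S :: "'h::chilbert_space \<Rightarrow> 'h" and \<delta> :: real
  assumes S: "separated S \<delta>" and \<delta>: "0 < \<delta>"
begin

lemma resolvent_curve_lipschitz:
  "cmod (cinner (resolvent S (g t) x) y - cinner (resolvent S (g u) x) y) \<le> norm x * norm y / \<delta>\<^sup>2 * \<bar>t - u\<bar>"
proof -
  have "cmod (cinner (resolvent S (g t) x) y - cinner (resolvent S (g u) x) y)
      \<le> norm (resolvent S (g t) x - resolvent S (g u) x) * norm y"
    unfolding cinner_diff_left[symmetric] by (rule cinner_norm_le)
  also have "\<dots> \<le> (cmod (g t - g u) * norm x / \<delta>\<^sup>2) * norm y"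
    by (intro mult_right_mono resolvent_lipschitz[OF S \<delta>] g_frontier) auto
  also have "\<dots> \<le> (\<bar>t - u\<bar> * norm x / \<delta>\<^sup>2) * norm y"
    using g_lip[of t u] by (intro mult_right_mono divide_right_mono) (auto simp: dist_norm)
  finally show ?thesis by (simp add: mult_ac)
qed

text \<open>The square of the resolvent is minus its derivative in the spectral parameter, so the
  integrand is exact and its integral over the closed curve vanishes.\<close>

lemma resolvent_square_integral:
  "((\<lambda>t. cinner (resolvent S (g t) (resolvent S (g t) x)) y * velocity t) has_integral 0) {0..L}"
proof -
  define F where "F t = cinner (resolvent S (g t) x) y" for t
  have "((\<lambda>t. - (cinner (resolvent S (g t) (resolvent S (g t) x)) y * velocity t)) has_integral F L - F 0) {0..L}"
  proof (rule FTC_locally_lipschitz[OF _ countable_corner_times])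
    show "0 \<le> L" using L_pos by simp
    show "dist (F t) (F u) \<le> norm x * norm y / \<delta>\<^sup>2 * \<bar>t - u\<bar>" for t u
      unfolding F_def dist_norm by (rule resolvent_curve_lipschitz)
    fix t assume t: "t \<in> {0<..<L} - corner_times"
    let ?R = "resolvent S (g t) x"
    define K where "K = cinner (resolvent S (g t) ?R) y"
    \<comment> \<open>\<open>F\<close> with its expected linear part removed; the resolvent identity
      leaves a product of two increments of order \<open>u - t\<close>.\<close>
    define E where "E u = F u + (g u - g t) * K" for u
    have "cmod (E u - E t) \<le> norm ?R * norm y / \<delta>\<^sup>2 * (u - t)\<^sup>2" for u
    proof -
      have "F u - F t = (g t - g u) * cinner (resolvent S (g u) ?R) y"
        unfolding F_def cinner_diff_left[symmetric] resolvent_identity[OF S \<delta> g_frontier g_frontier] cinner_scaleC_left ..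
      then have "E u - E t = (g u - g t) * (K - cinner (resolvent S (g u) ?R) y)"
        by (simp add: E_def algebra_simps)
      then have "cmod (E u - E t) = cmod (g u - g t) * cmod (K - cinner (resolvent S (g u) ?R) y)"
        by (simp add: norm_mult)
      also have "\<dots> \<le> \<bar>u - t\<bar> * (norm ?R * norm y / \<delta>\<^sup>2 * \<bar>t - u\<bar>)"
        using g_lip[of u t] resolvent_curve_lipschitz[of t ?R y u] unfolding K_def dist_norm
        by (intro mult_mono) auto
      also have "\<dots> = norm ?R * norm y / \<delta>\<^sup>2 * (u - t)\<^sup>2"
      proof -
        have "\<bar>u - t\<bar> * \<bar>t - u\<bar> = (u - t)\<^sup>2" by (metis abs_minus_commute abs_mult_self_eq power2_eq_square)
        then show ?thesis by (metis mult.left_commute)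
      qed
      finally show ?thesis .
    qed
    then have "(E has_vector_derivative 0) (at t)" by (rule has_vector_derivative_quadratic)
    moreover have "(g has_vector_derivative velocity t) (at t)" using t by (intro has_velocity) auto
    ultimately have "((\<lambda>u. E u - (g u - g t) * K) has_vector_derivative 0 - (velocity t - 0) * K) (at t)"
      by (intro has_vector_derivative_diff has_vector_derivative_mult_left has_vector_derivative_const)
    then show "(F has_vector_derivative - (cinner (resolvent S (g t) ?R) y * velocity t)) (at t)"
      by (simp add: E_def K_def mult.commute)
  qed (rule zero_less_one)
  then have "((\<lambda>t. - (cinner (resolvent S (g t) (resolvent S (g t) x)) y * velocity t)) has_integral - 0) {0..L}"
    using g_per[of 0] by (simp add: F_def)
  from has_integral_neg[OF this] show ?thesis by simp
qed

end

text \<open>The second resolvent identity; two dilates differ by \<open>s' - s\<close> times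
  \<open>S - z0\<close>.\<close>

lemma resolvent_dilate_identity:
  fixes S :: "'h::chilbert_space \<Rightarrow> 'h"
  assumes S: "separated (dilate s S) \<delta>" and S': "separated (dilate s' S) \<delta>" and \<delta>: "0 < \<delta>" and \<sigma>: "\<sigma> \<in> frontier \<Omega>"
  shows "resolvent (dilate s' S) \<sigma> y - resolvent (dilate s S) \<sigma> y
    = of_real (s' - s) *\<^sub>C resolvent (dilate s' S) \<sigma> (S (resolvent (dilate s S) \<sigma> y) - z0 *\<^sub>C resolvent (dilate s S) \<sigma> y)"
proof -
  let ?x = "resolvent (dilate s S) \<sigma> y"
  let ?A = "S ?x - z0 *\<^sub>C ?x"
  have "\<sigma> *\<^sub>C ?x - dilate s' S ?x = (\<sigma> *\<^sub>C ?x - dilate s S ?x) + (- of_real (s' - s)) *\<^sub>C ?A"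
    by (simp add: dilate_def scaleC_diff_right scaleC_scaleC scaleC_diff_left scaleC_minus_left algebra_simps)
  also have "\<sigma> *\<^sub>C ?x - dilate s S ?x = y" by (rule resolvent_right[OF S \<delta> \<sigma>])
  finally have "?x = resolvent (dilate s' S) \<sigma> y + (- of_real (s' - s)) *\<^sub>C resolvent (dilate s' S) \<sigma> ?A"
    by (metis resolvent_left[OF S' \<delta> \<sigma>] resolvent_add[OF S' \<delta> \<sigma>] resolvent_scale[OF S' \<delta> \<sigma>])
  then have "?x = resolvent (dilate s' S) \<sigma> y - of_real (s' - s) *\<^sub>C resolvent (dilate s' S) \<sigma> ?A"
    by (simp only: scaleC_minus_left diff_conv_add_uminus)
  moreover have "x = a - d \<Longrightarrow> a - x = d" for x a d :: 'h by simp
  ultimately show ?thesis by blast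
qed

text \<open>The integral of the resolvent does not change along the dilations of \<open>S\<close> to the scalar operator \<open>z0\<close>:
  its derivative is the integral of an exact form.\<close>

lemma resolvent_integral:
  fixes S :: "'h::chilbert_space \<Rightarrow> 'h"
  assumes S: "separated S \<delta>" and \<delta>: "0 < \<delta>"
  shows "((\<lambda>t. cinner (resolvent S (g t) x) y * velocity t) has_integral 2 * of_real pi * \<i> * cinner x y) {0..L}"
proof -
  obtain r where r: "0 < r" "\<And>\<zeta> n. unit_normal \<zeta> n \<Longrightarrow> r \<le> Re (cnj n * (\<zeta> - z0))" using inradius by metis
  \<comment> \<open>A common gap for all dilates, so that every estimate below is uniform in
    \<open>s\<close>.\<close>
  define \<eta> where "\<eta> = min r \<delta>"
  have \<eta>: "0 < \<eta>" using r \<delta> by (simp add: \<eta>_def)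
  have sep: "separated (dilate s S) \<eta>" if s: "s \<in> {0..1}" for s
  proof -
    have "\<eta> = (1 - s) * \<eta> + s * \<eta>" by (simp add: algebra_simps)
    also have "\<dots> \<le> (1 - s) * r + s * \<delta>" using s by (intro add_mono mult_left_mono) (auto simp: \<eta>_def)
    finally show ?thesis using separated_mono[OF separated_dilate[OF S _ _ r(2)]] s by auto
  qed
  note Sl = bounded_clinearD[OF separatedD(1)[OF S]]
  have Ac: "bounded_clinear (\<lambda>x. S x - z0 *\<^sub>C x)"
    using bounded_clinear_affine[OF separatedD(1)[OF S], of "- z0" 1]
    by (simp add: scaleC_minus_left scaleC_one)
  obtain M where M: "0 < M" "\<And>x. norm (S x - z0 *\<^sub>C x) \<le> M * norm x" by (rule bounded_clinear_norm[OF Ac]) blast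
  define R where "R s t = resolvent (dilate s S) (g t)" for s t
  define A where "A x = S x - z0 *\<^sub>C x" for x
  have RA: "R s t (A w) = A (R s t w)" if s: "s \<in> {0..1}" for s t w
  proof -
    have eq: "g t *\<^sub>C A v - dilate s S (A v) = A (g t *\<^sub>C v - dilate s S v)" for v
      by (simp add: A_def dilate_def Sl scaleC_diff_right scaleC_add_right scaleC_scaleC mult.commute algebra_simps)
    have "g t *\<^sub>C A (R s t w) - dilate s S (A (R s t w)) = A w"
      unfolding eq R_def by (simp add: resolvent_right[OF sep[OF s] \<eta> g_frontier])
    then show ?thesis unfolding R_def by (metis resolvent_left[OF sep[OF s] \<eta> g_frontier])
  qed
  define J where "J s = integral {0..L} (\<lambda>t. cinner (R s t x) y * velocity t)" for s
  have J: "((\<lambda>t. cinner (R s t x) y * velocity t) has_integral J s) {0..L}" if s: "s \<in> {0..1}" for s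
    unfolding J_def R_def
    by (rule integrable_integral) (rule integrable_lipschitz(1)[OF resolvent_curve_lipschitz[OF sep[OF s] \<eta>]])
  \<comment> \<open>The first-order change of \<open>J\<close> is the integral of the squared
    resolvent applied to \<open>A x\<close>, which vanishes. The remainder, from using the dilation
    identity twice, is quadratic; so \<open>J\<close> has derivative 0.\<close>
  have quad: "cmod (J s' - J s) \<le> (M / \<eta> * (M / \<eta> * (norm x / \<eta>)) * norm y * L) * (s' - s)\<^sup>2" if s: "s \<in> {0..1}" "s' \<in> {0..1}" for s s'
  proof -
    define h where "h = s' - s"
    have id1: "R s' t w - R s t w = of_real h *\<^sub>C R s' t (A (R s t w))" for t w
      unfolding R_def A_def h_def by (rule resolvent_dilate_identity[OF sep[OF s(1)] sep[OF s(2)] \<eta> g_frontier])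
    have sq: "((\<lambda>t. cinner (R s t (R s t (A x))) y * velocity t) has_integral 0) {0..L}"
      unfolding R_def by (rule resolvent_square_integral[OF sep[OF s(1)] \<eta>])
    have Rn: "norm (R u t w) \<le> norm w / \<eta>" if "u \<in> {0..1}" for u t w
      unfolding R_def by (rule resolvent_norm[OF sep[OF that] \<eta> g_frontier])
    have D: "((\<lambda>t. cinner (R s' t x) y * velocity t - cinner (R s t x) y * velocity t
        - of_real h * (cinner (R s t (R s t (A x))) y * velocity t)) has_integral J s' - J s - of_real h * 0) (cbox 0 L)"
      unfolding cbox_interval by (intro has_integral_diff has_integral_mult_right J s sq)
    have "cmod (J s' - J s - of_real h * 0) \<le> (M / \<eta> * (M / \<eta> * (norm x / \<eta>)) * norm y * h\<^sup>2) * measure lborel (cbox 0 L)"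
    proof (rule has_integral_bound[OF _ D])
      fix t
      let ?w = "A (R s t x)"
      have w: "R s t (A x) = ?w" by (rule RA[OF s(1)])
      have "R s' t x - R s t x - of_real h *\<^sub>C R s t ?w = of_real h *\<^sub>C (R s' t ?w - R s t ?w)"
        by (simp add: id1[of t x] scaleC_diff_right)
      also have "\<dots> = of_real (h\<^sup>2) *\<^sub>C R s' t (A (R s t ?w))"
        by (simp add: id1[of t ?w] scaleC_scaleC power2_eq_square)
      finally have eq: "R s' t x - R s t x - of_real h *\<^sub>C R s t ?w = of_real (h\<^sup>2) *\<^sub>C R s' t (A (R s t ?w))" .
      have "cinner (R s' t x) y * velocity t - cinner (R s t x) y * velocity t
          - of_real h * (cinner (R s t (R s t (A x))) y * velocity t)
          = cinner (R s' t x - R s t x - of_real h *\<^sub>C R s t ?w) y * velocity t"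
        by (simp only: w cinner_diff_left cinner_scaleC_left left_diff_distrib mult.assoc)
      then have "cmod (cinner (R s' t x) y * velocity t - cinner (R s t x) y * velocity t
          - of_real h * (cinner (R s t (R s t (A x))) y * velocity t))
          = h\<^sup>2 * cmod (cinner (R s' t (A (R s t ?w))) y) * cmod (velocity t)"
        unfolding eq by (simp add: cinner_scaleC_left norm_mult norm_power)
      also have "\<dots> \<le> h\<^sup>2 * (norm (R s' t (A (R s t ?w))) * norm y) * 1"
        by (intro mult_mono cinner_norm_le norm_velocity_le) auto
      also have "norm (R s' t (A (R s t ?w))) \<le> M / \<eta> * (M / \<eta> * (norm x / \<eta>))"
      proof -
        have a: "norm (A v) \<le> M * norm v" for v unfolding A_def by (rule M(2))
        have b: "norm (R u t (A v)) \<le> M / \<eta> * norm v" if "u \<in> {0..1}" for u v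
          using order_trans[OF Rn[OF that, of t "A v"] divide_right_mono[OF a[of v], of \<eta>]] \<eta> by simp
        have "norm (R s' t (A (R s t ?w))) \<le> M / \<eta> * norm (R s t ?w)" by (rule b[OF s(2)])
        also have "\<dots> \<le> M / \<eta> * (M / \<eta> * norm (R s t x))" using b[OF s(1)] M(1) \<eta> by (intro mult_left_mono) auto
        also have "\<dots> \<le> M / \<eta> * (M / \<eta> * (norm x / \<eta>))" using Rn[OF s(1)] M(1) \<eta> by (intro mult_left_mono) auto
        finally show ?thesis .
      qed
      finally show "cmod (cinner (R s' t x) y * velocity t - cinner (R s t x) y * velocity t
          - of_real h * (cinner (R s t (R s t (A x))) y * velocity t)) \<le> M / \<eta> * (M / \<eta> * (norm x / \<eta>)) * norm y * h\<^sup>2"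
        by (simp add: mult_ac mult_left_mono mult_right_mono)
    qed (use M(1) \<eta> in auto)
    then show ?thesis using L_pos by (simp add: h_def mult_ac)
  qed
  obtain c where c: "\<And>s. s \<in> {0..1} \<Longrightarrow> J s = c"
  proof (rule has_vector_derivative_zero_constant[of "{0..1::real}" J])
    show "(J has_vector_derivative 0) (at s within {0..1})" if "s \<in> {0..1}" for s
      by (rule has_vector_derivative_quadratic[OF quad[OF that]])
  qed auto
  have "J 1 = J 0" using c[of 0] c[of 1] by simp
  \<comment> \<open>At \<open>s = 0\<close> the operator is the scalar \<open>z0\<close>, and the
    integral reduces to the winding integral.\<close>
  have "R 0 t x = (1 / (g t - z0)) *\<^sub>C x" for t
  proof -
    have ne: "g t - z0 \<noteq> 0" using g_not_interior z0 by (metis eq_iff_diff_eq_0)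
    have "dilate 0 S v = z0 *\<^sub>C v" for v by (simp add: dilate_def)
    then have "g t *\<^sub>C ((1 / (g t - z0)) *\<^sub>C x) - dilate 0 S ((1 / (g t - z0)) *\<^sub>C x) = ((g t - z0) * (1 / (g t - z0))) *\<^sub>C x"
      by (simp only: scaleC_scaleC scaleC_diff_left[symmetric] left_diff_distrib)
    also have "\<dots> = x" using ne by (simp add: scaleC_one)
    finally show ?thesis unfolding R_def using resolvent_left[OF sep[of 0] \<eta> g_frontier] by (metis atLeastAtMost_iff order.refl zero_le_one)
  qed
  then have "((\<lambda>t. velocity t / (g t - z0) * cinner x y) has_integral J 0) {0..L}"
    using J[of 0] by (simp add: cinner_scaleC_left mult.commute)
  moreover have "((\<lambda>t. velocity t / (g t - z0) * cinner x y) has_integral 2 * of_real pi * \<i> * cinner x y) {0..L}"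
    by (intro has_integral_mult_left winding_integral z0)
  ultimately have "J 0 = 2 * of_real pi * \<i> * cinner x y" by (rule has_integral_unique)
  moreover have "dilate 1 S = S" by (simp add: dilate_def[abs_def] scaleC_one)
  ultimately show ?thesis using J[of 1] \<open>J 1 = J 0\<close> by (simp add: R_def)
qed

text \<open>Induction on the coefficients through \<open>\<sigma>\<close> R x = x + R (S x), where R
  is the resolvent at \<open>\<sigma>\<close>. The middle term contributes the integral of a
  polynomial over a closed curve, which is 0.\<close>

lemma Cauchy_operator:
  fixes S :: "'h::chilbert_space \<Rightarrow> 'h"
  assumes S: "separated S \<delta>" and \<delta>: "0 < \<delta>"
  shows "((\<lambda>t. poly f (g t) * cinner (resolvent S (g t) x) y * velocity t) has_integral
    2 * of_real pi * \<i> * cinner (poly_operator f S x) y) {0..L}"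
proof (induction f arbitrary: x)
  case (pCons a f)
  note Sl = separatedD(1)[OF S]
  have eq: "poly (pCons a f) (g t) * cinner (resolvent S (g t) x) y * velocity t
      = a * (cinner (resolvent S (g t) x) y * velocity t) + poly f (g t) * velocity t * cinner x y
        + poly f (g t) * cinner (resolvent S (g t) (S x)) y * velocity t" for t
  proof -
    have "resolvent S (g t) (g t *\<^sub>C x + (- 1) *\<^sub>C S x) = x"
      using resolvent_left[OF S \<delta> g_frontier, of t x] by (simp add: scaleC_minus_left scaleC_one)
    then have "g t *\<^sub>C resolvent S (g t) x + (- 1) *\<^sub>C resolvent S (g t) (S x) = x"
      by (simp only: resolvent_add[OF S \<delta> g_frontier] resolvent_scale[OF S \<delta> g_frontier])
    then have "cinner (g t *\<^sub>C resolvent S (g t) x + (- 1) *\<^sub>C resolvent S (g t) (S x)) y = cinner x y" by simp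
    then have "g t * cinner (resolvent S (g t) x) y = cinner x y + cinner (resolvent S (g t) (S x)) y"
      by (simp add: cinner_add_left cinner_diff_left cinner_scaleC_left cinner_minus_left scaleC_minus_left scaleC_one algebra_simps)
    then have "poly f (g t) * (g t * cinner (resolvent S (g t) x) y) = poly f (g t) * (cinner x y + cinner (resolvent S (g t) (S x)) y)"
      by simp
    then have "poly f (g t) * (g t * cinner (resolvent S (g t) x) y) * velocity t
      = poly f (g t) * (cinner x y + cinner (resolvent S (g t) (S x)) y) * velocity t" by simp
    then show ?thesis by (simp add: algebra_simps)
  qed
  have "((\<lambda>t. a * (cinner (resolvent S (g t) x) y * velocity t) + poly f (g t) * velocity t * cinner x y
        + poly f (g t) * cinner (resolvent S (g t) (S x)) y * velocity t) has_integral
      a * (2 * of_real pi * \<i> * cinner x y) + 0 * cinner x y + 2 * of_real pi * \<i> * cinner (poly_operator f S (S x)) y) {0..L}"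
    by (intro has_integral_add has_integral_mult_right has_integral_mult_left resolvent_integral[OF S \<delta>] poly_integral_zero pCons(2))
  moreover have "a * (2 * of_real pi * \<i> * cinner x y) + 0 * cinner x y + 2 * of_real pi * \<i> * cinner (poly_operator f S (S x)) y
      = 2 * of_real pi * \<i> * cinner (poly_operator (pCons a f) S x) y"
    by (simp add: poly_operator_pCons[OF Sl] poly_operator_commute[OF Sl] cinner_add_left cinner_scaleC_left algebra_simps)
  ultimately show ?case unfolding eq by simp
qed simp

text \<open>Supplies the finiteness of the extremal constant. The bound deteriorates as
  \<open>\<delta>\<close> tends to 0, but the final estimate is free of
  \<open>\<delta>\<close>.\<close>

lemma poly_operator_finite_bound:
  fixes S :: "'h::chilbert_space \<Rightarrow> 'h"
  assumes S: "separated S \<delta>" and \<delta>: "0 < \<delta>" and f: "\<And>z. z \<in> \<Omega> \<Longrightarrow> cmod (poly f z) \<le> 1"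
  shows "norm (poly_operator f S x) \<le> L / (2 * pi * \<delta>) * norm x"
proof (rule norm_le_by_cinner)
  fix y
  have "cmod (2 * of_real pi * \<i> * cinner (poly_operator f S x) y) \<le> (norm x * norm y / \<delta>) * measure lborel (cbox 0 L)"
  proof (rule has_integral_bound)
    show "((\<lambda>t. poly f (g t) * cinner (resolvent S (g t) x) y * velocity t) has_integral
        2 * of_real pi * \<i> * cinner (poly_operator f S x) y) (cbox 0 L)"
      using Cauchy_operator[OF S \<delta>] by simp
    fix t
    have "cmod (poly f (g t)) * cmod (cinner (resolvent S (g t) x) y) * cmod (velocity t) \<le> 1 * (norm x * norm y / \<delta>) * 1"
      using f[OF g_in] resolvent_form_le[OF S \<delta> g_frontier] norm_velocity_le \<delta> by (intro mult_mono) auto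
    then show "cmod (poly f (g t) * cinner (resolvent S (g t) x) y * velocity t) \<le> norm x * norm y / \<delta>"
      by (simp add: norm_mult)
  qed (use \<delta> in simp)
  then show "cmod (cinner (poly_operator f S x) y) \<le> L / (2 * pi * \<delta>) * norm x * norm y"
    using L_pos \<delta> by (simp add: norm_mult field_simps)
qed (use L_pos \<delta> in simp)

text \<open>The form <G(S) x, y> for the Cauchy transform \<open>G\<close> of the conjugate of
  \<open>f\<close>, defined without forming the operator G(S) or its adjoint.\<close>

definition companion_form :: "complex poly \<Rightarrow> ('h::chilbert_space \<Rightarrow> 'h) \<Rightarrow> 'h \<Rightarrow> 'h \<Rightarrow> complex" where
  "companion_form f S x y = integral {0..L} (\<lambda>t. cnj (poly f (g t)) * cinner (resolvent S (g t) x) y * velocity t) / (2 * of_real pi * \<i>)"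

text \<open>Covers the scalar Cauchy kernel and the resolvent forms at once. The constant is linear
  in \<open>B\<close>, so the Riemann sum errors for the forms scale with
  \<open>norm x * norm y\<close>.\<close>

lemma companion_integrand_lipschitz:
  assumes \<psi>: "\<And>t. cmod (\<psi> t) \<le> B / \<delta>" "\<And>t u. cmod (\<psi> t - \<psi> u) \<le> B / \<delta>\<^sup>2 * \<bar>t - u\<bar>" and \<delta>: "0 < \<delta>" and B: "0 \<le> B"
    and f: "\<And>z. z \<in> \<Omega> \<Longrightarrow> cmod (poly f z) \<le> 1"
    and C: "\<And>z w. z \<in> \<Omega> \<Longrightarrow> w \<in> \<Omega> \<Longrightarrow> cmod (poly f z - poly f w) \<le> C * cmod (z - w)" "0 \<le> C"
  shows "cmod (cnj (poly f (g t)) * \<psi> t - cnj (poly f (g u)) * \<psi> u) \<le> B * (C / \<delta> + 1 / \<delta>\<^sup>2) * \<bar>t - u\<bar>"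
proof -
  have "cnj (poly f (g t)) * \<psi> t - cnj (poly f (g u)) * \<psi> u
      = cnj (poly f (g t) - poly f (g u)) * \<psi> t + cnj (poly f (g u)) * (\<psi> t - \<psi> u)"
    by (simp add: algebra_simps)
  then have "cmod (cnj (poly f (g t)) * \<psi> t - cnj (poly f (g u)) * \<psi> u)
      \<le> cmod (poly f (g t) - poly f (g u)) * cmod (\<psi> t) + cmod (poly f (g u)) * cmod (\<psi> t - \<psi> u)"
    by (metis complex_mod_cnj norm_mult norm_triangle_ineq)
  also have "\<dots> \<le> (C * \<bar>t - u\<bar>) * (B / \<delta>) + 1 * (B / \<delta>\<^sup>2 * \<bar>t - u\<bar>)"
  proof (intro add_mono mult_mono \<psi> f g_in)
    show "cmod (poly f (g t) - poly f (g u)) \<le> C * \<bar>t - u\<bar>"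
      using order_trans[OF C(1)[OF g_in g_in] mult_left_mono[OF g_lip[of t u, unfolded dist_norm] C(2)]] .
  qed (use B \<delta> C in auto)
  finally show ?thesis by (simp add: algebra_simps)
qed

text \<open>The numerical range lies on the inner side of every tangent, so the operator kernel is positive; its
  total mass is \<open>2\<close>.\<close>

lemma companion_bound:
  fixes S :: "'h::chilbert_space \<Rightarrow> 'h"
  assumes S: "separated S \<delta>" and \<delta>: "0 < \<delta>" and f: "\<And>z. z \<in> \<Omega> \<Longrightarrow> cmod (poly f z) \<le> 1"
  shows "cmod (cinner (poly_operator f S x) y + cnj (companion_form f S y x)) \<le> 2 * norm x * norm y"
proof -
  obtain C where C: "0 \<le> C" "\<And>z w. z \<in> \<Omega> \<Longrightarrow> w \<in> \<Omega> \<Longrightarrow> cmod (poly f z - poly f w) \<le> C * cmod (z - w)"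
    by (rule poly_lipschitz) blast
  define R where "R t = resolvent S (g t)" for t
  note R_add = resolvent_add[OF S \<delta> g_frontier, folded R_def]
    and R_scale = resolvent_scale[OF S \<delta> g_frontier, folded R_def]
  \<comment> \<open>The Hermitian imaginary part of velocity times resolvent: the operator
    counterpart of the density \<open>Im (velocity t / (g t - z))\<close>.\<close>
  define m where "m t x y = (- \<i> / 2) * (velocity t * cinner (R t x) y - cnj (velocity t * cinner (R t y) x))" for t x y
  have Re_m: "Re ((- \<i> / 2) * (a - cnj a)) = Im a" for a by simp
  have psd: "psd_form (m t)" for t
  proof
    show "m t (x + y) z = m t x z + m t y z" for x y z
      by (simp add: m_def R_add cinner_add_left cinner_add_right algebra_simps)
    show "m t (a *\<^sub>C x) y = a * m t x y" for a x y
      by (simp add: m_def R_scale cinner_scaleC_left cinner_scaleC_right algebra_simps)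
    show "m t y x = cnj (m t x y)" for x y
      by (simp add: m_def algebra_simps)
    show "0 \<le> Re (m t x x)" for x
    proof -
      have "Re (m t x x) = Im (velocity t * cinner (R t x) x)"
        unfolding m_def by (rule Re_m)
      also have "\<dots> \<ge> 0"
      proof (cases "g t \<in> corners")
        case True
        then show ?thesis by (simp add: velocity_def normal_def)
      next
        case False
        then have n: "unit_normal (g t) (normal (g t))" using g_frontier by (intro normal_unit_normal) auto
        \<comment> \<open>The gap inequality is applied to the vector \<open>R t x\<close>, whose
          image under \<open>g t - S\<close> is \<open>x\<close> itself; it then reads as positivity
          of the kernel at \<open>x\<close>.\<close>
        have "g t *\<^sub>C R t x - S (R t x) = x" unfolding R_def by (rule resolvent_right[OF S \<delta> g_frontier])
        then have "\<delta> * (norm (R t x))\<^sup>2 \<le> Re (cnj (normal (g t)) * cinner x (R t x))"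
          using separatedD(2)[OF S n, of "R t x"] by simp
        moreover have "0 \<le> \<delta> * (norm (R t x))\<^sup>2" using \<delta> by simp
        ultimately have "0 \<le> Re (cnj (normal (g t)) * cnj (cinner (R t x) x))" using cinner_commute[of x "R t x"] by simp
        then show ?thesis by (simp add: velocity_def)
      qed
      finally show ?thesis .
    qed
  qed
  have m_int: "((\<lambda>t. Re (m t x x)) has_integral 2 * pi * (norm x)\<^sup>2) {0..L}" for x
  proof -
    have "((\<lambda>t. Im (cinner (R t x) x * velocity t)) has_integral Im (2 * of_real pi * \<i> * cinner x x)) {0..L}"
      unfolding R_def by (rule has_integral_Im[OF resolvent_integral[OF S \<delta>]])
    moreover have "Re (m t x x) = Im (cinner (R t x) x * velocity t)" for t
      unfolding m_def Re_m by (simp only: mult.commute)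
    ultimately show ?thesis by (simp add: cinner_self del: times_complex.sel) (simp add: cinner_self)
  qed
  define \<Phi> where "\<Phi> x y = cinner (poly_operator f S x) y + cnj (companion_form f S y x)" for x y
  have int2: "((\<lambda>t. cnj (poly f (g t)) * cinner (R t y) x * velocity t) has_integral
      2 * of_real pi * \<i> * companion_form f S y x) {0..L}" for x y
  proof -
    have "(\<lambda>t. (cnj (poly f (g t)) * cinner (R t y) x) * velocity t) integrable_on {0..L}"
      unfolding R_def
      by (rule integrable_lipschitz(1)[OF companion_integrand_lipschitz[OF _ resolvent_curve_lipschitz[OF S \<delta>] \<delta> _ f C(2,1)]])
        (use resolvent_form_le[OF S \<delta> g_frontier] in auto)
    then show ?thesis by (simp add: companion_form_def R_def has_integral_iff)
  qed
  have \<Phi>_int: "((\<lambda>t. poly f (g t) * m t x y) has_integral of_real pi * \<Phi> x y) {0..L}" for x y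
  proof -
    have i1: "((\<lambda>t. poly f (g t) * cinner (R t x) y * velocity t) has_integral
        2 * of_real pi * \<i> * cinner (poly_operator f S x) y) {0..L}"
      unfolding R_def by (rule Cauchy_operator[OF S \<delta>])
    have i2: "((\<lambda>t. cnj (cnj (poly f (g t)) * cinner (R t y) x * velocity t)) has_integral
        cnj (2 * of_real pi * \<i> * companion_form f S y x)) {0..L}"
      using has_integral_linear[OF int2 bounded_linear_cnj] by (simp add: o_def)
    have "((\<lambda>t. (- \<i> / 2) * (poly f (g t) * cinner (R t x) y * velocity t - cnj (cnj (poly f (g t)) * cinner (R t y) x * velocity t)))
        has_integral (- \<i> / 2) * (2 * of_real pi * \<i> * cinner (poly_operator f S x) y - cnj (2 * of_real pi * \<i> * companion_form f S y x))) {0..L}"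
      by (intro has_integral_mult_right has_integral_diff i1 i2)
    moreover have "(- \<i> / 2) * (poly f (g t) * cinner (R t x) y * velocity t - cnj (cnj (poly f (g t)) * cinner (R t y) x * velocity t))
        = poly f (g t) * m t x y" for t
      by (simp add: m_def algebra_simps)
    moreover have "(- \<i> / 2) * (2 * of_real pi * \<i> * cinner (poly_operator f S x) y - cnj (2 * of_real pi * \<i> * companion_form f S y x))
        = of_real pi * \<Phi> x y"
      by (simp add: \<Phi>_def algebra_simps)
    ultimately show ?thesis by simp
  qed
  have am: "cmod (\<Phi> x y) \<le> (norm x)\<^sup>2 + (norm y)\<^sup>2" for x y
  proof -
    have "((\<lambda>t. (Re (m t x x) + Re (m t y y)) / 2) has_integral (2 * pi * (norm x)\<^sup>2 + 2 * pi * (norm y)\<^sup>2) / 2) {0..L}"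
      by (intro has_integral_divide has_integral_add m_int)
    moreover have "cmod (poly f (g t) * m t x y) \<le> (Re (m t x x) + Re (m t y y)) / 2" for t
    proof -
      have "cmod (poly f (g t) * m t x y) \<le> 1 * cmod (m t x y)"
        unfolding norm_mult using f[OF g_in] by (intro mult_right_mono) auto
      then show ?thesis using psd_form.arith_mean[OF psd, of t x y] by linarith
    qed
    ultimately have "cmod (of_real pi * \<Phi> x y) \<le> (2 * pi * (norm x)\<^sup>2 + 2 * pi * (norm y)\<^sup>2) / 2"
      using integral_norm_bound_integral[OF has_integral_integrable[OF \<Phi>_int] has_integral_integrable]
      by (metis (no_types, lifting) \<Phi>_int integral_unique)
    then have "pi * cmod (\<Phi> x y) \<le> pi * ((norm x)\<^sup>2 + (norm y)\<^sup>2)"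
      by (simp add: norm_mult algebra_simps)
    then show ?thesis by simp
  qed
  \<comment> \<open>The arithmetic-mean bound is not homogeneous; rescaling both vectors to unit
    length turns the sum of squares into the product of the norms.\<close>
  have scale: "\<Phi> (of_real a *\<^sub>C x) (of_real b *\<^sub>C y) = of_real (a * b) * \<Phi> x y" for a b x y
  proof -
    have h: "((\<lambda>t. of_real (a * b) * (poly f (g t) * m t x y)) has_integral of_real (a * b) * (of_real pi * \<Phi> x y)) {0..L}"
      by (intro has_integral_mult_right \<Phi>_int)
    have e: "of_real (a * b) * (poly f (g t) * m t x y) = poly f (g t) * m t (of_real a *\<^sub>C x) (of_real b *\<^sub>C y)" for t
      by (simp add: m_def R_scale cinner_scaleC_left cinner_scaleC_right algebra_simps)
    have "of_real (a * b) * (of_real pi * \<Phi> x y) = of_real pi * \<Phi> (of_real a *\<^sub>C x) (of_real b *\<^sub>C y)"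
      by (rule has_integral_unique[OF h[unfolded e] \<Phi>_int])
    then have "of_real pi * (of_real (a * b) * \<Phi> x y) = of_real pi * \<Phi> (of_real a *\<^sub>C x) (of_real b *\<^sub>C y)"
      by (simp only: mult.left_commute)
    then show ?thesis by (metis mult_cancel_left of_real_eq_0_iff pi_neq_zero)
  qed
  show ?thesis
  proof (cases "x = 0 \<or> y = 0")
    case True
    then have "\<Phi> x y = 0" using scale[of 0 x 1 y] scale[of 1 x 0 y] by (auto simp: scaleC_one)
    then show ?thesis by (simp add: \<Phi>_def)
  next
    case False
    have "cmod (\<Phi> (of_real (1 / norm x) *\<^sub>C x) (of_real (1 / norm y) *\<^sub>C y)) \<le> 1\<^sup>2 + 1\<^sup>2"
      using am[of "of_real (1 / norm x) *\<^sub>C x" "of_real (1 / norm y) *\<^sub>C y"] False by (simp add: norm_divide)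
    then show ?thesis unfolding scale using False by (simp add: \<Phi>_def norm_divide norm_mult field_simps)
  qed
qed

end

section \<open>Polynomial approximation of the companion function\<close>

context convex_curve
begin

text \<open>Riemann sums of the Cauchy integral, with every Cauchy kernel replaced by a polynomial.\<close>

lemma companion_polynomial:
  fixes S :: "'h::chilbert_space \<Rightarrow> 'h"
  assumes S: "separated S \<delta>" and \<delta>: "0 < \<delta>" and f: "\<And>z. z \<in> \<Omega> \<Longrightarrow> cmod (poly f z) \<le> 1" and e: "0 < \<epsilon>"
  obtains q where
    "\<And>z. z \<in> core \<delta> \<Longrightarrow> z \<in> interior \<Omega> \<Longrightarrow> cmod (poly q z - cnj (layer_potential f z)) \<le> \<epsilon>"
    "\<And>x y. cmod (cinner (poly_operator q S x) y - companion_form f S x y) \<le> \<epsilon> * norm x * norm y"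
proof -
  obtain C where C: "0 \<le> C" "\<And>z w. z \<in> \<Omega> \<Longrightarrow> w \<in> \<Omega> \<Longrightarrow> cmod (poly f z - poly f w) \<le> C * cmod (z - w)"
    by (rule poly_lipschitz) blast
  define D where "D = C / \<delta> + 1 / \<delta>\<^sup>2"
  have D: "0 \<le> D" using C \<delta> by (simp add: D_def)
  \<comment> \<open>Half of \<open>\<epsilon>\<close> is spent on the Riemann sum, through
    \<open>N\<close>, and half on replacing the kernels at the nodes, through
    \<open>e'\<close>.\<close>
  obtain N :: nat where N': "2 * (D * L\<^sup>2) / \<epsilon> < real N" using reals_Archimedean2 by blast
  have "0 \<le> 2 * (D * L\<^sup>2) / \<epsilon>" using D e by simp
  then have N0: "0 < N" using N' by (cases N) auto
  have N: "D * L\<^sup>2 / real N \<le> \<epsilon> / 2"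
    using N' N0 e by (simp add: field_simps)
  define p where "p j = L * real j / real N" for j
  define e' where "e' = \<epsilon> / (2 * L)"
  have e': "0 < e'" using e L_pos by (simp add: e'_def)
  have "\<exists>P. (\<forall>y. norm (poly_operator P S y - resolvent S (g (p j)) y) \<le> e' * norm y) \<and>
      (\<forall>z\<in>core \<delta>. cmod (poly P z - 1 / (g (p j) - z)) \<le> e')" for j
    by (rule resolvent_polynomial[OF S \<delta> g_frontier e', of "p j"]) blast
  then obtain P where P1: "\<And>j y. norm (poly_operator (P j) S y - resolvent S (g (p j)) y) \<le> e' * norm y"
    and P2: "\<And>j z. z \<in> core \<delta> \<Longrightarrow> cmod (poly (P j) z - 1 / (g (p j) - z)) \<le> e'"
    by metis
  define w where "w j = cnj (poly f (g (p j))) * (g (p (Suc j)) - g (p j))" for j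
  have w: "cmod (w j) \<le> L / real N" for j
  proof -
    have "cmod (g (p (Suc j)) - g (p j)) \<le> L / real N"
      using g_lip[of "p (Suc j)" "p j"] L_pos N0 by (simp add: dist_norm p_def field_simps)
    then have "cmod (poly f (g (p j))) * cmod (g (p (Suc j)) - g (p j)) \<le> 1 * (L / real N)"
      using f[OF g_in] by (intro mult_mono) auto
    then show ?thesis by (simp add: w_def norm_mult)
  qed
  define q where "q = smult (1 / (2 * of_real pi * \<i>)) (\<Sum>j<N. smult (w j) (P j))"
  \<comment> \<open>One estimate for both claims, with the same nodes and weights:
    \<open>B = 1\<close> for the Cauchy kernel at a point, \<open>B = norm x * norm y\<close> for
    the resolvent form. Therefore a single \<open>q\<close> serves both.\<close>
  have key: "cmod ((\<Sum>j<N. w j * \<pi> j) - integral {0..L} (\<lambda>t. cnj (poly f (g t)) * \<psi> t * velocity t)) \<le> B * \<epsilon>"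
    if \<psi>: "\<And>t. cmod (\<psi> t) \<le> B / \<delta>" "\<And>t u. cmod (\<psi> t - \<psi> u) \<le> B / \<delta>\<^sup>2 * \<bar>t - u\<bar>" and B: "0 \<le> B"
      and \<pi>: "\<And>j. cmod (\<pi> j - \<psi> (p j)) \<le> B * e'" for \<psi> B \<pi>
  proof -
    have "cmod (integral {0..L} (\<lambda>t. cnj (poly f (g t)) * \<psi> t * velocity t)
        - (\<Sum>j<N. cnj (poly f (g (p j))) * \<psi> (p j) * (g (p (Suc j)) - g (p j)))) \<le> B * D * L\<^sup>2 / real N"
      unfolding p_def D_def
      by (rule Riemann_sum[OF companion_integrand_lipschitz[OF \<psi> \<delta> B f C(2,1)] N0])
    also have "\<dots> = B * (D * L\<^sup>2 / real N)" by simp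
    also have "\<dots> \<le> B * (\<epsilon> / 2)" by (rule mult_left_mono[OF N B])
    finally have 1: "cmod (integral {0..L} (\<lambda>t. cnj (poly f (g t)) * \<psi> t * velocity t)
        - (\<Sum>j<N. cnj (poly f (g (p j))) * \<psi> (p j) * (g (p (Suc j)) - g (p j)))) \<le> B * (\<epsilon> / 2)" .
    have "(\<Sum>j<N. w j * \<pi> j) - (\<Sum>j<N. cnj (poly f (g (p j))) * \<psi> (p j) * (g (p (Suc j)) - g (p j)))
        = (\<Sum>j<N. w j * (\<pi> j - \<psi> (p j)))"
      unfolding sum_subtractf[symmetric] by (rule sum.cong) (auto simp: w_def algebra_simps)
    also have "cmod \<dots> \<le> (\<Sum>j<N. L / real N * (B * e'))"
    proof (rule sum_norm_le)
      fix j
      have "cmod (w j) * cmod (\<pi> j - \<psi> (p j)) \<le> L / real N * (B * e')"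
        using L_pos by (intro mult_mono w \<pi>) auto
      then show "cmod (w j * (\<pi> j - \<psi> (p j))) \<le> L / real N * (B * e')" by (simp only: norm_mult)
    qed
    also have "\<dots> = B * (\<epsilon> / 2)" using N0 L_pos by (simp add: e'_def)
    finally have 2: "cmod ((\<Sum>j<N. w j * \<pi> j) - (\<Sum>j<N. cnj (poly f (g (p j))) * \<psi> (p j) * (g (p (Suc j)) - g (p j)))) \<le> B * (\<epsilon> / 2)" .
    have "cmod ((\<Sum>j<N. w j * \<pi> j) - integral {0..L} (\<lambda>t. cnj (poly f (g t)) * \<psi> t * velocity t)) \<le> B * (\<epsilon> / 2) + B * (\<epsilon> / 2)"
      using norm_diff_triangle_le[OF 2 1[unfolded norm_minus_commute[of "integral _ _"]]] .
    then show ?thesis by simp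
  qed
  have div: "cmod (a / (2 * of_real pi * \<i>) - b / (2 * of_real pi * \<i>)) \<le> B * \<epsilon>" if "cmod (a - b) \<le> B * \<epsilon>" "0 \<le> B" for a b B
  proof -
    have "cmod (a / (2 * of_real pi * \<i>) - b / (2 * of_real pi * \<i>)) = cmod (a - b) / (2 * pi)"
      unfolding diff_divide_distrib[symmetric] by (simp add: norm_divide norm_mult)
    also have "\<dots> \<le> cmod (a - b) / 1" using pi_ge_two by (intro divide_left_mono) auto
    finally show ?thesis using that by simp
  qed
  show thesis
  proof (rule that[of q])
    fix z assume z: "z \<in> core \<delta>" "z \<in> interior \<Omega>"
    have d: "\<delta> \<le> cmod (g t - z)" for t
    proof -
      obtain n where n: "unit_normal (g t) n" using unit_normal_exists[OF g_frontier] .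
      have "\<delta> \<le> Re (cnj n * (g t - z))" using z(1) n by (auto simp: core_def)
      also have "\<dots> \<le> cmod (cnj n * (g t - z))" by (rule complex_Re_le_cmod)
      finally show ?thesis by (simp add: norm_mult unit_normalD(1)[OF n])
    qed
    have ne: "g t - z \<noteq> 0" for t using d[of t] \<delta> by auto
    have "cmod ((\<Sum>j<N. w j * poly (P j) z) - integral {0..L} (\<lambda>t. cnj (poly f (g t)) * (1 / (g t - z)) * velocity t)) \<le> 1 * \<epsilon>"
    proof (rule key)
      show "cmod (1 / (g t - z)) \<le> 1 / \<delta>" for t
        unfolding norm_divide using d[of t] \<delta> by (simp add: frac_le)
      show "cmod (1 / (g t - z) - 1 / (g u - z)) \<le> 1 / \<delta>\<^sup>2 * \<bar>t - u\<bar>" for t u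
      proof -
        have "1 / (g t - z) - 1 / (g u - z) = (g u - g t) / ((g t - z) * (g u - z))"
          using ne[of t] ne[of u] by (simp add: diff_frac_eq)
        then have "cmod (1 / (g t - z) - 1 / (g u - z)) = cmod (g u - g t) / (cmod (g t - z) * cmod (g u - z))"
          by (simp add: norm_divide norm_mult)
        also have "\<dots> \<le> \<bar>t - u\<bar> / (\<delta> * \<delta>)"
          using g_lip[of u t] d \<delta> by (intro frac_le mult_mono) (auto simp: dist_norm)
        finally show ?thesis by (simp add: power2_eq_square)
      qed
      show "cmod (poly (P j) z - 1 / (g (p j) - z)) \<le> 1 * e'" for j using P2[OF z(1)] by simp
    qed simp
    from div[OF this]
    have "cmod (poly q z - integral {0..L} (\<lambda>t. cnj (poly f (g t)) / (g t - z) * velocity t) / (2 * of_real pi * \<i>)) \<le> \<epsilon>"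
      by (simp add: q_def poly_sum)
    then show "cmod (poly q z - cnj (layer_potential f z)) \<le> \<epsilon>"
      using integral_unique[OF layer_potential_interior[OF z(2), of f]] by simp
  next
    fix x y
    have "cmod ((\<Sum>j<N. w j * cinner (poly_operator (P j) S x) y)
        - integral {0..L} (\<lambda>t. cnj (poly f (g t)) * cinner (resolvent S (g t) x) y * velocity t)) \<le> norm x * norm y * \<epsilon>"
    proof (rule key)
      show "cmod (cinner (resolvent S (g t) x) y) \<le> norm x * norm y / \<delta>" for t
        by (rule resolvent_form_le[OF S \<delta> g_frontier])
      show "cmod (cinner (resolvent S (g t) x) y - cinner (resolvent S (g u) x) y) \<le> norm x * norm y / \<delta>\<^sup>2 * \<bar>t - u\<bar>" for t u
        by (rule resolvent_curve_lipschitz[OF S \<delta>])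
      show "cmod (cinner (poly_operator (P j) S x) y - cinner (resolvent S (g (p j)) x) y) \<le> norm x * norm y * e'" for j
      proof -
        have "cmod (cinner (poly_operator (P j) S x) y - cinner (resolvent S (g (p j)) x) y)
            \<le> norm (poly_operator (P j) S x - resolvent S (g (p j)) x) * norm y"
          unfolding cinner_diff_left[symmetric] by (rule cinner_norm_le)
        also have "\<dots> \<le> (e' * norm x) * norm y" by (intro mult_right_mono P1) auto
        finally show ?thesis by (simp add: mult_ac)
      qed
    qed simp
    from div[OF this]
    have "cmod ((\<Sum>j<N. w j * cinner (poly_operator (P j) S x) y) / (2 * of_real pi * \<i>) - companion_form f S x y) \<le> norm x * norm y * \<epsilon>"
      by (simp add: companion_form_def)
    moreover have "cinner (poly_operator q S x) y = (\<Sum>j<N. w j * cinner (poly_operator (P j) S x) y) / (2 * of_real pi * \<i>)"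
    proof -
      have "poly_operator (\<Sum>j\<in>J. smult (w j) (P j)) S x = (\<Sum>j\<in>J. w j *\<^sub>C poly_operator (P j) S x)" if "finite J" for J
        using that
        by (induction J) (auto simp: poly_operator_add[OF separatedD(1)[OF S]] poly_operator_smult[OF separatedD(1)[OF S]])
      then show ?thesis
        by (simp add: q_def poly_operator_smult[OF separatedD(1)[OF S]] cinner_scaleC_left cinner_sum_left)
    qed
    ultimately show "cmod (cinner (poly_operator q S x) y - companion_form f S x y) \<le> \<epsilon> * norm x * norm y"
      by (simp add: mult_ac)
  qed
qed

text \<open>The approximating polynomial is constructed for a dilate of \<open>S\<close>; this is
  the price, of order \<open>1 - s\<close>, for returning to \<open>S\<close>.\<close>

lemma companion_form_dilate:
  fixes S :: "'h::chilbert_space \<Rightarrow> 'h"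
  assumes S: "separated S \<delta>" and Ss: "separated (dilate s S) \<delta>" and \<delta>: "0 < \<delta>" and s: "0 \<le> s" "s \<le> 1"
    and f: "\<And>z. z \<in> \<Omega> \<Longrightarrow> cmod (poly f z) \<le> 1" and M: "\<And>x. norm (S x - z0 *\<^sub>C x) \<le> M * norm x" "0 \<le> M"
  shows "cmod (companion_form f S x y - companion_form f (dilate s S) x y) \<le> (1 - s) * (L * M / \<delta>\<^sup>2) * norm x * norm y"
proof -
  obtain C where C: "0 \<le> C" "\<And>z w. z \<in> \<Omega> \<Longrightarrow> w \<in> \<Omega> \<Longrightarrow> cmod (poly f z - poly f w) \<le> C * cmod (z - w)"
    by (rule poly_lipschitz) blast
  have int: "((\<lambda>t. cnj (poly f (g t)) * cinner (resolvent U (g t) x) y * velocity t) has_integral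
      2 * of_real pi * \<i> * companion_form f U x y) (cbox 0 L)" if U: "separated U \<delta>" for U :: "'h \<Rightarrow> 'h"
  proof -
    have "(\<lambda>t. (cnj (poly f (g t)) * cinner (resolvent U (g t) x) y) * velocity t) integrable_on {0..L}"
      by (rule integrable_lipschitz(1)[OF companion_integrand_lipschitz[OF _ resolvent_curve_lipschitz[OF U \<delta>] \<delta> _ f C(2,1)]])
        (use resolvent_form_le[OF U \<delta> g_frontier] in auto)
    then show ?thesis by (simp add: companion_form_def has_integral_iff)
  qed
  have d1: "dilate 1 S = S" by (simp add: dilate_def[abs_def] scaleC_one)
  let ?K = "(1 - s) * (M / \<delta>\<^sup>2) * norm x * norm y"
  have "cmod (2 * of_real pi * \<i> * companion_form f S x y - 2 * of_real pi * \<i> * companion_form f (dilate s S) x y)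
      \<le> ?K * measure lborel (cbox 0 L)"
  proof (rule has_integral_bound[OF _ has_integral_diff[OF int[OF S] int[OF Ss]]])
    fix t
    let ?x = "resolvent (dilate s S) (g t) x"
    have "resolvent S (g t) x - ?x = of_real (1 - s) *\<^sub>C resolvent S (g t) (S ?x - z0 *\<^sub>C ?x)"
      using resolvent_dilate_identity[of s S \<delta> 1 "g t" x] S Ss \<delta> g_frontier unfolding d1 by blast
    then have "norm (resolvent S (g t) x - ?x) = (1 - s) * norm (resolvent S (g t) (S ?x - z0 *\<^sub>C ?x))"
      using s by (simp flip: of_real_diff)
    also have "\<dots> \<le> (1 - s) * (M * (norm x / \<delta>) / \<delta>)"
    proof (intro mult_left_mono)
      have "norm (resolvent S (g t) (S ?x - z0 *\<^sub>C ?x)) \<le> norm (S ?x - z0 *\<^sub>C ?x) / \<delta>"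
        by (rule resolvent_norm[OF S \<delta> g_frontier])
      also have "\<dots> \<le> M * norm ?x / \<delta>" using M(1) \<delta> by (intro divide_right_mono) auto
      also have "\<dots> \<le> M * (norm x / \<delta>) / \<delta>"
        using resolvent_norm[OF Ss \<delta> g_frontier] M(2) \<delta> by (intro divide_right_mono mult_left_mono) auto
      finally show "norm (resolvent S (g t) (S ?x - z0 *\<^sub>C ?x)) \<le> M * (norm x / \<delta>) / \<delta>" .
    qed (use s in simp)
    finally have R: "norm (resolvent S (g t) x - ?x) \<le> (1 - s) * (M * (norm x / \<delta>) / \<delta>)" .
    have "cnj (poly f (g t)) * cinner (resolvent S (g t) x) y * velocity t - cnj (poly f (g t)) * cinner ?x y * velocity t
        = cnj (poly f (g t)) * cinner (resolvent S (g t) x - ?x) y * velocity t"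
      by (simp add: cinner_diff_left algebra_simps)
    then have "cmod (cnj (poly f (g t)) * cinner (resolvent S (g t) x) y * velocity t - cnj (poly f (g t)) * cinner ?x y * velocity t)
        = cmod (poly f (g t)) * cmod (cinner (resolvent S (g t) x - ?x) y) * cmod (velocity t)"
      by (simp add: norm_mult)
    also have "\<dots> \<le> 1 * (norm (resolvent S (g t) x - ?x) * norm y) * 1"
      by (intro mult_mono f g_in cinner_norm_le norm_velocity_le) auto
    also have "\<dots> \<le> ((1 - s) * (M * (norm x / \<delta>) / \<delta>)) * norm y" using mult_right_mono[OF R norm_ge_zero[of y]] by simp
    finally show "cmod (cnj (poly f (g t)) * cinner (resolvent S (g t) x) y * velocity t - cnj (poly f (g t)) * cinner ?x y * velocity t) \<le> ?K"
      by (simp add: power2_eq_square)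
  qed (use s M in simp)
  then have "2 * pi * cmod (companion_form f S x y - companion_form f (dilate s S) x y) \<le> ?K * L"
    using L_pos by (simp add: norm_mult flip: right_diff_distrib)
  moreover have "cmod (companion_form f S x y - companion_form f (dilate s S) x y)
      \<le> 2 * pi * cmod (companion_form f S x y - companion_form f (dilate s S) x y)"
    using pi_ge_two by (simp add: mult_le_cancel_right1)
  ultimately show ?thesis by (simp add: mult_ac)
qed

end

section \<open>The companion polynomial on all of \<open>\<Omega>\<close>, and the bound for
  separated operators\<close>

context convex_body
begin

interpretation bc: convex_curve \<Omega> z0 "perimeter \<Omega>" "boundary_curve \<Omega>" by (rule boundary_curve)

lemma np_operator_layer_potential:
  "\<zeta> \<in> frontier \<Omega> \<Longrightarrow> np_operator \<Omega> (poly f) \<zeta> = bc.layer_potential f \<zeta>"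
  unfolding bc.layer_potential_def by (rule np_operator_poly)

text \<open>The polynomial approximation is valid only on the core, whereas a bound on all of
  \<open>\<Omega>\<close> is wanted. So \<open>q\<close> is built for the dilate and composed with
  the same dilation: \<open>Q\<close> on \<open>\<Omega>\<close> takes the values of
  \<open>q\<close> on the shrunk copy, minus \<open>cnj c\<close>, and \<open>Q\<close> at
  \<open>S\<close> is \<open>q\<close> at the dilate, minus \<open>cnj c\<close>. The boundary bound
  comes from continuity of the layer potential, and the maximum principle extends it
  inwards.\<close>

lemma companion_exists:
  fixes S :: "'h::chilbert_space \<Rightarrow> 'h"
  assumes S: "separated S \<delta>" and \<delta>: "0 < \<delta>" and f: "\<And>z. z \<in> \<Omega> \<Longrightarrow> cmod (poly f z) \<le> 1" and e: "0 < \<epsilon>"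
  shows "\<exists>q c. (\<forall>z\<in>\<Omega>. cmod (poly q z) \<le> analytic_configuration_constant \<Omega> + \<epsilon>) \<and>
    cmod c \<le> 1 + analytic_configuration_constant \<Omega> + \<epsilon> \<and>
    (\<forall>x y. cmod (cinner (poly_operator f S x) y + cnj (cinner (poly_operator q S y) x) + c * cinner x y)
       \<le> (2 + \<epsilon>) * norm x * norm y)"
proof -
  let ?a = "analytic_configuration_constant \<Omega>"
  \<comment> \<open>On the boundary three errors add up: the polynomial approximation, the
    displacement by the dilation, and the choice of \<open>c\<close>.\<close>
  define e where "e = \<epsilon> / 3"
  have e0: "0 < e" "3 * e = \<epsilon>" using \<open>0 < \<epsilon>\<close> by (auto simp: e_def)
  obtain r where r: "0 < r" "\<And>\<zeta> n. unit_normal \<zeta> n \<Longrightarrow> r \<le> Re (cnj n * (\<zeta> - z0))" using inradius by metis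
  have Ac: "bounded_clinear (\<lambda>x. S x - z0 *\<^sub>C x)"
    using bounded_clinear_affine[OF separatedD(1)[OF S], of "- z0" 1]
    by (simp add: scaleC_minus_left scaleC_one)
  obtain M where M: "0 < M" "\<And>x. norm (S x - z0 *\<^sub>C x) \<le> M * norm x" by (rule bounded_clinear_norm[OF Ac]) blast
  obtain c where c: "cmod c \<le> 1 + ?a + e"
    "\<And>\<zeta>. \<zeta> \<in> frontier \<Omega> \<Longrightarrow> cmod (np_operator \<Omega> (poly f) \<zeta> - c) \<le> ?a + e"
    using np_operator_near_constant[OF f e0(1)] by metis
  define \<eta> where "\<eta> = min r \<delta>"
  have \<eta>: "0 < \<eta>" using r \<delta> by (simp add: \<eta>_def)
  have S\<eta>: "separated S \<eta>" by (rule separated_mono[OF S]) (simp add: \<eta>_def)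
  define K where "K = perimeter \<Omega> * M / \<eta>\<^sup>2"
  have K: "0 \<le> K" using bc.L_pos M(1) by (simp add: K_def)
  have "uniformly_continuous_on \<Omega> (bc.layer_potential f)"
    by (rule compact_uniformly_continuous[OF bc.continuous_on_layer_potential compact])
  then obtain d where d: "0 < d" "\<And>z w. z \<in> \<Omega> \<Longrightarrow> w \<in> \<Omega> \<Longrightarrow> dist w z < d \<Longrightarrow>
      dist (bc.layer_potential f w) (bc.layer_potential f z) < e"
    unfolding uniformly_continuous_on_def using e0(1) by metis
  have "bounded ((\<lambda>z. z - z0) ` \<Omega>)"
    by (intro compact_imp_bounded compact_continuous_image compact continuous_intros)
  then obtain B where B: "0 < B" "\<And>z. z \<in> \<Omega> \<Longrightarrow> cmod (z - z0) \<le> B" unfolding bounded_pos by auto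
  \<comment> \<open>In turn: \<open>s\<close> stays nonnegative, boundary points move by less than
    \<open>d\<close>, and the companion form changes by at most \<open>e\<close>.\<close>
  define h where "h = min (1 / 2) (min (d / (2 * B)) (e / (K + 1)))"
  have h: "0 < h" "h \<le> 1 / 2" "h * B < d" "h * K \<le> e"
  proof -
    show "0 < h" using d B e0 K by (auto simp: h_def)
    show "h \<le> 1 / 2" unfolding h_def by (rule min.cobounded1)
    have "h \<le> d / (2 * B)" by (simp add: h_def)
    then have "h * B \<le> d / 2" using B(1) by (simp add: field_simps)
    then show "h * B < d" using d(1) by linarith
    have "h \<le> e / (K + 1)" by (simp add: h_def)
    then have "h * (K + 1) \<le> e" using K by (simp add: field_simps)
    then show "h * K \<le> e" using \<open>0 < h\<close> by (simp add: algebra_simps)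
  qed
  define s where "s = 1 - h"
  have s: "0 \<le> s" "s \<le> 1" "1 - s = h" using h by (auto simp: s_def)
  let ?S = "dilate s S"
  have sepS: "separated ?S \<eta>"
  proof -
    have "\<eta> = (1 - s) * \<eta> + s * \<eta>" by (simp add: algebra_simps)
    also have "\<dots> \<le> (1 - s) * r + s * \<delta>" using s by (intro add_mono mult_left_mono) (auto simp: \<eta>_def)
    finally show ?thesis using separated_mono[OF separated_dilate[OF S s(1,2) r(2)]] by blast
  qed
  \<comment> \<open>The dilate of \<open>S\<close> has gap \<open>\<eta>\<close>, but the shrunk
    copy of \<open>\<Omega>\<close> has only gap \<open>(1 - s) * r\<close>; the approximation needs
    one value for both.\<close>
  define \<delta>' where "\<delta>' = min \<eta> ((1 - s) * r)"
  have \<delta>': "0 < \<delta>'" using \<eta> r h s by (simp add: \<delta>'_def)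
  have sepS': "separated ?S \<delta>'" by (rule separated_mono[OF sepS]) (simp add: \<delta>'_def)
  obtain q where q1: "\<And>z. z \<in> core \<delta>' \<Longrightarrow> z \<in> interior \<Omega> \<Longrightarrow> cmod (poly q z - cnj (bc.layer_potential f z)) \<le> e"
    and q2: "\<And>x y. cmod (cinner (poly_operator q ?S x) y - bc.companion_form f ?S x y) \<le> e * norm x * norm y"
    using bc.companion_polynomial[OF sepS' \<delta>' f e0(1)] by metis
  define Q where "Q = pcompose q [:of_real (1 - s) * z0, of_real s:] - [:cnj c:]"
  have Qop: "poly_operator Q S x = poly_operator q ?S x - cnj c *\<^sub>C x" for x
    by (simp only: Q_def poly_operator_diff[OF separatedD(1)[OF S]] poly_operator_const[OF separatedD(1)[OF S]]
        poly_operator_pcompose_affine[OF separatedD(1)[OF S]] dilate_def[abs_def])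
  have Qz: "poly Q z = poly q (of_real (1 - s) * z0 + of_real s * z) - cnj c" for z
    by (simp add: Q_def poly_pcompose mult.commute)
  have Q_front: "cmod (poly Q z) \<le> ?a + \<epsilon>" if z: "z \<in> frontier \<Omega>" for z
  proof -
    define zs where "zs = of_real (1 - s) * z0 + of_real s * z"
    have z\<Omega>: "z \<in> \<Omega>" using z frontier_subset by blast
    have "zs \<in> core ((1 - s) * r)" unfolding zs_def by (rule core_dilate[OF z\<Omega> s(1,2) r(2)])
    then have zc: "zs \<in> core \<delta>'" by (auto simp: core_def \<delta>'_def min_le_iff_disj)
    have zeq: "zs = z - (1 - s) *\<^sub>R (z - z0)" by (simp add: zs_def scaleR_conv_of_real algebra_simps)
    have zi: "zs \<in> interior \<Omega>" unfolding zeq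
      using h s by (intro mem_interior_convex_shrink[OF convex z0 z\<Omega>]) auto
    have "dist zs z = h * cmod (z - z0)" using s h by (simp add: zeq dist_norm)
    also have "\<dots> \<le> h * B" using B(2)[OF z\<Omega>] h by (intro mult_left_mono) auto
    finally have "dist zs z < d" using h(3) by linarith
    then have "dist (bc.layer_potential f zs) (bc.layer_potential f z) < e"
      using zi interior_subset by (intro d(2) z\<Omega>) auto
    then have 2: "cmod (cnj (bc.layer_potential f zs) - cnj (bc.layer_potential f z)) < e"
      unfolding dist_norm complex_cnj_diff[symmetric] complex_mod_cnj .
    have 3: "cmod (cnj (bc.layer_potential f z) - cnj c) \<le> ?a + e"
      unfolding complex_cnj_diff[symmetric] complex_mod_cnj using c(2)[OF z] by (simp only: np_operator_layer_potential[OF z])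
    have "poly Q z = (poly q zs - cnj (bc.layer_potential f zs))
        + ((cnj (bc.layer_potential f zs) - cnj (bc.layer_potential f z)) + (cnj (bc.layer_potential f z) - cnj c))"
      by (simp add: Qz zs_def)
    then have "cmod (poly Q z) \<le> cmod (poly q zs - cnj (bc.layer_potential f zs))
        + (cmod (cnj (bc.layer_potential f zs) - cnj (bc.layer_potential f z)) + cmod (cnj (bc.layer_potential f z) - cnj c))"
      by (metis norm_triangle_mono norm_triangle_ineq order.refl)
    then show ?thesis using q1[OF zc zi] 2 3 e0(2) by linarith
  qed
  have "cmod (poly Q z) \<le> ?a + \<epsilon>" if "z \<in> \<Omega>" for z
  proof (rule maximum_modulus_frontier[of "poly Q" \<Omega>])
    show "poly Q holomorphic_on interior \<Omega>" by (intro holomorphic_intros)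
    show "continuous_on (closure \<Omega>) (poly Q)" by (intro continuous_intros)
  qed (use compact_imp_bounded[OF compact] Q_front that in auto)
  moreover have "cmod c \<le> 1 + ?a + \<epsilon>" using c(1) e0 by linarith
  moreover have "cmod (cinner (poly_operator f S x) y + cnj (cinner (poly_operator Q S y) x) + c * cinner x y) \<le> (2 + \<epsilon>) * norm x * norm y" for x y
  proof -
    let ?B = "bc.companion_form f"
    have "cnj (cinner (poly_operator Q S y) x) = cnj (cinner (poly_operator q ?S y) x) - c * cinner x y"
      using cinner_commute[of x y] by (simp add: Qop cinner_diff_left cinner_scaleC_left)
    then have "cinner (poly_operator f S x) y + cnj (cinner (poly_operator Q S y) x) + c * cinner x y
      = (cinner (poly_operator f S x) y + cnj (?B S y x))
        + (cnj (cinner (poly_operator q ?S y) x - ?B ?S y x) - cnj (?B S y x - ?B ?S y x))"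
      by (simp add: algebra_simps)
    moreover have "cmod (a + (cnj b - cnj b')) \<le> cmod a + (cmod b + cmod b')" for a b b'
      using norm_triangle_ineq[of a "cnj b - cnj b'"] norm_triangle_ineq4[of "cnj b" "cnj b'"] by simp
    ultimately have "cmod (cinner (poly_operator f S x) y + cnj (cinner (poly_operator Q S y) x) + c * cinner x y)
      \<le> cmod (cinner (poly_operator f S x) y + cnj (?B S y x))
        + (cmod (cinner (poly_operator q ?S y) x - ?B ?S y x) + cmod (?B S y x - ?B ?S y x))"
      by metis
    also have "\<dots> \<le> 2 * norm x * norm y + (e * norm y * norm x + e * norm y * norm x)"
    proof (intro add_mono q2)
      show "cmod (cinner (poly_operator f S x) y + cnj (?B S y x)) \<le> 2 * norm x * norm y"
        by (rule bc.companion_bound[OF S \<delta> f])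
      have "cmod (?B S y x - ?B ?S y x) \<le> (1 - s) * (perimeter \<Omega> * M / \<eta>\<^sup>2) * norm y * norm x"
        by (rule bc.companion_form_dilate[OF S\<eta> sepS \<eta> s(1,2) f M(2)]) (use M(1) in auto)
      also have "\<dots> = (h * K) * (norm y * norm x)" by (simp add: s K_def)
      also have "\<dots> \<le> e * (norm y * norm x)" by (rule mult_right_mono[OF h(4)]) simp
      finally show "cmod (?B S y x - ?B ?S y x) \<le> e * norm y * norm x" by (simp add: mult_ac)
    qed
    also have "\<dots> = (2 + 2 * e) * (norm x * norm y)" by (simp add: algebra_simps)
    also have "\<dots> \<le> (2 + \<epsilon>) * (norm x * norm y)" using e0 by (intro mult_right_mono) auto
    finally show ?thesis by (simp add: mult.assoc)
  qed
  ultimately show ?thesis by blast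
qed

lemma poly_operator_separated_bound:
  fixes S :: "'h::chilbert_space \<Rightarrow> 'h"
  assumes S: "separated S \<delta>" and \<delta>: "0 < \<delta>" and p: "\<And>z. z \<in> \<Omega> \<Longrightarrow> cmod (poly p z) \<le> 1"
  shows "norm (poly_operator p S x) \<le> (1 + sqrt (1 + analytic_configuration_constant \<Omega>)) * norm x"
proof (rule poly_operator_bound[of S _ \<Omega>])
  show "norm (poly_operator f S y) \<le> perimeter \<Omega> / (2 * pi * \<delta>) * norm y"
    if "\<And>z. z \<in> \<Omega> \<Longrightarrow> cmod (poly f z) \<le> 1" for f y
    by (rule bc.poly_operator_finite_bound[OF S \<delta> that])
qed (use separatedD(1)[OF S] configuration_constant_nonneg companion_exists[OF S \<delta>] p in auto)

section \<open>Removal of the gap by letting the dilations tend to the operator\<close>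

lemma poly_operator_dilate_tendsto:
  fixes T :: "'h::chilbert_space \<Rightarrow> 'h"
  assumes T: "bounded_clinear T"
  shows "((\<lambda>s. poly_operator p (dilate s T) x) \<longlongrightarrow> poly_operator p T x) (at_left 1)"
proof (induction p)
  case (pCons a p)
  have clin: "bounded_clinear (dilate s T)" for s
    unfolding dilate_def[abs_def] by (rule bounded_clinear_affine[OF T])
  have "((\<lambda>s. a *\<^sub>C x + ((of_real (1 - s) * z0) *\<^sub>C poly_operator p (dilate s T) x + of_real s *\<^sub>C T (poly_operator p (dilate s T) x)))
      \<longlongrightarrow> a *\<^sub>C x + ((of_real (1 - 1) * z0) *\<^sub>C poly_operator p T x + of_real 1 *\<^sub>C T (poly_operator p T x))) (at_left 1)"
    by (intro tendsto_intros tendsto_scaleC pCons bounded_linear.tendsto[OF bounded_clinearD(1)[OF T]])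
  moreover have "poly_operator (pCons a p) (dilate s T) x = a *\<^sub>C x + ((of_real (1 - s) * z0) *\<^sub>C poly_operator p (dilate s T) x
      + of_real s *\<^sub>C T (poly_operator p (dilate s T) x))" for s
    unfolding poly_operator_pCons[OF clin] by (simp only: dilate_def[of s T "poly_operator p (dilate s T) x"])
  ultimately show ?case by (simp add: poly_operator_pCons[OF T] scaleC_one)
qed simp

end

theorem theorem3:
  fixes T :: "'h::chilbert_space \<Rightarrow> 'h" and p :: "complex poly"
  assumes "bounded_clinear T"
    and "interior (numerical_range T) \<noteq> {}"
  shows "onorm (poly_operator p T)
    \<le> (1 + sqrt (1 + analytic_configuration_constant (closure (numerical_range T))))
        * (SUP z\<in>numerical_range T. cmod (poly p z))"
proof -
  note T = assms(1)
  define \<Omega> where "\<Omega> = closure (numerical_range T)"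
  obtain z0 where z0: "z0 \<in> interior (numerical_range T)" using assms(2) by blast
  interpret convex_body \<Omega> z0
  proof
    show "compact \<Omega>" unfolding \<Omega>_def using bounded_numerical_range[OF T] by (simp add: compact_closure)
    show "convex \<Omega>" unfolding \<Omega>_def by (intro convex_closure convex_numerical_range T)
    show "z0 \<in> interior \<Omega>" unfolding \<Omega>_def using z0 interior_mono[OF closure_subset] by blast
  qed
  define m where "m = (SUP z\<in>numerical_range T. cmod (poly p z))"
  define \<kappa> where "\<kappa> = 1 + sqrt (1 + analytic_configuration_constant \<Omega>)"
  have \<kappa>: "0 \<le> \<kappa>" using configuration_constant_nonneg by (simp add: \<kappa>_def)
  have bdd: "bdd_above ((\<lambda>z. cmod (poly p z)) ` numerical_range T)"
  proof -
    have "bounded ((\<lambda>z. cmod (poly p z)) ` \<Omega>)"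
      by (intro compact_imp_bounded compact_continuous_image compact continuous_intros)
    then show ?thesis using bdd_above_mono[OF bounded_imp_bdd_above] closure_subset unfolding \<Omega>_def by (metis image_mono)
  qed
  have pm: "cmod (poly p z) \<le> m" if z: "z \<in> \<Omega>" for z
  proof (rule continuous_le_on_closure[of "numerical_range T" "\<lambda>z. cmod (poly p z)"])
    show "continuous_on (closure (numerical_range T)) (\<lambda>z. cmod (poly p z))" by (intro continuous_intros)
    show "z \<in> closure (numerical_range T)" using z by (simp add: \<Omega>_def)
    show "cmod (poly p w) \<le> m" if "w \<in> numerical_range T" for w
      unfolding m_def by (rule cSUP_upper[OF that bdd])
  qed
  have m0: "0 \<le> m"
    using pm[of z0] z0 interior_subset closure_subset norm_ge_zero order_trans unfolding \<Omega>_def by blast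
  obtain r where r: "0 < r" "\<And>\<zeta> n. unit_normal \<zeta> n \<Longrightarrow> r \<le> Re (cnj n * (\<zeta> - z0))" using inradius by metis
  have sep0: "separated T 0"
    by (rule separated_numerical_range[OF T]) (use closure_subset in \<open>auto simp: \<Omega>_def\<close>)
  \<comment> \<open>The polynomial is normalised by some \<open>M > m\<close>, since
    \<open>m\<close> may be 0. The limits are taken first in \<open>s\<close>, then in
    \<open>M\<close>.\<close>
  have bound: "norm (poly_operator p (dilate s T) x) \<le> \<kappa> * M * norm x"
    if s: "0 < s" "s < 1" and M: "m < M" for s M x
  proof -
    have sep: "separated (dilate s T) ((1 - s) * r)"
      using separated_dilate[OF sep0 _ _ r(2), of s] s by simp
    have M0: "0 < M" using M m0 by linarith
    have "norm (poly_operator (smult (of_real (1 / M)) p) (dilate s T) x) \<le> \<kappa> * norm x"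
      unfolding \<kappa>_def
    proof (rule poly_operator_separated_bound[OF sep])
      show "cmod (poly (smult (of_real (1 / M)) p) z) \<le> 1" if "z \<in> \<Omega>" for z
        using pm[OF that] M M0 by (simp add: norm_mult norm_divide)
    qed (use s r in auto)
    then show ?thesis using M0 by (simp add: poly_operator_smult[OF separatedD(1)[OF sep]] norm_divide field_simps)
  qed
  have le: "norm (poly_operator p T x) \<le> \<kappa> * M * norm x" if M: "m < M" for x M
  proof (rule tendsto_upperbound[OF tendsto_norm[OF poly_operator_dilate_tendsto[OF T]]])
    show "\<forall>\<^sub>F s in at_left 1. norm (poly_operator p (dilate s T) x) \<le> \<kappa> * M * norm x"
      unfolding eventually_at_left_field using bound M by (intro exI[of _ 0]) auto
  qed simp
  have "norm (poly_operator p T x) \<le> \<kappa> * m * norm x" for x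
  proof (rule tendsto_lowerbound)
    show "((\<lambda>M. \<kappa> * M * norm x) \<longlongrightarrow> \<kappa> * m * norm x) (at_right m)" by (intro tendsto_intros)
    show "\<forall>\<^sub>F M in at_right m. norm (poly_operator p T x) \<le> \<kappa> * M * norm x"
      unfolding eventually_at_right_field using le by (intro exI[of _ "m + 1"]) auto
  qed simp
  then have "onorm (poly_operator p T) \<le> \<kappa> * m" using \<kappa> m0 by (intro onorm_bound) auto
  then show ?thesis by (simp only: \<kappa>_def m_def \<Omega>_def)
qed

end
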